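(* Every simple polygon $P\subseteq\mathbb{R}^2$ satisfies $\operatorname{b}(P)\leq 180\,\operatorname{c}(P)$.
   Context: A simple polygon is regarded as the closed region bounded by a simple closed polygonal curve. $\lambda_k$ denotes $k$-dimensional Lebesgue measure, and $\overline{AB}$ is the closed line segment with endpoints $A,B$. For $P\subseteq\mathbb{R}^2$ let $\operatorname{Seg}(P)=\{(A,B)\in P\times P:\overline{AB}\subseteq P\}\subseteq(\mathbb{R}^2)^2$. The Beer index is $\operatorname{b}(P)=\lambda_4(\operatorname{Seg}(P))/\lambda_2(P)^2$. The convexity ratio is $\operatorname{c}(P)=\operatorname{smc}(P)/\lambda_2(P)$, where $\operatorname{smc}(P)$ is the supremum of the measures of convex subsets of $P$. *)

theory Defs
  imports "HOL-Analysis.Analysis"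
begin

fun polygonal_path :: "'a::real_normed_vector list \<Rightarrow> real \<Rightarrow> 'a" where
  "polygonal_path [] = linepath 0 0"
| "polygonal_path [a] = linepath a a"
| "polygonal_path [a, b] = linepath a b"
| "polygonal_path (a # b # c # vs) = linepath a b +++ polygonal_path (b # c # vs)"

text \<open>
  The vertex list of a closed polygonal curve repeats its first vertex at the end. Degenerate
  lists (constant segments, \<open>[a]\<close>, \<open>[a, b, a]\<close>) never give a \<^const>\<open>simple_path\<close>; consecutive
  collinear edges are allowed. The region is the curve together with the bounded
  component of its complement.
\<close>

definition simple_polygon :: "(real^2) set \<Rightarrow> bool" where
  "simple_polygon P \<longleftrightarrow>
     (\<exists>vs. simple_path (polygonal_path vs) \<and>
           pathfinish (polygonal_path vs) = pathstart (polygonal_path vs) \<and>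
           P = path_image (polygonal_path vs) \<union> inside (path_image (polygonal_path vs)))"

definition Seg :: "(real^2) set \<Rightarrow> ((real^2) \<times> (real^2)) set" where
  "Seg P = {(A, B) \<in> P \<times> P. closed_segment A B \<subseteq> P}"

text \<open>
  \<^const>\<open>lebesgue\<close> is taken on \<open>(real^2) \<times> (real^2)\<close> in the numerator, that is, it is
  4-dimensional Lebesgue measure, and on \<open>real^2\<close> in the denominator.
\<close>

definition beer_index :: "(real^2) set \<Rightarrow> real" where
  "beer_index P = measure lebesgue (Seg P) / (measure lebesgue P)\<^sup>2"

text \<open>
  A real-valued supremum: the set of measures is nonempty (take the empty set) and, for
  bounded measurable \<open>P\<close>, bounded above (\<open>bdd_above_convex_measures\<close> below).
\<close>

definition smc :: "(real^2) set \<Rightarrow> real" where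
  "smc P = Sup {measure lebesgue C |C. convex C \<and> C \<subseteq> P}"

definition convexity_ratio :: "(real^2) set \<Rightarrow> real" where
  "convexity_ratio P = smc P / measure lebesgue P"

lemma compact_simple_polygon:
  assumes "simple_polygon P"
  shows "compact P"
proof -
  obtain vs where s: "simple_path (polygonal_path vs)"
    and P: "P = path_image (polygonal_path vs) \<union> inside (path_image (polygonal_path vs))"
    using assms unfolding simple_polygon_def by blast
  let ?S = "path_image (polygonal_path vs)"
  have c: "compact ?S"
    using s by (simp add: compact_simple_path_image)
  have "bounded (inside ?S)"
    using c by (simp add: bounded_inside compact_imp_bounded)
  moreover have "closed (?S \<union> inside ?S)"
    using c by (simp add: closed_path_image_Un_inside s simple_path_imp_path)
  ultimately show ?thesis
    unfolding P using c by (simp add: compact_eq_bounded_closed)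
qed

lemma bdd_above_convex_measures:
  fixes P :: "(real^2) set"
  assumes "bounded P" "P \<in> sets lebesgue"
  shows "bdd_above {measure lebesgue C |C. convex C \<and> C \<subseteq> P}"
proof (rule bdd_aboveI[where M = "measure lebesgue P"])
  fix x assume "x \<in> {measure lebesgue C |C. convex C \<and> C \<subseteq> P}"
  then obtain C where C: "x = measure lebesgue C" "convex C" "C \<subseteq> P" by blast
  have "C \<in> lmeasurable"
    using C assms bounded_subset measurable_convex by blast
  moreover have "P \<in> lmeasurable"
    using assms bounded_set_imp_lmeasurable by blast
  ultimately show "x \<le> measure lebesgue P"
    using C measure_mono_fmeasurable fmeasurableD by metis
qed

lemma closed_Seg:
  assumes "closed P"
  shows "closed (Seg P)"
proof -
  have "Seg P = (\<Inter>u\<in>{0..1}. (\<lambda>z. (1 - u) *\<^sub>R fst z + u *\<^sub>R snd z) -` P)"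
  proof (intro equalityI subsetI)
    fix z assume "z \<in> Seg P"
    then show "z \<in> (\<Inter>u\<in>{0..1}. (\<lambda>z. (1 - u) *\<^sub>R fst z + u *\<^sub>R snd z) -` P)"
      by (force simp: Seg_def closed_segment_def)
  next
    fix z assume *: "z \<in> (\<Inter>u\<in>{0..1}. (\<lambda>z. (1 - u) *\<^sub>R fst z + u *\<^sub>R snd z) -` P)"
    then have "closed_segment (fst z) (snd z) \<subseteq> P"
      by (auto simp: closed_segment_def)
    then show "z \<in> Seg P"
      using ends_in_segment by (cases z) (fastforce simp: Seg_def)
  qed
  also have "closed \<dots>"
    by (intro closed_INT ballI closed_vimage assms continuous_intros)
  finally show ?thesis .
qed

end

theory Submission
  imports Defs
begin

text \<open>
  The interior \<open>G\<close> of the polygon is cut by chords into a tree of bodies. Starting from the two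
  sides of some chord, the body of an oriented chord (a window) consists of the points on its
  positive side that see it, and the boundary of a body inside \<open>G\<close> consists of chords lying on lines
  through the parent chord; these are the windows of the next generation. Two mutually visible
  points lie in the same body, in a body and one of its children, in two children of the same body,
  or on the two sides of the initial chord.

  Since \<open>P\<close> has connected complement, it contains every triangle whose sides it contains. Hence if
  \<open>A\<close> and \<open>B\<close> see each other and both see a common chord, then \<open>P\<close> contains a triangle whose area is
  comparable to the width of the configuration. This confines the points \<open>B\<close> that are visible from
  \<open>A\<close> and closer than \<open>A\<close> to the relevant window to a region of area at most \<open>90 smc P\<close>. Every
  visible pair is charged in this way to one of its two points, which gives the constant \<open>2 \<cdot> 90\<close>.
\<close>

section \<open>Triangles and half-planes\<close>

text \<open>Pairs are oriented by height over the parent's window, because a triangle over a window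
  controls those \<open>B\<close> that are not higher than \<open>A\<close>. The obstacle is a pair
  that \<open>A\<close> sees through its own window: \<open>A\<close> need not see the parent's
  window at all. If \<open>B\<close> is at most k times as far beyond the window of \<open>A\<close>
  as \<open>A\<close> is in front of it, the triangle over the visible part of that window, enlarged
  k + 1 times, contains \<open>B\<close>; its area is at most (k + 1)^2 times \<open>smc P\<close>.
  If \<open>B\<close> is farther, the crossing point is so close to \<open>A\<close> that it can
  replace \<open>A\<close> as apex over the parent's window, which leads to 16 k (k + 1) / (k - 1)^2
  times \<open>smc P\<close>. Among the integers the sum of the two is least at k = 4, with 25 +
  320/9, rounded to 25 + 36. Partners in the body of \<open>A\<close> and in its children need 28
  more, so the total is 89. The tree lives in the open set \<open>G\<close>. The polygonal shape
  enters at the end, in showing that almost every segment in \<open>P\<close> avoids the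
  boundary.\<close>

definition wedge :: "real^2 \<Rightarrow> real^2 \<Rightarrow> real" where
  "wedge x y = x$1 * y$2 - x$2 * y$1"

lemma wedge_simps [simp]:
  "wedge 0 x = 0" "wedge x 0 = 0" "wedge x x = 0"
  "wedge (- x) y = - wedge x y" "wedge x (- y) = - wedge x y"
  "wedge (c *\<^sub>R x) y = c * wedge x y" "wedge x (c *\<^sub>R y) = c * wedge x y"
  by (auto simp: wedge_def algebra_simps)

lemma wedge_add_left: "wedge (x + y) z = wedge x z + wedge y z"
  and wedge_add_right: "wedge z (x + y) = wedge z x + wedge z y"
  and wedge_diff_left: "wedge (x - y) z = wedge x z - wedge y z"
  and wedge_diff_right: "wedge z (x - y) = wedge z x - wedge z y"
  by (auto simp: wedge_def algebra_simps)

lemmas wedge_linear = wedge_add_left wedge_add_right wedge_diff_left wedge_diff_right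

lemma wedge_commute: "wedge x y = - wedge y x"
  by (simp add: wedge_def)

lemma continuous_on_wedge [continuous_intros]:
  "continuous_on S f \<Longrightarrow> continuous_on S g \<Longrightarrow> continuous_on S (\<lambda>x. wedge (f x) (g x))"
  unfolding wedge_def by (intro continuous_intros)

lemma tendsto_wedge [tendsto_intros]:
  "(f \<longlongrightarrow> a) F \<Longrightarrow> (g \<longlongrightarrow> b) F \<Longrightarrow> ((\<lambda>x. wedge (f x) (g x)) \<longlongrightarrow> wedge a b) F"
  unfolding wedge_def by (intro tendsto_intros)

text \<open>Cramer's rule, the source of all skew coordinates below.\<close>

lemma wedge_basis:
  assumes "wedge a b \<noteq> 0"
  shows "x = (wedge x b / wedge a b) *\<^sub>R a + (wedge a x / wedge a b) *\<^sub>R b"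
proof -
  have "wedge a b *\<^sub>R x = wedge x b *\<^sub>R a + wedge a x *\<^sub>R b"
    by (simp add: vec_eq_iff forall_2 wedge_def algebra_simps)
  then have "(1 / wedge a b) *\<^sub>R (wedge a b *\<^sub>R x) = (1 / wedge a b) *\<^sub>R (wedge x b *\<^sub>R a + wedge a x *\<^sub>R b)"
    by simp
  then show ?thesis using assms by (simp add: scaleR_add_right)
qed

lemma wedge_eq_0_iff:
  assumes "a \<noteq> 0"
  shows "wedge a x = 0 \<longleftrightarrow> (\<exists>c. x = c *\<^sub>R a)"
proof
  assume w: "wedge a x = 0"
  have n: "a$1 * a$1 + a$2 * a$2 \<noteq> 0"
    using assms sum_squares_eq_zero_iff[of "a$1" "a$2"] by (auto simp: vec_eq_iff forall_2)
  have eq: "a$1 * x$2 = a$2 * x$1"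
    using w by (simp add: wedge_def)
  have "a$2 * (a$2 * x$1) = a$2 * (a$1 * x$2)" "a$1 * (a$1 * x$2) = a$1 * (a$2 * x$1)"
    by (simp_all only: eq)
  then have "(a$1 * a$1 + a$2 * a$2) *\<^sub>R x = (a$1 * x$1 + a$2 * x$2) *\<^sub>R a"
    by (simp add: vec_eq_iff forall_2 algebra_simps)
  then have "(1 / (a$1 * a$1 + a$2 * a$2)) *\<^sub>R ((a$1 * a$1 + a$2 * a$2) *\<^sub>R x) =
      (1 / (a$1 * a$1 + a$2 * a$2)) *\<^sub>R ((a$1 * x$1 + a$2 * x$2) *\<^sub>R a)"
    by simp
  then have "x = ((a$1 * x$1 + a$2 * x$2) / (a$1 * a$1 + a$2 * a$2)) *\<^sub>R a"
    using n by (simp only: scaleR_scaleR) (simp add: divide_simps del: sum_squares_eq_zero_iff)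
  then show "\<exists>c. x = c *\<^sub>R a" by blast
qed auto

lemma measure_triangle:
  "measure lebesgue (convex hull {a, b, c :: real^2}) = \<bar>wedge (b - a) (c - a)\<bar> / 2"
proof -
  have "compact (convex hull {a, b, c})"
    by (simp add: finite_imp_compact_convex_hull)
  then have "measure lebesgue (convex hull {a, b, c}) = measure lborel (convex hull {a, b, c})"
    by (simp add: borel_compact measure_completion)
  also have "\<dots> = \<bar>wedge (b - a) (c - a)\<bar> / 2"
    unfolding content_triangle by (simp add: wedge_def algebra_simps abs_minus_commute)
  finally show ?thesis .
qed

text \<open>A connected set that meets both \<open>K\<close> and its complement meets
  \<open>frontier K\<close>. The set \<open>- P\<close> cannot lie inside \<open>K\<close>, because
  \<open>P\<close> and \<open>K\<close> are bounded and the plane is not. Triangles, and unions of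
  two triangles with a common side, are filled this way.\<close>

lemma subset_if_frontier_subset:
  fixes P K :: "(real^2) set"
  assumes "connected (- P)" "bounded P" "bounded K" "frontier K \<subseteq> P"
  shows "K \<subseteq> P"
proof (rule ccontr)
  assume "\<not> K \<subseteq> P"
  then have "- P \<inter> K \<noteq> {}" by blast
  moreover have "- P - K \<noteq> {}"
  proof
    assume "- P - K = {}"
    then have "UNIV = P \<union> K" by blast
    then show False
      using assms not_bounded_UNIV by (metis bounded_Un)
  qed
  ultimately show False
    using connected_Int_frontier[OF assms(1)] assms(4) by blast
qed

lemma triangle_subset:
  fixes P :: "(real^2) set"
  assumes "connected (- P)" "bounded P"
    and "closed_segment a b \<subseteq> P" "closed_segment b c \<subseteq> P" "closed_segment c a \<subseteq> P"
  shows "convex hull {a, b, c} \<subseteq> P"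
  by (rule subset_if_frontier_subset)
    (use assms in \<open>auto simp: frontier_of_triangle intro!: bounded_convex_hull\<close>)

lemma triangle_interiorI:
  fixes a b c x :: "real^2"
  assumes w: "wedge (b - a) (c - a) \<noteq> 0"
    and x: "x = u *\<^sub>R a + v *\<^sub>R b + t *\<^sub>R c" "u > 0" "v > 0" "t > 0" "u + v + t = 1"
  shows "x \<in> interior (convex hull {a, b, c})"
proof -
  \<comment> \<open>The triangle in barycentric coordinates with strict inequalities, written as an
    open condition.\<close>
  define U where "U = {x. wedge (x - a) (c - a) / wedge (b - a) (c - a) > 0 \<and>
      wedge (b - a) (x - a) / wedge (b - a) (c - a) > 0 \<and>
      wedge (x - a) (c - a) / wedge (b - a) (c - a) + wedge (b - a) (x - a) / wedge (b - a) (c - a) < 1}"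
  have "open U" unfolding U_def
    by (intro open_Collect_conj open_Collect_less continuous_intros) (use w in auto)
  moreover have "U \<subseteq> convex hull {a, b, c}"
  proof
    fix y assume y: "y \<in> U"
    define p where "p = wedge (y - a) (c - a) / wedge (b - a) (c - a)"
    define q where "q = wedge (b - a) (y - a) / wedge (b - a) (c - a)"
    have "y - a = p *\<^sub>R (b - a) + q *\<^sub>R (c - a)"
      unfolding p_def q_def by (rule wedge_basis[OF w])
    then have "y = (1 - p - q) *\<^sub>R a + p *\<^sub>R b + q *\<^sub>R c"
      by (simp add: algebra_simps)
    moreover have "0 \<le> p" "0 \<le> q" "0 \<le> 1 - p - q"
      using y unfolding U_def p_def q_def by auto
    ultimately show "y \<in> convex hull {a, b, c}"
      unfolding convex_hull_3 by force
  qed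
  moreover have "x \<in> U"
  proof -
    have u: "u = 1 - v - t" using x by simp
    have "x - a = v *\<^sub>R (b - a) + t *\<^sub>R (c - a)"
      unfolding x u by (simp add: algebra_simps)
    then have "wedge (x - a) (c - a) = v * wedge (b - a) (c - a)"
      "wedge (b - a) (x - a) = t * wedge (b - a) (c - a)"
      by (simp_all add: wedge_add_left wedge_add_right)
    then show ?thesis using w x unfolding U_def by auto
  qed
  ultimately show ?thesis by (meson interiorI)
qed

text \<open>Twice the signed area of the triangle \<open>v\<close>, \<open>u\<close>,
  \<open>x\<close>, hence the signed distance from the line scaled by the length of
  \<open>u - v\<close>. The scale is harmless, since heights are compared only over the same
  line.\<close>

definition ht :: "real^2 \<Rightarrow> real^2 \<Rightarrow> real^2 \<Rightarrow> real" where
  "ht v u x = wedge (u - v) (x - v)"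

lemma ht_ends [simp]: "ht v u v = 0" "ht v u u = 0"
  by (simp_all add: ht_def)

lemma ht_swap: "ht u v x = - ht v u x"
  by (simp add: ht_def wedge_def algebra_simps)

lemma ht_affine: "ht v u ((1 - t) *\<^sub>R x + t *\<^sub>R y) = (1 - t) * ht v u x + t * ht v u y"
  by (simp add: ht_def wedge_def algebra_simps)

lemma ht_affine': "ht v u (x + t *\<^sub>R (y - x)) = (1 - t) * ht v u x + t * ht v u y"
  by (simp add: ht_def wedge_def algebra_simps)

lemma continuous_on_ht [continuous_intros]:
  "continuous_on S f \<Longrightarrow> continuous_on S (\<lambda>x. ht v u (f x))"
  unfolding ht_def by (intro continuous_intros)

lemma open_ht_gt: "open {x. ht v u x > 0}" and open_ht_lt: "open {x. ht v u x < 0}"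
  by (intro open_Collect_less continuous_intros)+

lemma convex_ht_gt: "convex {x. ht v u x > 0}"
proof -
  have "(1 - t) * ht v u x + t * ht v u y > 0"
    if "ht v u x > 0" "ht v u y > 0" "0 \<le> t" "t \<le> 1" for x y t
    using that by (cases "t = 0") (auto intro!: add_nonneg_pos)
  then show ?thesis by (simp add: convex_alt ht_affine)
qed

lemma convex_ht_lt: "convex {x. ht v u x < 0}"
  using convex_ht_gt[of u v] by (simp add: ht_swap[of u v])

lemma ht_eq_0_iff: "v \<noteq> u \<Longrightarrow> ht v u x = 0 \<longleftrightarrow> (\<exists>t. x = v + t *\<^sub>R (u - v))"
  unfolding ht_def by (subst wedge_eq_0_iff) (auto simp: algebra_simps)

lemma in_open_segment_iff:
  fixes a b :: "'a::real_vector"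
  shows "x \<in> open_segment a b \<longleftrightarrow> a \<noteq> b \<and> (\<exists>t. 0 < t \<and> t < 1 \<and> x = a + t *\<^sub>R (b - a))"
  by (auto simp: in_segment algebra_simps)

lemma in_closed_segment_iff:
  fixes a b :: "'a::real_vector"
  shows "x \<in> closed_segment a b \<longleftrightarrow> (\<exists>t. 0 \<le> t \<and> t \<le> 1 \<and> x = a + t *\<^sub>R (b - a))"
  by (auto simp: in_segment algebra_simps)

lemma ht_open_segment: "x \<in> open_segment v u \<Longrightarrow> ht v u x = 0"
  by (auto simp: in_open_segment_iff ht_affine')

section \<open>Neighbourhoods of segments\<close>

lemma open_segments_visible:
  fixes G :: "'a::real_normed_vector set"
  assumes "open G"
  shows "open {(x, y). closed_segment x y \<subseteq> G}"
proof (rule Topological_Spaces.openI)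
  fix p assume "p \<in> {(x, y). closed_segment x y \<subseteq> G}"
  then obtain x y where p: "p = (x, y)" and xy: "closed_segment x y \<subseteq> G"
    by blast
  obtain e where e: "e > 0" "(\<Union>z\<in>closed_segment x y. ball z e) \<subseteq> G"
    using compact_subset_open_imp_ball_epsilon_subset[OF compact_segment assms xy] by blast
  show "\<exists>T. open T \<and> p \<in> T \<and> T \<subseteq> {(x, y). closed_segment x y \<subseteq> G}"
  proof (rule exI[of _ "ball x e \<times> ball y e"], intro conjI)
    show "open (ball x e \<times> ball y e)" "p \<in> ball x e \<times> ball y e"
      using e by (auto intro: open_Times simp: p)
    have "w \<in> G" if *: "x' \<in> ball x e" "y' \<in> ball y e" "w \<in> closed_segment x' y'" for x' y' w
    proof -
      from * obtain t where t: "0 \<le> t" "t \<le> 1" "w = (1 - t) *\<^sub>R x' + t *\<^sub>R y'"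
        by (auto simp: in_segment)
      define z where "z = (1 - t) *\<^sub>R x + t *\<^sub>R y"
      have "z \<in> closed_segment x y" using t by (auto simp: in_segment z_def)
      moreover have "dist z w < e"
      proof -
        have "z - w = (1 - t) *\<^sub>R (x - x') + t *\<^sub>R (y - y')"
          by (simp add: z_def t algebra_simps)
        then have "norm (z - w) \<le> (1 - t) * norm (x - x') + t * norm (y - y')"
          using norm_triangle_ineq[of "(1 - t) *\<^sub>R (x - x')" "t *\<^sub>R (y - y')"] t by simp
        also have "\<dots> < e"
          using * t by (intro convex_bound_lt) (auto simp: dist_norm)
        finally show ?thesis by (simp add: dist_norm)
      qed
      ultimately show "w \<in> G" using e(2) by (meson UN_I mem_ball subsetD)
    qed
    then show "ball x e \<times> ball y e \<subseteq> {(x, y). closed_segment x y \<subseteq> G}"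
      by blast
  qed
qed

lemma segment_point_near:
  fixes x y :: "'a::real_normed_vector"
  assumes "e > 0"
  shows "\<exists>s. 0 < s \<and> s < 1 \<and> y + s *\<^sub>R (x - y) \<in> ball y e"
proof -
  \<comment> \<open>The summand 1 keeps the denominator positive when \<open>x = y\<close>.\<close>
  define s where "s = min (1/2) (e / (2 * (norm (x - y) + 1)))"
  have s: "0 < s" "s < 1" using assms by (auto simp: s_def add_nonneg_pos)
  have "s * norm (x - y) \<le> e / (2 * (norm (x - y) + 1)) * (norm (x - y) + 1)"
    using assms by (intro mult_mono) (auto simp: s_def)
  also have "\<dots> = e / 2"
  proof -
    have "norm (x - y) + 1 \<noteq> 0" using norm_ge_zero[of "x - y"] by linarith
    then show ?thesis by (simp add: field_simps)
  qed
  finally have "s * norm (x - y) < e" using assms by linarith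
  then show ?thesis using s by (intro exI[of _ s]) (auto simp: dist_norm)
qed

lemma line_nbhd:
  fixes y d :: "'a::real_normed_vector"
  assumes "open U" "\<And>\<tau>. t1 \<le> \<tau> \<Longrightarrow> \<tau> \<le> t2 \<Longrightarrow> y + \<tau> *\<^sub>R d \<in> U"
  obtains e where "e > 0" "\<And>\<tau> x. t1 \<le> \<tau> \<Longrightarrow> \<tau> \<le> t2 \<Longrightarrow> x \<in> ball (y + \<tau> *\<^sub>R d) e \<Longrightarrow> x \<in> U"
proof -
  let ?K = "(\<lambda>\<tau>. y + \<tau> *\<^sub>R d) ` {t1..t2}"
  have "compact ?K" by (intro compact_continuous_image continuous_intros) auto
  moreover have "?K \<subseteq> U" using assms(2) by auto
  ultimately obtain e where "e > 0" "(\<Union>z\<in>?K. ball z e) \<subseteq> U"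
    using compact_subset_open_imp_ball_epsilon_subset[OF _ assms(1)] by metis
  then show ?thesis using that[of e] by fastforce
qed

lemma closed_segment_parts:
  fixes a b z :: "'a::euclidean_space"
  assumes "z \<in> closed_segment a b"
  shows "closed_segment a z \<subseteq> closed_segment a b" "closed_segment z b \<subseteq> closed_segment a b"
  using assms by (simp_all add: subset_closed_segment)

text \<open>The points \<open>a\<close> and \<open>q\<close> lie strictly on opposite sides of the
  line \<open>bp\<close>, so each half of a small disc about a point of the common side is covered
  by one of the two triangles.\<close>

lemma open_segment_in_interior_Un:
  fixes a b p q :: "real^2"
  assumes opp: "wedge (b - p) (a - p) * wedge (b - p) (q - p) < 0"
  shows "open_segment b p \<subseteq> interior (convex hull {a, b, p} \<union> convex hull {b, q, p})"
proof
  fix x assume "x \<in> open_segment b p"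
  then obtain t where t: "0 < t" "t < 1" "x = p + t *\<^sub>R (b - p)"
    unfolding open_segment_commute[of b p] by (auto simp: in_open_segment_iff)
  \<comment> \<open>The coordinates of \<open>y - p\<close> along \<open>b - p\<close> and along the
    third vertex. The set \<open>U\<close> leaves the sign of \<open>cg\<close> open, since that
    sign decides which triangle contains \<open>y\<close>.\<close>
  define cf where "cf a y = wedge (y - p) (a - p) / wedge (b - p) (a - p)" for a y
  define cg where "cg a y = wedge (b - p) (y - p) / wedge (b - p) (a - p)" for a y
  define U where "U = {y. cf a y > 0 \<and> cf a y + cg a y < 1 \<and> cf q y > 0 \<and> cf q y + cg q y < 1}"
  have nz: "wedge (b - p) (a - p) \<noteq> 0" "wedge (b - p) (q - p) \<noteq> 0" using opp by auto
  have "open U" unfolding U_def cf_def cg_def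
    by (intro open_Collect_conj open_Collect_less continuous_intros) (use nz in auto)
  moreover have "x \<in> U"
    using nz t by (simp add: U_def cf_def cg_def)
  moreover have "U \<subseteq> convex hull {a, b, p} \<union> convex hull {b, q, p}"
  proof
    fix y assume y: "y \<in> U"
    have mem: "y = cg w y *\<^sub>R w + cf w y *\<^sub>R b + (1 - cf w y - cg w y) *\<^sub>R p"
      if "wedge (b - p) (w - p) \<noteq> 0" for w
    proof -
      have "y - p = cf w y *\<^sub>R (b - p) + cg w y *\<^sub>R (w - p)"
        unfolding cf_def cg_def by (rule wedge_basis[OF that])
      then show ?thesis by (simp add: algebra_simps)
    qed
    have "cg a y \<ge> 0 \<or> cg q y \<ge> 0"
      using opp unfolding cg_def by (auto simp: divide_simps mult_less_0_iff split: if_splits)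
    then show "y \<in> convex hull {a, b, p} \<union> convex hull {b, q, p}"
    proof
      assume "cg a y \<ge> 0"
      then have "y \<in> convex hull {a, b, p}"
        using mem[OF nz(1)] y unfolding convex_hull_3 U_def by (smt (verit) mem_Collect_eq)
      then show ?thesis by blast
    next
      assume "cg q y \<ge> 0"
      then have "y \<in> convex hull {q, b, p}"
        using mem[OF nz(2)] y unfolding convex_hull_3 U_def by (smt (verit) mem_Collect_eq)
      then show ?thesis by (simp add: insert_commute)
    qed
  qed
  ultimately show "x \<in> interior (convex hull {a, b, p} \<union> convex hull {b, q, p})"
    by (meson interiorI)
qed

section \<open>Areas of parallelograms and of homothetic images\<close>

lemma measure_parallelogram:
  fixes a d p :: "real^2"
  assumes k: "wedge d a = k" "k \<noteq> 0" and ab: "\<alpha>1 \<le> \<alpha>2" "\<beta>1 \<le> \<beta>2"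
  defines "S \<equiv> {x. \<alpha>1 \<le> wedge a (x - p) \<and> wedge a (x - p) \<le> \<alpha>2 \<and>
    \<beta>1 \<le> wedge d (x - p) / k \<and> wedge d (x - p) / k \<le> \<beta>2}"
  shows "S \<in> lmeasurable" "measure lebesgue S = (\<alpha>2 - \<alpha>1) * (\<beta>2 - \<beta>1)"
proof -
  \<comment> \<open>\<open>f\<close> inverts the coordinates: \<open>wedge a (f w) = w$1\<close> and
    \<open>wedge d (f w) / k = w$2\<close>. One coordinate is kept as an area and the other is
    divided by \<open>k\<close>, so the determinant is -1 and the area is a plain product.\<close>
  define f :: "real^2 \<Rightarrow> real^2" where "f w = (w$2) *\<^sub>R a + (- (w$1 / k)) *\<^sub>R d" for w
  have lin: "linear f"
    by (rule linearI) (auto simp: f_def algebra_simps add_divide_distrib)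
  have ad: "wedge a d = - k" using k wedge_commute by metis
  let ?B = "cbox (vector [\<alpha>1, \<beta>1]) (vector [\<alpha>2, \<beta>2]) :: (real^2) set"
  have "S = (+) p ` f ` ?B"
  proof (intro equalityI subsetI)
    fix x assume x: "x \<in> S"
    define w :: "real^2" where "w = vector [wedge a (x - p), wedge d (x - p) / k]"
    have "x - p = (wedge (x - p) a / wedge d a) *\<^sub>R d + (wedge d (x - p) / wedge d a) *\<^sub>R a"
      by (rule wedge_basis) (use k in auto)
    then have "x = p + f w" by (simp add: f_def w_def k wedge_commute[of "x - p" a] algebra_simps)
    moreover have "w \<in> ?B" using x by (auto simp: w_def S_def mem_box_cart forall_2)
    ultimately show "x \<in> (+) p ` f ` ?B" by blast
  next
    fix x assume "x \<in> (+) p ` f ` ?B"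
    then obtain w where w: "w \<in> ?B" "x = p + f w" by blast
    have "wedge a (x - p) = w$1" "wedge d (x - p) / k = w$2"
      using k(2) by (simp_all add: w f_def wedge_add_right wedge_diff_right ad k(1))
    then show "x \<in> S" using w(1) by (auto simp: S_def mem_box_cart forall_2)
  qed
  moreover have "\<bar>det (matrix f)\<bar> = 1"
  proof -
    have "det (matrix f) = - 1"
    proof -
      have kd: "d$1 * a$2 = k + a$1 * d$2" using k(1) by (simp add: wedge_def algebra_simps)
      have "det (matrix f) = - (d$1 * a$2 / k) + a$1 * d$2 / k"
        by (simp add: det_2 matrix_def f_def axis_def)
      then show ?thesis unfolding kd using k(2) by (simp add: add_divide_distrib)
    qed
    then show ?thesis by simp
  qed
  moreover have "measure lebesgue ?B = (\<alpha>2 - \<alpha>1) * (\<beta>2 - \<beta>1)"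
  proof -
    have "?B \<noteq> {}" using ab by (simp add: interval_ne_empty_cart forall_2)
    then show ?thesis by (simp add: content_cbox_cart UNIV_2)
  qed
  moreover have "?B \<in> lmeasurable" by simp
  ultimately show "S \<in> lmeasurable" "measure lebesgue S = (\<alpha>2 - \<alpha>1) * (\<beta>2 - \<beta>1)"
    using measurable_linear_image[OF lin] measure_linear_image[OF lin]
    by (simp_all add: measurable_translation measure_translation)
qed

lemma measure_homothety:
  fixes S :: "(real^2) set"
  assumes "S \<in> lmeasurable"
  shows "(\<lambda>x. a + r *\<^sub>R (x - a)) ` S \<in> lmeasurable"
    "measure lebesgue ((\<lambda>x. a + r *\<^sub>R (x - a)) ` S) = r\<^sup>2 * measure lebesgue S"
proof -
  have eq: "(\<lambda>x. a + r *\<^sub>R (x - a)) ` S = (+) (a - r *\<^sub>R a) ` (*\<^sub>R) r ` S"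
    by (auto simp: image_image algebra_simps)
  have lin: "linear ((*\<^sub>R) r :: real^2 \<Rightarrow> real^2)" by (rule linear_scale_self)
  show "(\<lambda>x. a + r *\<^sub>R (x - a)) ` S \<in> lmeasurable"
    "measure lebesgue ((\<lambda>x. a + r *\<^sub>R (x - a)) ` S) = r\<^sup>2 * measure lebesgue S"
    unfolding eq using measurable_linear_image[OF lin assms] measure_linear_image[OF lin assms]
    by (simp_all add: measurable_translation measure_translation)
qed

section \<open>The Jordan curve theorem in the real plane\<close>

text \<open>A linear homeomorphism that carries inside, outside and frontier along, and with them
  the Jordan and theta curve theorems for paths in \<open>complex\<close>.\<close>

definition to_complex :: "real^2 \<Rightarrow> complex" where
  "to_complex x = Complex (x$1) (x$2)"

lemma linear_to_complex: "linear to_complex"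
  by (rule linearI) (auto simp: to_complex_def complex_eq_iff)

definition of_complex :: "complex \<Rightarrow> real^2" where
  "of_complex z = vector [Re z, Im z]"

lemma linear_of_complex: "linear of_complex"
  by (rule linearI) (auto simp: of_complex_def vec_eq_iff forall_2)

lemma to_of_complex [simp]: "to_complex (of_complex z) = z" "of_complex (to_complex x) = x"
  by (simp_all add: of_complex_def to_complex_def vec_eq_iff forall_2)

lemma bij_to_complex: "bij to_complex"
  by (rule o_bij[of of_complex]) auto

lemma inj_to_complex: "inj to_complex"
  using bij_to_complex bij_is_inj by blast

lemma to_complex_image_Compl: "to_complex ` (- S) = - to_complex ` S"
  by (simp add: bij_to_complex bij_image_Compl_eq)

lemma of_complex_image_image [simp]: "of_complex ` to_complex ` S = S" "to_complex ` of_complex ` T = T"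
  by (auto simp: image_image)

lemma continuous_to_complex: "continuous_on S to_complex" "continuous_on T of_complex"
  by (auto simp: linear_to_complex linear_of_complex linear_continuous_on linear_conv_bounded_linear[symmetric])

lemma connected_to_complex_iff: "connected (to_complex ` S) \<longleftrightarrow> connected S"
  by (metis connected_continuous_image continuous_to_complex of_complex_image_image(1))

lemma bounded_to_complex_iff: "bounded (to_complex ` S) \<longleftrightarrow> bounded S"
  by (metis bounded_linear_image linear_conv_bounded_linear linear_to_complex linear_of_complex
      of_complex_image_image(1))

lemma connected_component_to_complex:
  "connected_component (to_complex ` S) (to_complex x) (to_complex y) \<longleftrightarrow> connected_component S x y"
proof
  assume "connected_component (to_complex ` S) (to_complex x) (to_complex y)"
  then obtain C where C: "connected C" "C \<subseteq> to_complex ` S" "to_complex x \<in> C" "to_complex y \<in> C"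
    unfolding connected_component_def by blast
  have "connected (of_complex ` C)"
    by (metis C(1) connected_to_complex_iff of_complex_image_image(2))
  moreover have "of_complex ` C \<subseteq> S" using C(2) by (metis image_mono of_complex_image_image(1))
  moreover have "x \<in> of_complex ` C" "y \<in> of_complex ` C"
    using C(3,4) by (metis image_eqI to_of_complex(2))+
  ultimately show "connected_component S x y"
    unfolding connected_component_def by blast
next
  assume "connected_component S x y"
  then obtain C where C: "connected C" "C \<subseteq> S" "x \<in> C" "y \<in> C"
    unfolding connected_component_def by blast
  then show "connected_component (to_complex ` S) (to_complex x) (to_complex y)"
    unfolding connected_component_def
    by (metis connected_to_complex_iff image_eqI image_mono)
qed

text \<open>Components of the complements correspond under the bijection, and boundedness is
  preserved in both directions.\<close>

lemma inside_to_complex: "inside (to_complex ` S) = to_complex ` inside S"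
proof -
  have *: "to_complex x \<in> inside (to_complex ` S) \<longleftrightarrow> x \<in> inside S" for x
  proof -
    have "connected_component_set (- to_complex ` S) (to_complex x) =
        to_complex ` connected_component_set (- S) x"
      unfolding to_complex_image_Compl[symmetric]
      by (auto simp: image_iff connected_component_to_complex[symmetric])
        (metis connected_component_to_complex to_of_complex(1))
    then show ?thesis
      unfolding inside_def by (auto simp: bounded_to_complex_iff inj_image_mem_iff[OF inj_to_complex])
  qed
  show ?thesis
    by (metis (no_types, opaque_lifting) * Set.set_eqI image_iff to_of_complex(1))
qed

lemma outside_to_complex: "outside (to_complex ` S) = to_complex ` outside S"
  by (simp add: outside_inside inside_to_complex to_complex_image_Compl[symmetric]
      flip: image_Un)

lemma frontier_to_complex: "frontier (to_complex ` S) = to_complex ` frontier S"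
  by (simp add: frontier_closures closure_injective_linear_image linear_to_complex inj_to_complex
      image_Int flip: to_complex_image_Compl)

theorem Jordan_inside_outside_plane:
  fixes c :: "real \<Rightarrow> real^2"
  assumes "simple_path c" "pathfinish c = pathstart c"
  shows "inside (path_image c) \<noteq> {}" "connected (inside (path_image c))"
    "connected (outside (path_image c))" "frontier (inside (path_image c)) = path_image c"
    "frontier (outside (path_image c)) = path_image c"
proof -
  have "simple_path (to_complex \<circ> c)"
    using assms(1) by (simp add: simple_path_linear_image_eq linear_to_complex inj_to_complex)
  moreover have "pathfinish (to_complex \<circ> c) = pathstart (to_complex \<circ> c)"
    using assms(2) by (simp add: pathfinish_def pathstart_def)
  moreover have "path_image (to_complex \<circ> c) = to_complex ` path_image c"
    by (simp add: path_image_linear_image linear_to_complex)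
  ultimately show "inside (path_image c) \<noteq> {}" "connected (inside (path_image c))"
    "connected (outside (path_image c))" "frontier (inside (path_image c)) = path_image c"
    "frontier (outside (path_image c)) = path_image c"
    using Jordan_inside_outside[of "to_complex \<circ> c"]
    by (simp_all add: inside_to_complex outside_to_complex frontier_to_complex
        connected_to_complex_iff inj_image_eq_iff[OF inj_to_complex])
qed

theorem theta_curve_plane:
  fixes c :: "real \<Rightarrow> real^2"
  assumes "simple_path c1" "pathstart c1 = a" "pathfinish c1 = b"
    and "simple_path c2" "pathstart c2 = a" "pathfinish c2 = b"
    and "simple_path c" "pathstart c = a" "pathfinish c = b" and "a \<noteq> b"
    and "path_image c1 \<inter> path_image c2 = {a, b}"
    and "path_image c1 \<inter> path_image c = {a, b}"
    and "path_image c2 \<inter> path_image c = {a, b}"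
    and "path_image c \<inter> inside (path_image c1 \<union> path_image c2) \<noteq> {}"
  shows "inside (path_image c1 \<union> path_image c) \<inter> inside (path_image c2 \<union> path_image c) = {}"
    "inside (path_image c1 \<union> path_image c) \<union> inside (path_image c2 \<union> path_image c) \<union>
      (path_image c - {a, b}) = inside (path_image c1 \<union> path_image c2)"
proof -
  let ?j = to_complex
  have pi: "path_image (?j \<circ> g) = ?j ` path_image g" for g
    by (simp add: path_image_linear_image linear_to_complex)
  have sp: "simple_path (?j \<circ> g) \<longleftrightarrow> simple_path g" for g
    by (simp add: simple_path_linear_image_eq linear_to_complex inj_to_complex)
  have ends: "pathstart (?j \<circ> g) = ?j (pathstart g)" "pathfinish (?j \<circ> g) = ?j (pathfinish g)" for g
    by (simp_all add: pathfinish_def pathstart_def)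
  have ab: "{?j a, ?j b} = ?j ` {a, b}" by simp
  note im = pi image_Un[symmetric] image_Int[OF inj_to_complex, symmetric]
    inside_to_complex ab image_set_diff[OF inj_to_complex, symmetric]
    inj_image_eq_iff[OF inj_to_complex] image_is_empty
  show "inside (path_image c1 \<union> path_image c) \<inter> inside (path_image c2 \<union> path_image c) = {}"
    "inside (path_image c1 \<union> path_image c) \<union> inside (path_image c2 \<union> path_image c) \<union>
      (path_image c - {a, b}) = inside (path_image c1 \<union> path_image c2)"
    by (rule split_inside_simple_closed_curve[of "?j \<circ> c1" "?j a" "?j b" "?j \<circ> c2" "?j \<circ> c", unfolded im];
        use assms in \<open>simp add: sp ends inj_eq[OF inj_to_complex]\<close>)+
qed

section \<open>Chords of a Jordan domain\<close>

locale jordan_domain =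
  fixes c :: "real \<Rightarrow> real^2"
  assumes simple: "simple_path c" and loop: "pathfinish c = pathstart c"
begin

definition G :: "(real^2) set" where "G = inside (path_image c)"
definition P :: "(real^2) set" where "P = path_image c \<union> inside (path_image c)"

abbreviation sees :: "real^2 \<Rightarrow> real^2 \<Rightarrow> bool" where "sees x y \<equiv> closed_segment x y \<subseteq> G"

lemma G_open: "open G"
  unfolding G_def using simple by (simp add: open_inside closed_simple_path_image)

lemma G_bounded: "bounded G"
  unfolding G_def using simple by (simp add: bounded_inside bounded_simple_path_image)

lemma G_nonempty: "G \<noteq> {}" and G_connected: "connected G"
  and frontier_G: "frontier G = path_image c"
  unfolding G_def using Jordan_inside_outside_plane[OF simple loop] by auto

lemma P_eq: "P = closure G"
  using frontier_G unfolding P_def G_def by (metis Un_commute closure_Un_frontier)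

lemma G_subset_P: "G \<subseteq> P"
  by (simp add: P_eq closure_subset)

lemma P_closed: "closed P" and P_bounded: "bounded P" and P_compact: "compact P"
  using G_bounded by (auto simp: P_eq compact_eq_bounded_closed)

lemma Compl_P: "- P = outside (path_image c)"
  unfolding P_def by (simp add: outside_inside)

lemma connected_Compl_P: "connected (- P)"
  using Compl_P Jordan_inside_outside_plane[OF simple loop] by simp

text \<open>Every point of the curve is also a limit of the outside, so none is interior to
  \<open>P\<close>. Consequently a triangle found in \<open>P\<close> has its interior in
  \<open>G\<close>.\<close>

lemma interior_P: "interior P = G"
proof -
  have "path_image c = frontier P"
    using Compl_P Jordan_inside_outside_plane(5)[OF simple loop] by (metis frontier_complement)
  then have "interior P = P - path_image c"
    by (metis P_closed closure_closed frontier_def double_diff interior_subset subset_refl)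
  also have "\<dots> = G"
    unfolding P_def G_def by (auto simp: inside_def)
  finally show ?thesis .
qed

lemma triangle_in_P:
  "closed_segment x y \<subseteq> P \<Longrightarrow> closed_segment y z \<subseteq> P \<Longrightarrow> closed_segment z x \<subseteq> P \<Longrightarrow>
    convex hull {x, y, z} \<subseteq> P"
  by (rule triangle_subset[OF connected_Compl_P P_bounded])

text \<open>As the endpoints are outside \<open>G\<close>, the open segment is an entire component
  of the intersection of its line with \<open>G\<close>; \<open>chord_maximal\<close> is the form in
  which this is used.\<close>

definition chord :: "real^2 \<Rightarrow> real^2 \<Rightarrow> bool" where
  "chord v u \<longleftrightarrow> v \<noteq> u \<and> open_segment v u \<subseteq> G \<and> v \<notin> G \<and> u \<notin> G"

lemma chord_swap: "chord v u \<Longrightarrow> chord u v"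
  by (auto simp: chord_def open_segment_commute)

lemma chord_maximal:
  assumes c: "chord v u" and a: "a \<in> open_segment v u" and ax: "sees a x"
    and x: "ht v u x = 0"
  shows "x \<in> open_segment v u"
proof -
  obtain s where s: "0 < s" "s < 1" "a = v + s *\<^sub>R (u - v)"
    using a by (auto simp: in_open_segment_iff)
  obtain t where t: "x = v + t *\<^sub>R (u - v)"
    using x ht_eq_0_iff c by (auto simp: chord_def)
  have xa: "x - a = (t - s) *\<^sub>R (u - v)"
    by (simp add: s t algebra_simps)
  have "t > 0"
  proof (rule ccontr)
    assume "\<not> t > 0"
    have "v = a + (s / (s - t)) *\<^sub>R (x - a)"
    proof -
      have "s / (s - t) * (t - s) = - s" using s \<open>\<not> t > 0\<close> by (simp add: field_simps)
      then show ?thesis unfolding xa by (simp add: s(3) del: times_divide_eq_left)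
    qed
    then have "v \<in> closed_segment a x"
      unfolding in_closed_segment_iff using s \<open>\<not> t > 0\<close> by (intro exI[of _ "s / (s - t)"]) auto
    then show False using ax c by (auto simp: chord_def)
  qed
  moreover have "t < 1"
  proof (rule ccontr)
    assume "\<not> t < 1"
    have "u = a + ((1 - s) / (t - s)) *\<^sub>R (x - a)"
    proof -
      have "(1 - s) / (t - s) * (t - s) = 1 - s" using s \<open>\<not> t < 1\<close> by simp
      then have "a + ((1 - s) / (t - s)) *\<^sub>R (x - a) = a + (1 - s) *\<^sub>R (u - v)"
        by (simp only: xa scaleR_scaleR)
      then show ?thesis by (simp add: s(3) algebra_simps)
    qed
    then have "u \<in> closed_segment a x"
      unfolding in_closed_segment_iff using s \<open>\<not> t < 1\<close> by (intro exI[of _ "(1 - s) / (t - s)"]) auto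
    then show False using ax c by (auto simp: chord_def)
  qed
  ultimately show ?thesis
    using t c by (auto simp: in_open_segment_iff chord_def)
qed

lemma chord_halfball:
  assumes c: "chord v u" and x: "x \<in> open_segment v u"
  obtains e where "e > 0" "ball x e \<subseteq> G" "\<And>b. b \<in> ball x e \<Longrightarrow> ht v u b = 0 \<Longrightarrow> b \<in> open_segment v u"
proof -
  obtain e where e: "e > 0" "ball x e \<subseteq> G"
    using c x G_open by (meson chord_def open_contains_ball subsetD)
  have "b \<in> open_segment v u" if "b \<in> ball x e" "ht v u b = 0" for b
    using chord_maximal[OF c x _ that(2)] e that(1)
    by (meson centre_in_ball convex_ball convex_contains_segment subset_trans)
  then show ?thesis using e that by blast
qed

lemma ball_meets_halfplane:
  assumes "v \<noteq> u" "ht v u x = 0" "e > 0"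
  shows "ball x e \<inter> {b. ht v u b > 0} \<noteq> {}"
proof -
  \<comment> \<open>The vector \<open>u - v\<close> turned by a right angle.\<close>
  define w :: "real^2" where "w = vector [- (u - v)$2, (u - v)$1]"
  have w: "wedge (u - v) w > 0"
  proof -
    have "wedge (u - v) w = (u - v)$1 * (u - v)$1 + (u - v)$2 * (u - v)$2"
      by (simp add: wedge_def w_def algebra_simps)
    also have "\<dots> > 0"
      unfolding sum_squares_gt_zero_iff using assms(1) by (auto simp: vec_eq_iff forall_2)
    finally show ?thesis .
  qed
  then have "w \<noteq> 0" by auto
  define b where "b = x + (e / 2 / norm w) *\<^sub>R w"
  have "dist x b < e" using \<open>w \<noteq> 0\<close> assms(3) by (simp add: b_def dist_norm)
  moreover have "ht v u b = ht v u x + (e / 2 / norm w) * wedge (u - v) w"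
    by (simp add: b_def ht_def wedge_add_right wedge_diff_right)
  ultimately show ?thesis using w assms \<open>w \<noteq> 0\<close> by (auto simp: zero_less_mult_iff)
qed

text \<open>The two components of \<open>G\<close> without the chord, with names fixed by the last
  clause. That clause speaks only of points near the chord, because farther away either component
  may contain points of both signs.\<close>

definition sides :: "real^2 \<Rightarrow> real^2 \<Rightarrow> (real^2) set \<Rightarrow> (real^2) set \<Rightarrow> bool" where
  "sides v u X Y \<longleftrightarrow> open X \<and> open Y \<and> X \<inter> Y = {} \<and> X \<union> Y = G - open_segment v u \<and>
     connected X \<and> connected Y \<and> connected (X \<union> open_segment v u) \<and> connected (Y \<union> open_segment v u) \<and>
     (\<forall>x\<in>open_segment v u. \<exists>e>0. \<forall>b\<in>ball x e. (ht v u b > 0 \<longrightarrow> b \<in> X) \<and> (ht v u b < 0 \<longrightarrow> b \<in> Y))"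

text \<open>The endpoints cut the curve into two arcs, and these form a theta curve with the chord.
  The components are the insides of the two closed curves through the chord, and each has the chord
  in its frontier.\<close>

lemma sides_exist_unoriented:
  assumes ch: "chord v u"
  obtains X Y where "open X" "open Y" "X \<inter> Y = {}" "X \<union> Y = G - open_segment v u"
    "connected X" "connected Y"
    "open_segment v u \<subseteq> closure X" "open_segment v u \<subseteq> closure Y"
proof -
  let ?s = "open_segment v u"
  have vu: "v \<noteq> u" "?s \<subseteq> G" "v \<notin> G" "u \<notin> G" using ch by (auto simp: chord_def)
  have "closed_segment v u \<subseteq> closure G"
    using closure_mono[OF vu(2)] vu(1) by (simp add: closure_open_segment)
  then have vc: "v \<in> path_image c" "u \<in> path_image c"
    using vu G_open by (auto simp: frontier_G[symmetric] frontier_def interior_open)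
  obtain c1 c2 where c12: "arc c1" "arc c2" "pathstart c1 = v" "pathfinish c1 = u"
      "pathstart c2 = u" "pathfinish c2 = v" "path_image c1 \<inter> path_image c2 = {v, u}"
      "path_image c1 \<union> path_image c2 = path_image c"
    using exists_double_arc[OF simple loop vc vu(1)] by metis
  let ?l = "linepath v u"
  have seg: "closed_segment v u = ?s \<union> {v, u}"
    using closed_segment_eq_open by blast
  have disj: "?s \<inter> path_image c = {}"
    using vu(2) unfolding G_def by (auto simp: inside_def)
  have i1: "path_image c1 \<inter> path_image ?l = {v, u}" and i2: "path_image c2 \<inter> path_image ?l = {v, u}"
    using c12(7,8) disj by (auto simp: seg)
  let ?X = "inside (path_image c1 \<union> path_image ?l)"
  let ?Y = "inside (path_image (reversepath c2) \<union> path_image ?l)"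
  have arcl: "arc ?l" using vu(1) by simp
  have ne: "path_image ?l \<inter> inside (path_image c1 \<union> path_image (reversepath c2)) \<noteq> {}"
  proof -
    have "?s \<subseteq> path_image ?l \<inter> inside (path_image c1 \<union> path_image (reversepath c2))"
      using vu(2) c12(8) segment_open_subset_closed[of v u] by (simp add: G_def)
    moreover have "?s \<noteq> {}" using vu(1) by simp
    ultimately show ?thesis by blast
  qed
  have th: "?X \<inter> ?Y = {}" "?X \<union> ?Y \<union> (path_image ?l - {v, u}) = inside (path_image c1 \<union> path_image (reversepath c2))"
    using theta_curve_plane[of c1 v u "reversepath c2" ?l] c12 i1 i2 ne arcl vu(1)
    by (simp_all add: arc_imp_simple_path simple_path_reversepath)
  have XY: "?X \<union> ?Y \<union> ?s = G"
    using th(2) c12(8) vu(1) by (simp add: G_def open_segment_def)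
  have no: "?X \<inter> ?s = {}" "?Y \<inter> ?s = {}"
    by (auto simp: inside_def seg)
  have J1: "simple_path (c1 +++ reversepath ?l)" "simple_path (reversepath c2 +++ reversepath ?l)"
    using c12 i1 i2 vu(1)
    by (auto intro!: arc_linepath  simple_path_join_loop simp: arc_reversepath closed_segment_commute)
  have pi: "path_image (c1 +++ reversepath ?l) = path_image c1 \<union> path_image ?l"
    "path_image (reversepath c2 +++ reversepath ?l) = path_image (reversepath c2) \<union> path_image ?l"
    using c12 by (simp_all add: path_image_join closed_segment_commute)
  have J: "connected ?X" "frontier ?X = path_image c1 \<union> path_image ?l"
    "connected ?Y" "frontier ?Y = path_image c2 \<union> path_image ?l"
    using Jordan_inside_outside_plane[OF J1(1)] Jordan_inside_outside_plane[OF J1(2)] c12 pi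
    by (simp_all)
  have "open ?X" "open ?Y"
    using c12 by (auto intro!: open_inside closed_Un closed_path_image simp: arc_imp_path)
  moreover have "?s \<subseteq> closure ?X" "?s \<subseteq> closure ?Y"
    using J(2,4) frontier_subset_closed seg by (auto simp: frontier_def)
  ultimately show ?thesis using that[of ?X ?Y] th(1) XY no J by blast
qed

text \<open>A small half disc beside a chord point is connected and misses the chord, so it lies in
  one component. Both components accumulate at the point, so the two half discs lie in different
  ones. Which component is on the positive side is locally constant, hence constant along the
  connected chord.\<close>

lemma sides_exist:
  assumes ch: "chord v u"
  shows "\<exists>X Y. sides v u X Y"
proof -
  let ?s = "open_segment v u"
  obtain X Y where XY: "open X" "open Y" "X \<inter> Y = {}" "X \<union> Y = G - ?s"
    "connected X" "connected Y" "?s \<subseteq> closure X" "?s \<subseteq> closure Y"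
    using sides_exist_unoriented[OF ch] .
  have vu: "v \<noteq> u" using ch by (simp add: chord_def)
  have con: "connected (X \<union> ?s)" "connected (Y \<union> ?s)"
    using connected_intermediate_closure[OF XY(5), of "X \<union> ?s"]
      connected_intermediate_closure[OF XY(6), of "Y \<union> ?s"] XY(7,8) closure_subset
    by blast+
  define good where "good A x \<longleftrightarrow> (\<exists>e>0. \<forall>b\<in>ball x e. ht v u b > 0 \<longrightarrow> b \<in> A)" for A x
  define bad where "bad A x \<longleftrightarrow> (\<exists>e>0. \<forall>b\<in>ball x e. ht v u b < 0 \<longrightarrow> b \<in> A)" for A x
  have loc: "good X x \<and> bad Y x \<or> good Y x \<and> bad X x" if x: "x \<in> ?s" for x
  proof -
    obtain e where e: "e > 0" "ball x e \<subseteq> G" "\<And>b. b \<in> ball x e \<Longrightarrow> ht v u b = 0 \<Longrightarrow> b \<in> ?s"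
        using chord_halfball[OF ch x] by metis
    define B1 where "B1 = ball x e \<inter> {b. ht v u b > 0}"
    define B2 where "B2 = ball x e \<inter> {b. ht v u b < 0}"
    have cn: "connected B1" "connected B2"
      unfolding B1_def B2_def by (auto intro!: convex_connected convex_Int convex_ht_gt convex_ht_lt)
    have sub: "B1 \<subseteq> X \<union> Y" "B2 \<subseteq> X \<union> Y"
      using XY(4) e(2) ht_open_segment[of _ v u] by (force simp: B1_def B2_def)+
    have one: "B \<inter> X = {} \<or> B \<inter> Y = {}" if "connected B" "B \<subseteq> X \<union> Y" for B
      using connectedD[OF that(1) XY(1,2)] XY(3) that(2) by blast
    have *: "\<exists>b\<in>A. b \<in> B1 \<union> B2" if "A = X \<or> A = Y" for A
    proof -
      have "x \<in> closure A" using that XY x by blast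
      then obtain b where b: "b \<in> A" "b \<in> ball x e"
        using e(1) unfolding closure_approachable by (auto simp: dist_commute)
      moreover have "b \<notin> ?s" using that b XY by blast
      ultimately show ?thesis using e(3)[of b] by (force simp: B1_def B2_def)
    qed
    have "B1 \<subseteq> X \<and> B2 \<subseteq> Y \<or> B1 \<subseteq> Y \<and> B2 \<subseteq> X"
      using one[OF cn(1) sub(1)] one[OF cn(2) sub(2)] *[of X] *[of Y] sub by blast
    then show ?thesis
      unfolding good_def bad_def using e(1) by (auto simp: B1_def B2_def)
  qed
  have opn: "openin (top_of_set ?s) {x \<in> ?s. good A x}" for A
  proof (subst openin_subtopology, intro exI conjI)
    show "openin euclidean {x. good A x}"
      unfolding open_openin[symmetric] open_contains_ball good_def
    proof clarify
      fix x and e :: real assume e: "e > 0" "\<forall>b\<in>ball x e. 0 < ht v u b \<longrightarrow> b \<in> A"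
      have "\<exists>d>0. \<forall>b\<in>ball y d. 0 < ht v u b \<longrightarrow> b \<in> A" if "y \<in> ball x e" for y
        using e that by (meson open_ball open_contains_ball subsetD)
      then show "\<exists>e>0. ball x e \<subseteq> {x. \<exists>e>0. \<forall>b\<in>ball x e. 0 < ht v u b \<longrightarrow> b \<in> A}"
        using e(1) by blast
    qed
    show "{x \<in> ?s. good A x} = {x. good A x} \<inter> ?s" by blast
  qed
  have excl: "\<not> (good X x \<and> good Y x)" if x: "x \<in> ?s" for x
  proof
    assume "good X x \<and> good Y x"
    then obtain e1 e2 where e: "e1 > 0" "e2 > 0" "\<forall>b\<in>ball x e1. ht v u b > 0 \<longrightarrow> b \<in> X"
      "\<forall>b\<in>ball x e2. ht v u b > 0 \<longrightarrow> b \<in> Y"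
      unfolding good_def by blast
    have "ball x (min e1 e2) \<inter> {b. ht v u b > 0} \<noteq> {}"
      by (rule ball_meets_halfplane) (use vu x e in \<open>auto simp: ht_open_segment\<close>)
    then obtain b where "b \<in> ball x (min e1 e2)" "ht v u b > 0" by blast
    then have "b \<in> X" "b \<in> Y" using e by auto
    then show False using XY(3) by blast
  qed
  have "connected ?s" by (simp add: convex_connected)
  then have "{x \<in> ?s. good X x} = {} \<or> {x \<in> ?s. good Y x} = {}"
    unfolding connected_openin using opn[of X] opn[of Y] excl loc by blast
  then consider "\<forall>x\<in>?s. good X x \<and> bad Y x" | "\<forall>x\<in>?s. good Y x \<and> bad X x"
    using loc by blast
  moreover have comb: "\<exists>e>0. \<forall>b\<in>ball x e. (ht v u b > 0 \<longrightarrow> b \<in> A) \<and> (ht v u b < 0 \<longrightarrow> b \<in> B)"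
    if "good A x" "bad B x" for A B x
  proof -
    obtain e1 e2 where "e1 > 0" "e2 > 0" "\<forall>b\<in>ball x e1. ht v u b > 0 \<longrightarrow> b \<in> A"
      "\<forall>b\<in>ball x e2. ht v u b < 0 \<longrightarrow> b \<in> B"
      using \<open>good A x\<close> \<open>bad B x\<close> unfolding good_def bad_def by blast
    then show ?thesis by (intro exI[of _ "min e1 e2"]) auto
  qed
  ultimately show ?thesis
  proof cases
    case 1
    then have "sides v u X Y" unfolding sides_def using XY con comb by blast
    then show ?thesis by blast
  next
    case 2
    then have "sides v u Y X" unfolding sides_def using XY con comb by (simp add: Int_commute Un_commute)
    then show ?thesis by blast
  qed
qed

section \<open>Bodies and windows\<close>

text \<open>A window is a chord with ordered endpoints: its pocket is the side where \<open>ht v u\<close> is positive,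
  so the two orders describe the two sides.\<close>

definition body :: "real^2 \<Rightarrow> real^2 \<Rightarrow> (real^2) set" where
  "body v u = {x. ht v u x > 0 \<and> (\<exists>y\<in>open_segment v u. sees x y)}"

text \<open>The last clause says that the parent's body reaches a child window from its negative side,
  everywhere along the window.\<close>

definition child :: "real^2 \<Rightarrow> real^2 \<Rightarrow> real^2 \<Rightarrow> real^2 \<Rightarrow> bool" where
  "child v u v' u' \<longleftrightarrow> chord v' u' \<and>
    (\<exists>y\<in>closed_segment v u. ht v' u' y = 0 \<and> (\<forall>z\<in>open_segment v' u'. closed_segment y z \<subseteq> P)) \<and>
    open_segment v' u' \<inter> body v u = {} \<and> open_segment v' u' \<inter> open_segment v u = {} \<and>
    (\<forall>x\<in>open_segment v' u'. \<forall>b. ht v' u' b < 0 \<longrightarrow> sees x b \<longrightarrow>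
      open_segment x b \<inter> body v u \<noteq> {})"

lemma body_subset_G: "body v u \<subseteq> G"
  unfolding body_def by auto

lemma body_open: "open (body v u)"
proof -
  have "open {x. sees x y}" for y
  proof -
    have "{x. sees x y} = (\<lambda>x. (x, y)) -` {(x, y). sees x y}"
      by auto
    moreover have "open ((\<lambda>x. (x, y)) -` {(x, y). sees x y})"
      by (rule open_vimage[OF open_segments_visible[OF G_open]]) (intro continuous_intros)
    ultimately show ?thesis by simp
  qed
  moreover have "body v u = {x. ht v u x > 0} \<inter> (\<Union>y\<in>open_segment v u. {x. sees x y})"
    unfolding body_def by auto
  ultimately show ?thesis using open_ht_gt by (auto intro!: open_Int open_UN)
qed

lemma body_segment:
  assumes "x \<in> body v u"
  obtains y where "y \<in> open_segment v u" "sees x y"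
    "closed_segment x y \<subseteq> body v u \<union> open_segment v u"
proof -
  obtain y where y: "y \<in> open_segment v u" "sees x y" and h: "ht v u x > 0"
    using assms by (auto simp: body_def)
  have "w \<in> body v u \<union> open_segment v u" if "w \<in> closed_segment x y" for w
  proof -
    obtain t where t: "0 \<le> t" "t \<le> 1" "w = x + t *\<^sub>R (y - x)"
      using \<open>w \<in> closed_segment x y\<close> by (auto simp: in_closed_segment_iff)
    show ?thesis
    proof (cases "t = 1")
      case True
      then show ?thesis using t y by simp
    next
      case False
      then have "ht v u w > 0" using t h y by (simp add: ht_affine' ht_open_segment)
      moreover have "closed_segment w y \<subseteq> closed_segment x y"
        using that by (simp add: subset_closed_segment)
      ultimately show ?thesis using y unfolding body_def by blast
    qed
  qed
  then show ?thesis using that y by blast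
qed

lemma sides_swap: "sides v u X Y \<Longrightarrow> sides u v Y X"
  unfolding sides_def by (simp add: ht_swap[of u v] open_segment_commute Int_commute Un_commute) blast

lemma connected_in_side:
  assumes "sides v u X Y" "connected K" "K \<subseteq> G" "K \<inter> open_segment v u = {}" "K \<inter> X \<noteq> {}"
  shows "K \<subseteq> X"
  using connectedD[OF assms(2), of X Y] assms unfolding sides_def by blast

lemma connected_in_side':
  assumes "sides v u X Y" "connected K" "K \<subseteq> G" "K \<inter> open_segment v u = {}" "K \<inter> Y \<noteq> {}"
  shows "K \<subseteq> Y"
  using connected_in_side[OF sides_swap[OF assms(1)]] assms by (simp add: open_segment_commute)

text \<open>On the segment from \<open>x\<close> to a window point \<open>y\<close> the height stays
  positive up to \<open>y\<close>. That part misses the chord and, near \<open>y\<close>, lies in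
  \<open>X\<close>.\<close>

lemma body_subset_side:
  assumes s: "sides v u X Y"
  shows "body v u \<subseteq> X"
proof
  fix x assume x: "x \<in> body v u"
  then obtain y where y: "y \<in> open_segment v u" "sees x y" and h: "ht v u x > 0"
    by (auto simp: body_def)
  let ?K = "closed_segment x y \<inter> {x. ht v u x > 0}"
  obtain e where e: "e > 0" "\<forall>b\<in>ball y e. ht v u b > 0 \<longrightarrow> b \<in> X"
    using s y(1) unfolding sides_def by blast
  obtain s where sp: "0 < s" "s < 1" "y + s *\<^sub>R (x - y) \<in> ball y e"
    using segment_point_near[OF e(1)] by blast
  have "ht v u (y + s *\<^sub>R (x - y)) > 0"
    using h y(1) sp by (simp add: ht_affine' ht_open_segment)
  moreover have "y + s *\<^sub>R (x - y) \<in> closed_segment x y"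
    using sp by (auto simp: closed_segment_commute[of x y] in_closed_segment_iff intro!: exI[of _ s])
  ultimately have "?K \<inter> X \<noteq> {}" using sp e by blast
  moreover have "connected ?K"
    by (intro convex_connected convex_Int convex_ht_gt) auto
  moreover have "?K \<inter> open_segment v u = {}" using ht_open_segment[of _ v u] by force
  ultimately have "?K \<subseteq> X"
    using connected_in_side[OF s] y(2) by blast
  then show "x \<in> X" using h by auto
qed

text \<open>The last clause of \<open>child\<close> is applied to points \<open>b\<close> close to
  \<open>x\<close> on the negative side.\<close>

lemma child_near:
  assumes ch: "child v u v' u'" and x: "x \<in> open_segment v' u'" and U: "open U" "x \<in> U"
  obtains q where "q \<in> body v u" "q \<in> U" "ht v' u' q < 0"
proof -
  have c: "chord v' u'" and v': "v' \<noteq> u'" using ch by (auto simp: child_def chord_def)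
  have "x \<in> G" using c x by (auto simp: chord_def)
  then obtain e where e: "e > 0" "ball x e \<subseteq> U \<inter> G"
    using U G_open by (metis Int_iff open_Int open_contains_ball)
  have "ball x e \<inter> {b. ht u' v' b > 0} \<noteq> {}"
    using ball_meets_halfplane[of u' v' x e] v' e(1) ht_open_segment[OF x] by (simp add: ht_swap[of u' v'])
  then obtain b where b: "b \<in> ball x e" "ht v' u' b < 0" by (auto simp: ht_swap[of u' v'])
  have "closed_segment x b \<subseteq> ball x e"
    using b(1) e(1) by (intro closed_segment_subset) auto
  then obtain q where q: "q \<in> open_segment x b" "q \<in> body v u"
    using ch x b(2) e(2) unfolding child_def by blast
  have "q \<in> U" using q(1) \<open>closed_segment x b \<subseteq> ball x e\<close> e(2) segment_open_subset_closed by blast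
  moreover have "ht v' u' q < 0"
    using q(1) b(2) ht_open_segment[OF x]
    by (auto simp: in_open_segment_iff ht_affine' mult_pos_neg)
  ultimately show ?thesis using that q(2) by blast
qed

text \<open>The body and its window are joined by segments that miss the child's window, and by
  \<open>child_near\<close> they have points just behind it; hence all of them lie in
  \<open>Y'\<close>. The child's window is a limit of the body, which is in \<open>X\<close>, so it
  cannot enter the open set \<open>Y\<close>; its pocket follows by connectedness.\<close>

lemma child_sides:
  assumes c: "chord v u" and ch: "child v u v' u'" and s: "sides v u X Y" and s': "sides v' u' X' Y'"
  shows "body v u \<union> open_segment v u \<subseteq> Y'" "open_segment v' u' \<subseteq> X" "X' \<subseteq> X"
proof -
  let ?s = "open_segment v u" and ?s' = "open_segment v' u'"
  have c': "chord v' u'" and disj: "?s' \<inter> body v u = {}" "?s' \<inter> ?s = {}"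
    using ch by (auto simp: child_def)
  have ne: "?s' \<noteq> {}" "?s' \<subseteq> G" "?s \<noteq> {}" "?s \<subseteq> G" using c c' by (auto simp: chord_def)
  obtain x0 where x0: "x0 \<in> ?s'" using ne by blast
  obtain e where e: "e > 0" "\<forall>b\<in>ball x0 e. ht v' u' b < 0 \<longrightarrow> b \<in> Y'"
    using s' x0 unfolding sides_def by blast
  obtain q where q: "q \<in> body v u" "q \<in> ball x0 e" "ht v' u' q < 0"
    using child_near[OF ch x0 open_ball, of x0 e] e(1) by auto
  then have q: "q \<in> body v u" "q \<in> Y'" using e(2) by blast+
  have *: "closed_segment x y \<union> ?s \<subseteq> Y'"
    if "y \<in> ?s" "sees x y" "closed_segment x y \<subseteq> body v u \<union> ?s"
      "(closed_segment x y \<union> ?s) \<inter> Y' \<noteq> {}" for x y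
  proof (rule connected_in_side'[OF s'])
    show "connected (closed_segment x y \<union> ?s)"
      by (rule connected_Un) (use that(1) in \<open>auto simp: convex_connected\<close>)
  qed (use that disj ne in auto)
  obtain y where y: "y \<in> ?s" "sees q y" "closed_segment q y \<subseteq> body v u \<union> ?s"
    using body_segment[OF q(1)] .
  have "q \<in> closed_segment q y" by simp
  then have sY: "?s \<subseteq> Y'" using *[OF y] q(2) by blast
  moreover have "x \<in> Y'" if x: "x \<in> body v u" for x
  proof -
    obtain y where "y \<in> ?s" "sees x y" "closed_segment x y \<subseteq> body v u \<union> ?s"
      using body_segment[OF x] .
    then show ?thesis using *[of y x] sY by auto
  qed
  ultimately show "body v u \<union> ?s \<subseteq> Y'" by blast
  show s'X: "?s' \<subseteq> X"
  proof
    fix x assume x: "x \<in> ?s'"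
    then have "x \<in> X \<union> Y" using s ne disj unfolding sides_def by blast
    moreover have "x \<notin> Y"
    proof
      assume "x \<in> Y"
      moreover have "open Y" using s by (simp add: sides_def)
      ultimately obtain q where "q \<in> body v u" "q \<in> Y"
        using child_near[OF ch x, of Y] by metis
      then show False using body_subset_side[OF s] s unfolding sides_def by blast
    qed
    ultimately show "x \<in> X" by blast
  qed
  have "X' \<union> ?s' \<subseteq> X"
  proof (rule connected_in_side[OF s])
    show "connected (X' \<union> ?s')" using s' by (simp add: sides_def)
    show "X' \<union> ?s' \<subseteq> G" using s' ne(2) unfolding sides_def by blast
    show "(X' \<union> ?s') \<inter> ?s = {}" using s' sY disj(2) unfolding sides_def by blast
    show "(X' \<union> ?s') \<inter> X \<noteq> {}" using s'X ne(1) by blast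
  qed
  then show "X' \<subseteq> X" by blast
qed

lemma chord_eq:
  assumes c: "chord v u" "chord v' u'" and x: "x \<in> open_segment v u" "x \<in> open_segment v' u'"
    and l: "ht v u v' = 0" "ht v u u' = 0"
  shows "(v', u') = (v, u) \<or> (v', u') = (u, v)"
proof -
  have sub: "open_segment v' u' \<subseteq> open_segment v u" if "chord v u" "chord v' u'" "x \<in> open_segment v u"
    "x \<in> open_segment v' u'" "ht v u v' = 0" "ht v u u' = 0" for v u v' u'
  proof
    fix y assume y: "y \<in> open_segment v' u'"
    have "closed_segment x y \<subseteq> open_segment v' u'"
      using y that by (intro closed_segment_subset) auto
    moreover have "ht v u y = 0"
      using y that(5,6) by (auto simp: in_open_segment_iff ht_affine')
    ultimately show "y \<in> open_segment v u"
      using chord_maximal[OF that(1,3)] that(2) unfolding chord_def by blast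
  qed
  have vu: "v \<noteq> u" "v' \<noteq> u'" using c by (auto simp: chord_def)
  obtain s t where st: "v' = v + s *\<^sub>R (u - v)" "u' = v + t *\<^sub>R (u - v)"
    using l ht_eq_0_iff[OF vu(1)] by auto
  have "u' - v' = (t - s) *\<^sub>R (u - v)" by (simp add: st algebra_simps)
  then have "ht v' u' v = 0 \<and> ht v' u' u = 0"
    by (simp add: ht_def st wedge_linear wedge_commute[of v u])
  then have "open_segment v u = open_segment v' u'"
    using sub[of v u v' u'] sub[of v' u' v u] c x l by blast
  then show ?thesis
    using vu by (auto simp: open_segment_eq doubleton_eq_iff)
qed

text \<open>A window that entered the pocket of a sibling would bring points of the parent's body
  into that pocket, whereas the body lies on the negative side. Two windows that cross would enter
  each other's pockets.\<close>

lemma siblings_disjoint: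
  assumes c: "chord v u" and ch1: "child v u v1 u1" and ch2: "child v u v2 u2"
    and s1: "sides v1 u1 X1 Y1" and s2: "sides v2 u2 X2 Y2" and ne: "(v1, u1) \<noteq> (v2, u2)"
  shows "X1 \<inter> X2 = {}" "X2 \<subseteq> Y1" "open_segment v2 u2 \<subseteq> Y1"
proof -
  let ?s1 = "open_segment v1 u1" and ?s2 = "open_segment v2 u2"
  obtain X Y where s: "sides v u X Y" using sides_exist[OF c] by blast
  have c1: "chord v1 u1" "v1 \<noteq> u1" "?s1 \<subseteq> G" "?s1 \<noteq> {}"
    and c2: "chord v2 u2" "v2 \<noteq> u2" "?s2 \<subseteq> G" "?s2 \<noteq> {}"
    using ch1 ch2 by (auto simp: child_def chord_def)
  note b1 = child_sides(1)[OF c ch1 s s1] and b2 = child_sides(1)[OF c ch2 s s2]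
  have key: "open_segment v2 u2 \<inter> X1 = {}" if ch2: "child v u v2 u2" and s1: "sides v1 u1 X1 Y1"
    and b1: "body v u \<union> open_segment v u \<subseteq> Y1" for v1 u1 v2 u2 X1 Y1
  proof (rule ccontr)
    assume "open_segment v2 u2 \<inter> X1 \<noteq> {}"
    then obtain x where x: "x \<in> open_segment v2 u2" "x \<in> X1" by blast
    have "open X1" using s1 by (simp add: sides_def)
    then obtain q where "q \<in> body v u" "q \<in> X1"
      using child_near[OF ch2 x(1) _ x(2)] by metis
    then show False using b1 s1 unfolding sides_def by blast
  qed
  have d: "?s1 \<inter> ?s2 = {}"
  proof (rule ccontr)
    assume "?s1 \<inter> ?s2 \<noteq> {}"
    then obtain x where x: "x \<in> ?s1" "x \<in> ?s2" by blast
    obtain e where e: "e > 0" "\<forall>b\<in>ball x e. ht v1 u1 b > 0 \<longrightarrow> b \<in> X1"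
      using s1 x unfolding sides_def by blast
    show False
    proof (cases "ht v1 u1 v2 = 0 \<and> ht v1 u1 u2 = 0")
      \<comment> \<open>Collinear windows with a common point agree up to orientation. Opposite
        orientations would put nearby points of the parent's body into the pocket of the
        first.\<close>
      case True
      then have "v2 = u1" "u2 = v1" using chord_eq[OF c1(1) c2(1) x] ne by auto
      then obtain q where "q \<in> body v u" "q \<in> ball x e" "ht v1 u1 q > 0"
        using child_near[OF ch2 x(2) open_ball, of x e] e(1) ht_swap[of u1 v1] by auto
      then show False using e b1 s1 unfolding sides_def by blast
    next
      case False
      have line: "ht v1 u1 x = 0" using x ht_open_segment by blast
      obtain t where t: "0 < t" "t < 1" "x = v2 + t *\<^sub>R (u2 - v2)"
        using x(2) by (auto simp: in_open_segment_iff)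
      have z: "(1 - t) * ht v1 u1 v2 + t * ht v1 u1 u2 = 0"
        using line t(3) ht_affine' by metis
      have "\<exists>w\<in>{v2, u2}. ht v1 u1 w > 0"
      proof (rule ccontr)
        assume "\<not> ?thesis"
        then have "(1 - t) * ht v1 u1 v2 \<le> 0" "t * ht v1 u1 u2 \<le> 0"
          using t by (auto simp: mult_le_0_iff)
        then have "(1 - t) * ht v1 u1 v2 = 0" "t * ht v1 u1 u2 = 0" using z by linarith+
        then show False using False t by auto
      qed
      then obtain w where w: "w \<in> {v2, u2}" "ht v1 u1 w > 0" by blast
      obtain r where r: "0 < r" "r < 1" "x + r *\<^sub>R (w - x) \<in> ball x e"
        using segment_point_near[OF e(1)] by blast
      have "x + r *\<^sub>R (w - x) \<in> X1"
        using e(2) r w line by (simp add: ht_affine')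
      moreover have "x + r *\<^sub>R (w - x) \<in> ?s2"
      proof (cases "w = u2")
        case True
        have "x + r *\<^sub>R (w - x) = v2 + (t + r * (1 - t)) *\<^sub>R (u2 - v2)"
          by (simp add: True t algebra_simps)
        moreover have "t + r * (1 - t) < 1"
        proof -
          have "r * (1 - t) < 1 * (1 - t)" using r t by (intro mult_strict_right_mono) auto
          then show ?thesis by simp
        qed
        moreover have "t + r * (1 - t) > 0" using r t by (simp add: add_pos_nonneg)
        ultimately show ?thesis unfolding in_open_segment_iff using c2(2) by blast
      next
        case False
        then have "x + r *\<^sub>R (w - x) = v2 + ((1 - r) * t) *\<^sub>R (u2 - v2)"
          using w(1) by (auto simp: t algebra_simps)
        moreover have "(1 - r) * t < 1" "(1 - r) * t > 0"
          using r t mult_strict_mono[of "1 - r" 1 t 1] by auto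
        ultimately show ?thesis unfolding in_open_segment_iff using c2(2) by blast
      qed
      ultimately show False using key[OF ch2 s1 b1] by blast
    qed
  qed
  show s2Y: "?s2 \<subseteq> Y1"
    using key[OF ch2 s1 b1] d c2(3) s1 unfolding sides_def by blast
  have "X2 \<union> ?s2 \<subseteq> Y1"
  proof (rule connected_in_side'[OF s1])
    show "connected (X2 \<union> ?s2)" using s2 by (simp add: sides_def)
    show "X2 \<union> ?s2 \<subseteq> G" using s2 c2(3) unfolding sides_def by blast
    show "(X2 \<union> ?s2) \<inter> ?s1 = {}" using key[OF ch1 s2 b2] d by blast
    show "(X2 \<union> ?s2) \<inter> Y1 \<noteq> {}" using s2Y c2(4) by blast
  qed
  then show "X2 \<subseteq> Y1" by blast
  then show "X1 \<inter> X2 = {}" using s1 unfolding sides_def by blast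
qed

section \<open>Children at the points where a segment leaves a body\<close>

lemma ray_exit:
  assumes z: "z \<in> G" and d: "d \<noteq> 0"
  obtains b where "b > 0" "z + b *\<^sub>R d \<notin> G" "\<And>t. 0 \<le> t \<Longrightarrow> t < b \<Longrightarrow> z + t *\<^sub>R d \<in> G"
proof -
  define S where "S = {t. 0 \<le> t \<and> z + t *\<^sub>R d \<notin> G}"
  have "closed S"
  proof -
    have "S = {0..} \<inter> (\<lambda>t. z + t *\<^sub>R d) -` (- G)" by (auto simp: S_def)
    moreover have "closed ((\<lambda>t. z + t *\<^sub>R d) -` (- G))"
      by (intro closed_vimage continuous_intros) (simp add: G_open)
    ultimately show ?thesis by auto
  qed
  obtain B where B: "\<And>x. x \<in> G \<Longrightarrow> norm x \<le> B"
    using G_bounded bounded_iff by metis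
  have "B \<ge> 0" using B[OF z] norm_ge_zero order_trans by blast
  define t where "t = (B + norm z + 1) / norm d"
  have "t \<ge> 0" using \<open>B \<ge> 0\<close> by (simp add: t_def)
  have "norm (t *\<^sub>R d) \<le> norm (z + t *\<^sub>R d) + norm z"
    by (metis add.commute add_diff_cancel_left' norm_triangle_ineq4)
  moreover have "norm (t *\<^sub>R d) = B + norm z + 1" using d \<open>B \<ge> 0\<close> by (simp add: t_def)
  ultimately have "\<not> norm (z + t *\<^sub>R d) \<le> B" by simp
  then have "t \<in> S" using B \<open>t \<ge> 0\<close> unfolding S_def by blast
  then have "S \<noteq> {}" by blast
  have bb: "bdd_below S" unfolding S_def by (intro bdd_belowI[of _ 0]) auto
  have inS: "Inf S \<in> S"
    by (rule closed_contains_Inf[OF \<open>S \<noteq> {}\<close> bb \<open>closed S\<close>])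
  then have "Inf S \<noteq> 0" using z by (auto simp: S_def)
  then have "Inf S > 0" using inS by (simp add: S_def)
  moreover have "z + r *\<^sub>R d \<in> G" if "0 \<le> r" "r < Inf S" for r
    using cInf_lower[OF _ bb, of r] that unfolding S_def by force
  ultimately show ?thesis using that inS by (simp add: S_def)
qed

text \<open>At a point \<open>z\<close> where a segment leaves a body, \<open>z\<close> is a limit of points \<open>Z n\<close> of the body
  that see points \<open>Y n\<close> of the window, and \<open>Y n\<close> may be assumed to converge to some \<open>y\<close>. The child
  window is the chord through \<open>z\<close> on the line \<open>yz\<close>. In the next two lemmas \<open>z = y + d\<close>, and the
  chord consists of the points \<open>y + \<tau> d\<close> with \<open>\<alpha> < \<tau> < \<beta>\<close>.\<close>

lemma shadow_line_avoids_body: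
  assumes c: "chord v u" and y: "y \<in> closed_segment v u"
    and nosee: "\<And>y'. y' \<in> open_segment v u \<Longrightarrow> \<not> sees (y + d) y'"
    and ab: "0 \<le> \<alpha>" "\<alpha> < 1" "1 < \<beta>"
    and inG: "\<And>t. \<alpha> < t \<Longrightarrow> t < \<beta> \<Longrightarrow> y + t *\<^sub>R d \<in> G"
    and inP: "\<And>t. 0 \<le> t \<Longrightarrow> t < \<beta> \<Longrightarrow> y + t *\<^sub>R d \<in> P"
    and w: "\<alpha> < \<tau>" "\<tau> < \<beta>"
  shows "y + \<tau> *\<^sub>R d \<notin> body v u"
proof
  define w where "w = y + \<tau> *\<^sub>R d"
  assume "y + \<tau> *\<^sub>R d \<in> body v u"
  then obtain y1 where y1: "y1 \<in> open_segment v u" "sees w y1" and hw: "ht v u w > 0"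
    by (auto simp: body_def w_def)
  have \<tau>: "\<tau> > 0" using w ab by linarith
  have segP: "closed_segment v u \<subseteq> P"
    using c closure_mono[of "open_segment v u" G] by (simp add: P_eq chord_def closure_open_segment)
  \<comment> \<open>A parameter above \<alpha> and below both 1 and \<tau>. From \<open>s\<close> to
    1 the line is a compact part of \<open>G\<close> and has a uniform neighbourhood there; below
    \<open>s\<close> it is a part of the side \<open>yw\<close> of a triangle that stays away from
    \<open>w\<close>.\<close>
  define s where "s = (\<alpha> + min 1 \<tau>) / 2"
  have s: "\<alpha> < s" "s < 1" "s < \<tau>" "0 < s" using ab w by (auto simp: s_def)
  \<comment> \<open>The line through \<open>y\<close> and \<open>w\<close> is transversal to the
    window, as \<open>w\<close> has positive height. If it contained \<open>y1\<close>, then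
    \<open>y1 = y\<close>, and the point \<open>y + d\<close> would see \<open>y\<close> along this
    line.\<close>
  have nz: "wedge (y1 - y) (w - y) \<noteq> 0"
  proof
    assume "wedge (y1 - y) (w - y) = 0"
    moreover have "d \<noteq> 0" using hw y by (auto simp: w_def in_closed_segment_iff ht_affine')
    ultimately obtain r where r: "y1 - y = r *\<^sub>R d"
      using \<tau> wedge_eq_0_iff[of d "y1 - y"] wedge_commute[of "y1 - y"] by (auto simp: w_def)
    have "ht v u y1 = ht v u y + r * (wedge (u - v) d)"
    proof -
      have "y1 = y + r *\<^sub>R d" using r by (simp add: algebra_simps)
      then show ?thesis by (simp add: ht_def wedge_linear)
    qed
    moreover have "ht v u y = 0" using y by (auto simp: in_closed_segment_iff ht_affine')
    moreover have "ht v u w = ht v u y + \<tau> * wedge (u - v) d"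
      by (simp add: w_def ht_def wedge_linear)
    ultimately have "r = 0" using hw ht_open_segment[OF y1(1)] by auto
    then have yy: "y = y1" using r by simp
    have "sees (y + d) y1"
    proof
      fix p assume "p \<in> closed_segment (y + d) y1"
      then obtain t where t: "0 \<le> t" "t \<le> 1" "p = y + (1 - t) *\<^sub>R d"
        unfolding yy[symmetric] by (auto simp: in_closed_segment_iff algebra_simps)
      show "p \<in> G"
      proof (cases "1 - t \<le> \<tau>")
        case True
        have "p = w + (1 - (1 - t) / \<tau>) *\<^sub>R (y1 - w)"
        proof -
          have "(1 - (1 - t) / \<tau>) * \<tau> = \<tau> - (1 - t)" using \<tau> by (simp add: field_simps)
          then have "(1 - (1 - t) / \<tau>) *\<^sub>R (y1 - w) = - ((\<tau> - (1 - t)) *\<^sub>R d)"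
            by (simp add: w_def yy[symmetric])
          then show ?thesis by (simp add: t w_def algebra_simps)
        qed
        moreover have "0 \<le> 1 - (1 - t) / \<tau>" "1 - (1 - t) / \<tau> \<le> 1" using t True \<tau> by simp_all
        ultimately show ?thesis using y1(2) unfolding in_closed_segment_iff subset_iff by blast
      next
        case False
        then show ?thesis using inG[of "1 - t"] t w ab by simp
      qed
    qed
    then show False using nosee y1(1) by blast
  qed
  \<comment> \<open>The filled triangle has its interior in \<open>G\<close>. If the target is moved
    from \<open>y\<close> slightly towards \<open>y1\<close>, the segment from \<open>y + d\<close>
    to it runs first close to the chord and then inside the triangle. So \<open>y + d\<close> sees a
    window point, contrary to \<open>nosee\<close>.\<close>
  have "convex hull {y, y1, w} \<subseteq> P"
  proof (rule triangle_in_P)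
    show "closed_segment y y1 \<subseteq> P"
      using segP y y1(1) by (meson closed_segment_subset convex_closed_segment order_trans segment_open_subset_closed subsetD)
    show "closed_segment y1 w \<subseteq> P" using y1(2) G_subset_P by (simp add: closed_segment_commute)
    show "closed_segment w y \<subseteq> P"
    proof
      fix p assume "p \<in> closed_segment w y"
      then obtain t where t: "0 \<le> t" "t \<le> 1" "p = y + (t * \<tau>) *\<^sub>R d"
        unfolding closed_segment_commute[of w y] by (auto simp: in_closed_segment_iff w_def)
      have "t * \<tau> < \<beta>" using t \<tau> w mult_left_le_one_le[of \<tau> t] by linarith
      moreover have "0 \<le> t * \<tau>" using t \<tau> by simp
      ultimately show "p \<in> P" using t inP[of "t * \<tau>"] by simp
    qed
  qed
  then have int: "interior (convex hull {y, y1, w}) \<subseteq> G"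
    using interior_mono interior_P by blast
  obtain e where e: "e > 0"
    "\<And>t x. s \<le> t \<Longrightarrow> t \<le> 1 \<Longrightarrow> x \<in> ball (y + t *\<^sub>R d) e \<Longrightarrow> x \<in> G"
    using line_nbhd[OF G_open, of s 1 y d] inG s ab by (smt (verit))
  \<comment> \<open>The bound \<open>1 - s / \<tau>\<close> keeps the barycentric weight of
    \<open>y\<close> positive below parameter \<open>s\<close>; the last bound keeps the earlier
    part of the segment within \<open>e\<close> of the line.\<close>
  obtain r where r: "0 < r" "r < 1" "r < 1 - s / \<tau>" "r * norm (y1 - y) < e"
  proof -
    have "0 < 1 - s / \<tau>" using s \<tau> by simp
    define r where "r = Min {1/2, (1 - s / \<tau>) / 2, e / (2 * (norm (y1 - y) + 1))}"
    have pos: "norm (y1 - y) + 1 > 0" by (smt (verit) norm_ge_zero)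
    have "r > 0" "r < 1" "r < 1 - s / \<tau>"
      using \<open>0 < 1 - s / \<tau>\<close> e(1) pos by (auto simp: r_def min_less_iff_disj)
    moreover have "r * norm (y1 - y) < e"
    proof -
      have "r * norm (y1 - y) \<le> e / (2 * (norm (y1 - y) + 1)) * (norm (y1 - y) + 1)"
        using \<open>r > 0\<close> e(1) pos by (intro mult_mono) (auto simp: r_def)
      also have "\<dots> = e / 2" using pos by (simp add: field_simps)
      finally show ?thesis using e(1) by linarith
    qed
    ultimately show ?thesis using that by blast
  qed
  define y' where "y' = y + r *\<^sub>R (y1 - y)"
  have "y' \<in> open_segment v u"
  proof -
    obtain p where p: "0 \<le> p" "p \<le> 1" "y = v + p *\<^sub>R (u - v)" using y by (auto simp: in_closed_segment_iff)
    obtain q where q: "0 < q" "q < 1" "y1 = v + q *\<^sub>R (u - v)" using y1(1) by (auto simp: in_open_segment_iff)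
    have "y' = v + ((1 - r) * p + r * q) *\<^sub>R (u - v)"
      by (simp add: y'_def p q algebra_simps)
    moreover have "(1 - r) * p + r * q > 0" using r p q by (simp add: add_nonneg_pos)
    moreover have "(1 - r) * p + r * q < 1"
    proof -
      have "(1 - r) * p \<le> 1 - r" using r p by (simp add: mult_left_le)
      moreover have "r * q < r" using r q by simp
      ultimately show ?thesis by linarith
    qed
    ultimately show ?thesis using c unfolding in_open_segment_iff chord_def by blast
  qed
  moreover have "sees (y + d) y'"
  proof
    fix p assume "p \<in> closed_segment (y + d) y'"
    then obtain t where t: "0 \<le> t" "t \<le> 1" and p: "p = (y + d) + t *\<^sub>R (y' - (y + d))"
      by (auto simp: in_closed_segment_iff)
    have p: "p = y + (1 - t) *\<^sub>R d + (t * r) *\<^sub>R (y1 - y)"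
      by (simp add: p y'_def algebra_simps)
    consider "s \<le> 1 - t" | "0 < 1 - t" "1 - t < s" | "t = 1" using t by linarith
    then show "p \<in> G"
    proof cases
      case 1
      have "norm ((t * r) *\<^sub>R (y1 - y)) \<le> r * norm (y1 - y)"
        using t r by (simp add: mult_left_le_one_le mult_right_mono)
      then have "p \<in> ball (y + (1 - t) *\<^sub>R d) e" using r(4) by (simp add: p dist_norm)
      then show ?thesis using e(2) 1 t by simp
    next
      case 2
      have "(1 - t) / \<tau> < s / \<tau>" using 2 \<tau> by (simp add: divide_strict_right_mono)
      moreover have "t * r \<le> r" using t r by (simp add: mult_left_le_one_le)
      ultimately have "0 < 1 - (1 - t) / \<tau> - t * r" using r by linarith
      moreover have "p = (1 - (1 - t) / \<tau> - t * r) *\<^sub>R y + (t * r) *\<^sub>R y1 + ((1 - t) / \<tau>) *\<^sub>R w"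
      proof -
        have "((1 - t) / \<tau>) *\<^sub>R (w - y) = (1 - t) *\<^sub>R d" using \<tau> by (simp add: w_def)
        then have "p = y + ((1 - t) / \<tau>) *\<^sub>R (w - y) + (t * r) *\<^sub>R (y1 - y)" by (simp only: p)
        also have "y + k *\<^sub>R (w - y) + (t * r) *\<^sub>R (y1 - y) =
            (1 - k - t * r) *\<^sub>R y + (t * r) *\<^sub>R y1 + k *\<^sub>R w" for k
          by (simp add: algebra_simps)
        finally show ?thesis .
      qed
      moreover have "0 < t * r" "0 < (1 - t) / \<tau>"
      proof -
        have "t > 0" using 2 s by linarith
        then show "0 < t * r" using r by simp
        show "0 < (1 - t) / \<tau>" using 2 \<tau> by simp
      qed
      ultimately have "p \<in> interior (convex hull {y, y1, w})"
        by (intro triangle_interiorI[OF nz, of p "1 - (1 - t) / \<tau> - t * r" "t * r" "(1 - t) / \<tau>"]) auto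
      then show ?thesis using int by blast
    next
      case 3
      then have "p = y'" by (simp add: p y'_def)
      then show ?thesis using \<open>y' \<in> open_segment v u\<close> c unfolding chord_def by blast
    qed
  qed
  ultimately show False using nosee by blast
qed

lemma shadow_line_approached:
  assumes c: "chord v u" and c': "chord v' u'"
    and ab: "0 \<le> \<alpha>" "\<alpha> < 1" "1 < \<beta>"
    and line: "\<And>t. ht v' u' (y + t *\<^sub>R d) = 0"
    and param: "\<And>t. \<alpha> < t \<Longrightarrow> t < \<beta> \<Longrightarrow> y + t *\<^sub>R d \<in> open_segment v' u'"
    and d: "d \<noteq> 0"
    and Z: "\<And>n. ht v u (Z n) > 0" "\<And>n. ht v' u' (Z n) < 0" "Z \<longlonglongrightarrow> y + d"
    and Y: "\<And>n. Y n \<in> open_segment v u" "Y \<longlonglongrightarrow> y"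
    and ZY: "\<And>n. sees (Y n) (Z n)"
    and avoid: "open_segment v' u' \<inter> body v u = {}"
    and x: "x = y + \<tau> *\<^sub>R d" "\<alpha> < \<tau>" "\<tau> < \<beta>" and b: "ht v' u' b < 0"
  shows "open_segment x b \<inter> body v u \<noteq> {}"
proof -
  define D where "D n = Z n - Y n" for n
  define e where "e = b - x"
  have D: "D \<longlonglongrightarrow> d" unfolding D_def using tendsto_diff[OF Z(3) Y(2)] by simp
  have hx: "ht v' u' x = 0" using line x by simp
  have ed: "wedge e d \<noteq> 0"
  proof
    assume "wedge e d = 0"
    then obtain r where r: "e = r *\<^sub>R d"
      using d wedge_eq_0_iff[of d e] wedge_commute[of e] by auto
    have "b = y + (\<tau> + r) *\<^sub>R d" using r by (simp add: e_def x algebra_simps)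
    then show False using line b by simp
  qed
  \<comment> \<open>Solution of \<open>Y n + T n *\<^sub>R D n = x + s n *\<^sub>R e\<close>, the
    point where the ray from \<open>Y n\<close> through \<open>Z n\<close> meets the line
    \<open>xb\<close>. In the limit the ray runs along the chord, which meets that line at
    \<open>x\<close>; so \<open>s\<close> tends to 0 and \<open>T\<close> to \<tau>.\<close>
  define s where "s n = wedge (Y n - x) (D n) / wedge e (D n)" for n
  define T where "T n = - wedge e (Y n - x) / wedge e (D n)" for n
  have lims: "s \<longlonglongrightarrow> wedge (y - x) d / wedge e d" "T \<longlonglongrightarrow> - wedge e (y - x) / wedge e d"
    "(\<lambda>n. wedge e (D n)) \<longlonglongrightarrow> wedge e d"
    unfolding s_def T_def by (intro tendsto_intros Y(2) D ed)+
  have lim_eqs: "wedge (y - x) d / wedge e d = 0" "- wedge e (y - x) / wedge e d = \<tau>"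
    using ed by (simp_all add: x(1))
  have s0: "s \<longlonglongrightarrow> 0" and T0: "T \<longlonglongrightarrow> \<tau>"
    using lims(1,2) unfolding lim_eqs by this+
  define t1 where "t1 = (\<alpha> + min 1 \<tau>) / 2"
  define t2 where "t2 = (\<beta> + max 1 \<tau>) / 2"
  have t12: "\<alpha> < t1" "t1 < 1" "t1 < \<tau>" "1 < t2" "\<tau> < t2" "t2 < \<beta>"
    using ab x by (auto simp: t1_def t2_def)
  obtain \<epsilon> where eps: "\<epsilon> > 0"
    "\<And>t p. t1 \<le> t \<Longrightarrow> t \<le> t2 \<Longrightarrow> p \<in> ball (y + t *\<^sub>R d) \<epsilon> \<Longrightarrow> p \<in> G"
  proof (rule line_nbhd[OF G_open, of t1 t2 y d])
    fix t assume "t1 \<le> t" "t \<le> t2"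
    then show "y + t *\<^sub>R d \<in> G" using param[of t] t12 c' by (auto simp: chord_def)
  qed (use that in blast)
  have "(\<lambda>n. norm (Y n - y) + t2 * norm (D n - d)) \<longlonglongrightarrow> norm (y - y) + t2 * norm (d - d)"
    by (intro tendsto_intros Y(2) D)
  then have "eventually (\<lambda>n. norm (Y n - y) + t2 * norm (D n - d) < \<epsilon>) sequentially"
    using eps(1) by (intro order_tendstoD(2)) auto
  moreover have "eventually (\<lambda>n. wedge e (D n) \<noteq> 0) sequentially"
    using tendsto_imp_eventually_ne[OF lims(3) ed] .
  moreover have "eventually (\<lambda>n. s n < 1) sequentially" using order_tendstoD(2)[OF s0] by simp
  moreover have "eventually (\<lambda>n. t1 < T n) sequentially" "eventually (\<lambda>n. T n < t2) sequentially"
    using order_tendstoD[OF T0] t12 by blast+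
  ultimately have "eventually (\<lambda>n. norm (Y n - y) + t2 * norm (D n - d) < \<epsilon> \<and> wedge e (D n) \<noteq> 0
      \<and> s n < 1 \<and> t1 < T n \<and> T n < t2) sequentially"
    by eventually_elim auto
  then obtain n where n: "norm (Y n - y) + t2 * norm (D n - d) < \<epsilon>" "wedge e (D n) \<noteq> 0"
      "s n < 1" "t1 < T n" "T n < t2"
    using eventually_happens trivial_limit_sequentially by blast
  define r where "r t = Y n + t *\<^sub>R D n" for t
  have near: "r t \<in> ball (y + t *\<^sub>R d) \<epsilon>" if "0 \<le> t" "t \<le> t2" for t
  proof -
    have "r t - (y + t *\<^sub>R d) = (Y n - y) + t *\<^sub>R (D n - d)" by (simp add: r_def algebra_simps)
    then have "norm (r t - (y + t *\<^sub>R d)) \<le> norm (Y n - y) + norm (t *\<^sub>R (D n - d))"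
      by (metis norm_triangle_ineq)
    also have "\<dots> \<le> norm (Y n - y) + t2 * norm (D n - d)"
      using that by (simp add: mult_right_mono)
    finally show ?thesis using n(1) by (simp add: dist_norm norm_minus_commute)
  qed
  have rG: "r t \<in> G" if "0 \<le> t" "t \<le> t2" for t
  proof (cases "t \<le> 1")
    case True
    have "r t \<in> closed_segment (Y n) (Z n)"
      unfolding in_closed_segment_iff r_def D_def using that True by auto
    then show ?thesis using ZY by blast
  next
    case False
    then show ?thesis using eps(2) near that t12 by (smt (verit))
  qed
  \<comment> \<open>Beyond \<open>Z n\<close> the ray stays close to the chord, hence in
    \<open>G\<close>, up to parameter \<open>t2\<close>; so its points still see
    \<open>Y n\<close>.\<close>
  have rbody: "r t \<in> body v u" if "0 < t" "t \<le> t2" for t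
  proof -
    have "sees (r t) (Y n)"
    proof
      fix p assume "p \<in> closed_segment (r t) (Y n)"
      then obtain q where q: "0 \<le> q" "q \<le> 1" "p = Y n + q *\<^sub>R (r t - Y n)"
        unfolding closed_segment_commute[of "r t"] in_closed_segment_iff by blast
      have "q * t \<le> t2" using q that mult_left_le_one_le[of t q] by linarith
      moreover have "0 \<le> q * t" using q that by simp
      ultimately show "p \<in> G" using q rG[of "q * t"] by (simp add: r_def)
    qed
    moreover have "ht v u (r t) > 0"
    proof -
      have "ht v u (r t) = (1 - t) * ht v u (Y n) + t * ht v u (Z n)"
        unfolding r_def D_def by (rule ht_affine')
      then show ?thesis using that Z(1) ht_open_segment[OF Y(1)] by simp
    qed
    ultimately show ?thesis unfolding body_def using Y(1) by blast
  qed
  \<comment> \<open>A zero would put \<open>r t\<close> on the chord by maximality, and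
    \<open>r t\<close> is in the body, which the chord avoids. So the height keeps the sign that it
    has at \<open>r 1 = Z n\<close>, and this makes \<open>s n\<close> positive.\<close>
  have nz: "ht v' u' (r t) \<noteq> 0" if "t1 < t" "t < t2" for t
  proof
    assume h: "ht v' u' (r t) = 0"
    have t: "0 \<le> t" "t \<le> t2" using that t12 ab by linarith+
    have p: "y + t *\<^sub>R d \<in> open_segment v' u'" using param[of t] that t12 by simp
    have "closed_segment (y + t *\<^sub>R d) (r t) \<subseteq> ball (y + t *\<^sub>R d) \<epsilon>"
      using near[OF t] eps(1) by (intro closed_segment_subset) auto
    then have "sees (y + t *\<^sub>R d) (r t)" using eps(2)[of t] that by force
    then have "r t \<in> open_segment v' u'" using chord_maximal[OF c' p _ h] by blast
    moreover have "r t \<in> body v u" using rbody[of t] that t12 ab by simp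
    ultimately show False using avoid by blast
  qed
  have "ht v' u' (r (T n)) < 0"
  proof (rule ccontr)
    assume "\<not> ht v' u' (r (T n)) < 0"
    then have pos: "ht v' u' (r (T n)) \<ge> 0" by simp
    have "r 1 = Z n" by (simp add: r_def D_def)
    then have neg: "ht v' u' (r 1) \<le> 0" using Z(2)[of n] by simp
    have cont: "continuous_on A (\<lambda>t. ht v' u' (r t))" for A
      unfolding r_def by (intro continuous_intros)
    show False
    proof (cases "1 \<le> T n")
      case True
      then obtain t where "1 \<le> t" "t \<le> T n" "ht v' u' (r t) = 0"
        using IVT'[OF neg pos _ cont] by auto
      then show False using nz[of t] n t12 by simp
    next
      case False
      then obtain t where "T n \<le> t" "t \<le> 1" "ht v' u' (r t) = 0"
        using IVT2'[OF neg pos _ cont] by auto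
      then show False using nz[of t] n t12 by simp
    qed
  qed
  moreover have rx: "r (T n) = x + s n *\<^sub>R e"
  proof -
    have "Y n - x = s n *\<^sub>R e + (- T n) *\<^sub>R D n"
      using wedge_basis[OF n(2), of "Y n - x"] by (simp add: s_def T_def)
    then show ?thesis by (simp add: r_def algebra_simps)
  qed
  ultimately have "(1 - s n) * ht v' u' x + s n * ht v' u' b < 0"
    unfolding e_def using ht_affine'[of v' u' x "s n" b] by simp
  then have "s n > 0" using hx b by (simp add: mult_less_0_iff)
  then have "r (T n) \<in> open_segment x b"
    using n(3) hx b unfolding in_open_segment_iff rx e_def by auto
  moreover have "r (T n) \<in> body v u" using rbody[of "T n"] n t12 ab by simp
  ultimately show ?thesis by blast
qed

lemma first_exit:
  assumes x0: "x0 \<in> body v u" and xA: "sees x0 A" and A: "A \<notin> body v u"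
  obtains z where "z \<in> closed_segment x0 A" "z \<notin> body v u" "z \<noteq> x0"
    "\<And>s. 0 \<le> s \<Longrightarrow> s < 1 \<Longrightarrow> x0 + s *\<^sub>R (z - x0) \<in> body v u"
proof -
  define S where "S = {t \<in> {0..1}. x0 + t *\<^sub>R (A - x0) \<notin> body v u}"
  have "S = {0..1} \<inter> (\<lambda>t. x0 + t *\<^sub>R (A - x0)) -` (- body v u)" by (auto simp: S_def)
  moreover have "closed ((\<lambda>t. x0 + t *\<^sub>R (A - x0)) -` (- body v u))"
    by (intro closed_vimage continuous_intros) (simp add: body_open)
  ultimately have "compact S" by (simp add: compact_Int_closed)
  moreover have "1 \<in> S" using A by (simp add: S_def)
  ultimately obtain t0 where t0: "t0 \<in> S" "\<And>t. t \<in> S \<Longrightarrow> t0 \<le> t"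
    using compact_attains_inf[of S] by blast
  define z where "z = x0 + t0 *\<^sub>R (A - x0)"
  have t01: "0 \<le> t0" "t0 \<le> 1" "z \<notin> body v u" using t0 by (auto simp: S_def z_def)
  then have "t0 \<noteq> 0" "z \<noteq> x0" using x0 by (auto simp: z_def)
  moreover have "x0 + s *\<^sub>R (z - x0) \<in> body v u" if "0 \<le> s" "s < 1" for s
  proof (rule ccontr)
    assume *: "x0 + s *\<^sub>R (z - x0) \<notin> body v u"
    have "s * t0 < t0" using that t01 \<open>t0 \<noteq> 0\<close> by simp
    moreover have "s * t0 \<in> S" using * that t01 \<open>s * t0 < t0\<close> by (simp add: S_def z_def)
    ultimately show False using t0(2) by fastforce
  qed
  moreover have "z \<in> closed_segment x0 A"
    unfolding in_closed_segment_iff z_def using t01 by blast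
  ultimately show ?thesis using that t01 by blast
qed

text \<open>The segment first leaves the body at a point \<open>z\<close>, and the child is the
  chord through \<open>z\<close> on the limit line. Past \<open>z\<close> nothing more has to be
  followed: \<open>A\<close> still sees \<open>z\<close> and is on the side opposite to
  \<open>x0\<close>, unless \<open>A = z\<close>.\<close>

lemma step:
  assumes c: "chord v u" and x0: "x0 \<in> body v u" and xA: "sees x0 A"
    and noc: "closed_segment x0 A \<inter> open_segment v u = {}" and A: "A \<notin> body v u"
  obtains v' u' where "child v u v' u'" "A \<in> body v' u' \<union> open_segment v' u'"
proof -
  obtain z where z: "z \<in> closed_segment x0 A" "z \<notin> body v u" "z \<noteq> x0"
    "\<And>s. 0 \<le> s \<Longrightarrow> s < 1 \<Longrightarrow> x0 + s *\<^sub>R (z - x0) \<in> body v u"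
    using first_exit[OF x0 xA A] by metis
  have zG: "z \<in> G" and x0z: "sees x0 z" and zA: "sees z A"
    using z(1) xA by (auto simp del: closed_segment_subset)
      (meson ends_in_segment subset_closed_segment subsetD)+
  define Z0 where "Z0 n = x0 + (1 - inverse (real (Suc n))) *\<^sub>R (z - x0)" for n
  have Z0: "Z0 n \<in> body v u" for n
    unfolding Z0_def by (rule z(4)) (auto simp: field_simps)
  have "Z0 \<longlonglongrightarrow> x0 + (1 - 0) *\<^sub>R (z - x0)"
    unfolding Z0_def by (intro tendsto_intros LIMSEQ_inverse_real_of_nat)
  then have Z0z: "Z0 \<longlonglongrightarrow> z" by simp
  have "\<exists>y. y \<in> open_segment v u \<and> sees (Z0 n) y" for n
    using Z0[of n] by (auto simp: body_def)
  then obtain Y0 where Y0: "\<And>n. Y0 n \<in> open_segment v u" "\<And>n. sees (Z0 n) (Y0 n)"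
    by metis
  have "\<forall>n. Y0 n \<in> closed_segment v u" using Y0(1) segment_open_subset_closed by blast
  then obtain y \<phi> where y: "y \<in> closed_segment v u" and \<phi>: "strict_mono \<phi>" "(Y0 \<circ> \<phi>) \<longlonglongrightarrow> y"
    using compact_segment[of v u] unfolding compact_def by meson
  define Z Y where "Z = Z0 \<circ> \<phi>" and "Y = Y0 \<circ> \<phi>"
  have Z: "Z \<longlonglongrightarrow> z" and Y: "Y \<longlonglongrightarrow> y"
    using LIMSEQ_subseq_LIMSEQ[OF Z0z \<phi>(1)] \<phi>(2) by (simp_all add: Z_def Y_def)
  have Zb: "Z n \<in> body v u" and Ys: "Y n \<in> open_segment v u" and YZ: "sees (Y n) (Z n)" for n
    using Z0 Y0 by (auto simp: Z_def Y_def closed_segment_commute)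
  have Zh: "ht v u (Z n) > 0" for n using Zb by (simp add: body_def)
  have zns: "z \<notin> open_segment v u" using noc z(1) by blast
  have "(\<lambda>n. ht v u (Z n)) \<longlonglongrightarrow> ht v u z"
    unfolding ht_def by (intro tendsto_intros Z)
  then have hz: "ht v u z \<ge> 0" using Zh by (intro tendsto_lowerbound) (auto intro: always_eventually less_imp_le)
  \<comment> \<open>A point \<open>z\<close> that sees the window would be in the body if its height
    is positive, and on the window itself if its height is 0.\<close>
  have nosee: "\<not> sees z y'" if "y' \<in> open_segment v u" for y'
  proof
    assume *: "sees z y'"
    show False
    proof (cases "ht v u z > 0")
      case True
      then show False using z(2) that * by (auto simp: body_def)
    next
      case False
      then have "ht v u z = 0" using hz by simp
      then show False using chord_maximal[OF c that] * zns by (simp add: closed_segment_commute)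
    qed
  qed
  define d where "d = z - y"
  have zyd: "z = y + d" by (simp add: d_def)
  have yG: "y \<in> open_segment v u" if "y \<in> G"
    using y that c unfolding chord_def closed_segment_eq_open by auto
  have d: "d \<noteq> 0" using yG zG zns by (auto simp: d_def)
  have yzP: "y + t *\<^sub>R d \<in> P" if "0 \<le> t" "t \<le> 1" for t
  proof (rule Lim_in_closed_set[OF P_closed _ trivial_limit_sequentially])
    show "(\<lambda>n. Y n + t *\<^sub>R (Z n - Y n)) \<longlonglongrightarrow> y + t *\<^sub>R d"
      unfolding d_def by (intro tendsto_intros Y Z)
    have "Y n + t *\<^sub>R (Z n - Y n) \<in> G" for n
      using YZ[of n] that unfolding in_closed_segment_iff subset_iff by blast
    then show "\<forall>\<^sub>F n in sequentially. Y n + t *\<^sub>R (Z n - Y n) \<in> P"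
      using G_subset_P by (auto intro: always_eventually)
  qed
  obtain b where b: "b > 0" "z + b *\<^sub>R d \<notin> G" "\<And>t. 0 \<le> t \<Longrightarrow> t < b \<Longrightarrow> z + t *\<^sub>R d \<in> G"
    using ray_exit[OF zG d] by metis
  obtain a where a: "a > 0" "z + a *\<^sub>R (- d) \<notin> G" "\<And>t. 0 \<le> t \<Longrightarrow> t < a \<Longrightarrow> z + t *\<^sub>R (- d) \<in> G"
    using ray_exit[OF zG, of "- d"] d by (metis neg_equal_0_iff_equal)
  define \<alpha> \<beta> where "\<alpha> = 1 - a" and "\<beta> = 1 + b"
  have inG: "y + t *\<^sub>R d \<in> G" if "\<alpha> < t" "t < \<beta>" for t
  proof (cases "t \<ge> 1")
    case True
    then show ?thesis using b(3)[of "t - 1"] that by (simp add: \<beta>_def zyd algebra_simps)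
  next
    case False
    then show ?thesis using a(3)[of "1 - t"] that by (simp add: \<alpha>_def zyd algebra_simps)
  qed
  define p q where "p = y + \<alpha> *\<^sub>R d" and "q = y + \<beta> *\<^sub>R d"
  have pq: "p \<notin> G" "q \<notin> G"
    using a(2) b(2) by (simp_all add: p_def q_def \<alpha>_def \<beta>_def zyd algebra_simps)
  \<comment> \<open>A negative \<alpha> would make \<open>y\<close> a point of \<open>G\<close>,
    hence of the window itself, and \<open>z\<close> would see it along the chord.\<close>
  have ab: "0 \<le> \<alpha>" "\<alpha> < 1" "1 < \<beta>"
  proof -
    show "\<alpha> < 1" "1 < \<beta>" using a b by (auto simp: \<alpha>_def \<beta>_def)
    show "0 \<le> \<alpha>"
    proof (rule ccontr)
      assume neg: "\<not> 0 \<le> \<alpha>"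
      then have "y \<in> G" using inG[of 0] \<open>1 < \<beta>\<close> by simp
      then have "y \<in> open_segment v u" by (rule yG)
      moreover have "sees z y"
      proof
        fix w assume "w \<in> closed_segment z y"
        then obtain t where "0 \<le> t" "t \<le> 1" "w = y + t *\<^sub>R d"
          unfolding closed_segment_commute[of z] in_closed_segment_iff d_def by blast
        then show "w \<in> G" using inG[of t] neg \<open>1 < \<beta>\<close> by simp
      qed
      ultimately show False using nosee by blast
    qed
  qed
  have qp: "q - p = (\<beta> - \<alpha>) *\<^sub>R d" by (simp add: p_def q_def algebra_simps)
  have pneq: "p \<noteq> q" using qp d ab by auto
  have seg: "w \<in> open_segment p q \<longleftrightarrow> (\<exists>t. \<alpha> < t \<and> t < \<beta> \<and> w = y + t *\<^sub>R d)" for w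
  proof
    assume "w \<in> open_segment p q"
    then obtain s where s: "0 < s" "s < 1" "w = p + s *\<^sub>R (q - p)" by (auto simp: in_open_segment_iff)
    have "s * (\<beta> - \<alpha>) < 1 * (\<beta> - \<alpha>)" using s ab by (intro mult_strict_right_mono) auto
    moreover have "0 < s * (\<beta> - \<alpha>)" using s ab by simp
    ultimately show "\<exists>t. \<alpha> < t \<and> t < \<beta> \<and> w = y + t *\<^sub>R d"
      by (intro exI[of _ "\<alpha> + s * (\<beta> - \<alpha>)"]) (simp add: s(3) qp scaleR_add_left, simp add: p_def)
  next
    assume "\<exists>t. \<alpha> < t \<and> t < \<beta> \<and> w = y + t *\<^sub>R d"
    then obtain t where t: "\<alpha> < t" "t < \<beta>" "w = y + t *\<^sub>R d" by blast
    have "w = p + ((t - \<alpha>) / (\<beta> - \<alpha>)) *\<^sub>R (q - p)"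
    proof -
      have "((t - \<alpha>) / (\<beta> - \<alpha>)) *\<^sub>R (q - p) = (t - \<alpha>) *\<^sub>R d" using ab by (simp add: qp)
      then show ?thesis by (simp add: t p_def algebra_simps)
    qed
    then show "w \<in> open_segment p q"
      unfolding in_open_segment_iff using pneq t ab by (intro conjI exI[of _ "(t - \<alpha>) / (\<beta> - \<alpha>)"]) auto
  qed
  have segI: "y + t *\<^sub>R d \<in> open_segment p q" if "\<alpha> < t" "t < \<beta>" for t
    using seg that by metis
  have segE: "\<exists>t. \<alpha> < t \<and> t < \<beta> \<and> w = y + t *\<^sub>R d" if "w \<in> open_segment p q" for w
    using seg[of w] that by simp
  have "open_segment p q \<subseteq> G"
  proof
    fix w assume "w \<in> open_segment p q"
    then show "w \<in> G" using segE[of w] inG by auto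
  qed
  then have chpq: "chord p q" using pneq pq unfolding chord_def by simp
  have line: "ht p q (y + t *\<^sub>R d) = 0" for t
    unfolding ht_def qp by (simp add: p_def wedge_linear)
  have inP: "y + t *\<^sub>R d \<in> P" if "0 \<le> t" "t < \<beta>" for t
    using yzP[of t] inG[of t] that ab G_subset_P by (cases "t \<le> 1") auto
  have avoid: "open_segment p q \<inter> body v u = {}"
  proof -
    have "y + t *\<^sub>R d \<notin> body v u" if "\<alpha> < t" "t < \<beta>" for t
      by (rule shadow_line_avoids_body[OF c y _ ab inG inP that]) (use nosee zyd in auto)
    then show ?thesis using segE by (metis disjoint_iff)
  qed
  have zpq: "z \<in> open_segment p q" unfolding seg zyd using ab by (intro exI[of _ 1]) simp
  have disj: "open_segment p q \<inter> open_segment v u = {}"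
  proof (rule ccontr)
    assume "open_segment p q \<inter> open_segment v u \<noteq> {}"
    then obtain w where w: "w \<in> open_segment p q" "w \<in> open_segment v u" by blast
    have "closed_segment z w \<subseteq> open_segment p q"
      using zpq w by (intro closed_segment_subset) auto
    then show False using nosee w(2) chpq unfolding chord_def by blast
  qed
  have hx0: "ht p q x0 \<noteq> 0"
  proof
    assume "ht p q x0 = 0"
    then have "x0 \<in> open_segment p q"
      using chord_maximal[OF chpq zpq] x0z by (simp add: closed_segment_commute)
    then show False using avoid x0 by blast
  qed
  have base: "\<exists>y\<in>closed_segment v u. ht p q y = 0 \<and> (\<forall>w\<in>open_segment p q. closed_segment y w \<subseteq> P)"
  proof (intro bexI[OF _ y] conjI ballI subsetI)
    show "ht p q y = 0" using line[of 0] by simp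
    fix w x assume "w \<in> open_segment p q" "x \<in> closed_segment y w"
    then obtain t s where *: "0 \<le> s" "s \<le> 1" "\<alpha> < t" "t < \<beta>" "x = y + (s * t) *\<^sub>R d"
      unfolding in_closed_segment_iff seg by auto
    have "s * t < \<beta>" using * ab mult_left_le_one_le[of t s] by linarith
    moreover have "0 \<le> s * t" using * ab by simp
    ultimately show "x \<in> P" using inP[of "s * t"] * by simp
  qed
  \<comment> \<open>The orientation is chosen so that \<open>x0\<close>, and with it every
    \<open>Z n\<close>, lies on the negative side.\<close>
  have main: "child v u v' u' \<and> A \<in> body v' u' \<union> open_segment v' u'"
    if vu': "v' = p \<and> u' = q \<or> v' = q \<and> u' = p" and neg: "ht v' u' x0 < 0" for v' u'
  proof
    have sg: "open_segment v' u' = open_segment p q"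
      using vu' open_segment_commute by metis
    have ch': "chord v' u'" using vu' chpq chord_swap by blast
    have h0: "ht v' u' w = 0 \<longleftrightarrow> ht p q w = 0" for w using vu' ht_swap[of p q] by auto
    have hz': "ht v' u' z = 0" using line[of 1] h0 zyd by simp
    have Z'neg: "ht v' u' (Z n) < 0" for n
    proof -
      have "Z n = x0 + (1 - inverse (real (Suc (\<phi> n)))) *\<^sub>R (z - x0)" by (simp add: Z_def Z0_def)
      then show ?thesis using neg hz' by (simp add: ht_affine' mult_less_0_iff del: of_nat_Suc)
    qed
    have "open_segment x b \<inter> body v u \<noteq> {}"
      if x: "x \<in> open_segment v' u'" and b: "ht v' u' b < 0" for x b
    proof -
      obtain t where t: "\<alpha> < t" "t < \<beta>" "x = y + t *\<^sub>R d" using x sg segE[of x] by auto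
      show ?thesis
      proof (rule shadow_line_approached[OF c ch' ab _ _ d Zh Z'neg _ Ys Y YZ _ t(3,1,2) b])
        show "ht v' u' (y + t *\<^sub>R d) = 0" for t using line h0 by blast
        show "y + t *\<^sub>R d \<in> open_segment v' u'" if "\<alpha> < t" "t < \<beta>" for t unfolding sg by (rule segI[OF that])
        show "Z \<longlonglongrightarrow> y + d" using Z zyd by simp
        show "open_segment v' u' \<inter> body v u = {}" unfolding sg by (rule avoid)
      qed
    qed
    then show "child v u v' u'"
      unfolding child_def sg h0 using ch' base avoid disj by blast
    show "A \<in> body v' u' \<union> open_segment v' u'"
    proof (cases "A = z")
      case True
      then show ?thesis using zpq unfolding sg by blast
    next
      case False
      obtain t where t: "0 \<le> t" "t \<le> 1" "z = x0 + t *\<^sub>R (A - x0)"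
        using z(1) by (auto simp: in_closed_segment_iff)
      have "t \<noteq> 0" "t \<noteq> 1" using z(3) False t(3) by auto
      have "0 = (1 - t) * ht v' u' x0 + t * ht v' u' A"
        using hz' t(3) ht_affine' by metis
      moreover have "(1 - t) * ht v' u' x0 < 0" using t \<open>t \<noteq> 1\<close> neg by (simp add: mult_pos_neg)
      ultimately have "t * ht v' u' A > 0" by linarith
      then have "ht v' u' A > 0" using t by (simp add: zero_less_mult_iff)
      moreover have "sees A z" using zA by (simp add: closed_segment_commute)
      ultimately show ?thesis using zpq sg unfolding body_def by blast
    qed
  qed
  show ?thesis
  proof (cases "ht p q x0 < 0")
    case True
    then show ?thesis using main[of p q] that by blast
  next
    case False
    then show ?thesis using main[of q p] that hx0 ht_swap[of q p x0] by auto
  qed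
qed

section \<open>The tree of windows\<close>

lemma chord_nonempty: "chord v u \<Longrightarrow> open_segment v u \<noteq> {}"
  by (simp add: chord_def)

lemma bodyI:
  "ht v u x > 0 \<Longrightarrow> y \<in> open_segment v u \<Longrightarrow> sees y x \<Longrightarrow> x \<in> body v u"
  unfolding body_def closed_segment_commute[of y x] by blast

lemma child_meets:
  "child v u v' u' \<Longrightarrow> x \<in> open_segment v' u' \<Longrightarrow> ht v' u' b < 0 \<Longrightarrow> sees x b \<Longrightarrow>
    open_segment x b \<inter> body v u \<noteq> {}"
  by (simp add: child_def)

lemma sides_unique:
  assumes c: "chord v u" and s: "sides v u X Y" "sides v u X' Y'"
  shows "X = X'"
proof -
  have sub: "X \<subseteq> X'" if s: "sides v u X Y" "sides v u X' Y'" for X Y X' Y'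
  proof (rule connected_in_side[OF s(2)])
    obtain x where x: "x \<in> open_segment v u" using chord_nonempty[OF c] by blast
    obtain e where "e > 0" "\<forall>b\<in>ball x e. ht v u b > 0 \<longrightarrow> b \<in> X"
      using s(1) x unfolding sides_def by blast
    moreover obtain e' where "e' > 0" "\<forall>b\<in>ball x e'. ht v u b > 0 \<longrightarrow> b \<in> X'"
      using s(2) x unfolding sides_def by blast
    moreover have "ball x (min e e') \<inter> {b. ht v u b > 0} \<noteq> {}"
      by (rule ball_meets_halfplane) (use c ht_open_segment[OF x] calculation in \<open>auto simp: chord_def\<close>)
    ultimately show "X \<inter> X' \<noteq> {}" by fastforce
  qed (use s in \<open>auto simp: sides_def\<close>)
  show ?thesis using sub[OF s] sub[OF s(2,1)] by blast
qed

text \<open>For a chord the choice is unique by \<open>sides_unique\<close>; otherwise \<open>pocket v u\<close> is arbitrary.\<close>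

definition pocket :: "real^2 \<Rightarrow> real^2 \<Rightarrow> (real^2) set" where
  "pocket v u = (SOME X. \<exists>Y. sides v u X Y)"

lemma pocket_sides:
  assumes "chord v u"
  obtains Y where "sides v u (pocket v u) Y"
  using someI_ex[OF sides_exist[OF assms]] that unfolding pocket_def by blast

lemma body_subset_pocket: "chord v u \<Longrightarrow> body v u \<subseteq> pocket v u"
  by (metis pocket_sides body_subset_side)

lemma pocket_swap_disjoint:
  assumes c: "chord v u"
  shows "pocket v u \<inter> pocket u v = {}"
proof -
  obtain Y where s: "sides v u (pocket v u) Y" using pocket_sides[OF c] .
  obtain Y' where s': "sides u v (pocket u v) Y'" using pocket_sides[OF chord_swap[OF c]] .
  have "pocket v u = Y'" by (rule sides_unique[OF c s sides_swap[OF s']])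
  then show ?thesis using s' by (auto simp: sides_def)
qed

lemma near_chord_in_body:
  assumes c: "chord v u" and x: "x \<in> open_segment v u" and U: "open U" "x \<in> U"
  shows "U \<inter> body v u \<noteq> {}"
proof -
  have "x \<in> G" using c x by (auto simp: chord_def)
  then obtain e where e: "e > 0" "ball x e \<subseteq> U \<inter> G"
    using U G_open by (metis Int_iff open_Int open_contains_ball)
  obtain b where b: "b \<in> ball x e" "ht v u b > 0"
    using ball_meets_halfplane[of v u x e] c ht_open_segment[OF x] e(1) by (auto simp: chord_def)
  have "closed_segment b x \<subseteq> ball x e" using b(1) e(1) by (intro closed_segment_subset) auto
  then have "b \<in> body v u" unfolding body_def using x b(2) e(2) by blast
  then show ?thesis using b(1) e(2) by blast
qed

lemma chord_exists: obtains a b where "chord a b"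
proof -
  obtain x where x: "x \<in> G" using G_nonempty by blast
  define d :: "real^2" where "d = axis 1 1"
  have d: "d \<noteq> 0" by (simp add: d_def axis_eq_0_iff)
  obtain s where s: "s > 0" "x + s *\<^sub>R d \<notin> G" "\<And>t. 0 \<le> t \<Longrightarrow> t < s \<Longrightarrow> x + t *\<^sub>R d \<in> G"
    using ray_exit[OF x d] by metis
  obtain r where r: "r > 0" "x + r *\<^sub>R (- d) \<notin> G" "\<And>t. 0 \<le> t \<Longrightarrow> t < r \<Longrightarrow> x + t *\<^sub>R (- d) \<in> G"
    using ray_exit[OF x, of "- d"] d by (metis neg_equal_0_iff_equal)
  define a b where "a = x + r *\<^sub>R (- d)" and "b = x + s *\<^sub>R d"
  have ba: "b - a = (r + s) *\<^sub>R d" by (simp add: a_def b_def algebra_simps)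
  have "a \<noteq> b" using ba d r(1) s(1) by auto
  moreover have "w \<in> G" if w: "w \<in> open_segment a b" for w
  proof -
    obtain t where t: "0 < t" "t < 1" "w = a + t *\<^sub>R (b - a)" using w by (auto simp: in_open_segment_iff)
    have eq: "x + (t * (r + s) - r) *\<^sub>R d = x + (r - t * (r + s)) *\<^sub>R (- d)"
      by (simp add: algebra_simps)
    have "w = x + (t * (r + s) - r) *\<^sub>R d" unfolding t(3) ba by (simp add: a_def algebra_simps)
    moreover have "t * (r + s) < 1 * (r + s)" using t r s by (intro mult_strict_right_mono) auto
    moreover have "0 < t * (r + s)" using t r s by simp
    ultimately show ?thesis
      using s(3)[of "t * (r + s) - r"] r(3)[of "r - t * (r + s)"] unfolding eq[symmetric]
      by (cases "t * (r + s) \<ge> r") simp_all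
  qed
  ultimately have "chord a b" using s(2) r(2) unfolding chord_def a_def b_def by blast
  then show ?thesis using that by blast
qed

lemma child_chord: "child v u v' u' \<Longrightarrow> chord v' u'"
  by (simp add: child_def)

text \<open>Points of the child's window are limits of the body, on which the height is
  positive.\<close>

lemma child_ht_nonneg:
  assumes ch: "child v u v' u'" and z: "z \<in> open_segment v' u'"
  shows "ht v u z \<ge> 0"
proof (rule ccontr)
  assume "\<not> ht v u z \<ge> 0"
  then obtain q where "q \<in> body v u" "ht v u q < 0"
    using child_near[OF ch z open_ht_lt[of v u]] by auto
  then show False by (simp add: body_def)
qed

text \<open>\<open>A\<close> and \<open>B\<close> lie in different components cut by the child's
  window, so the segment meets it. The heights make the crossing an inner point of the segment and
  put \<open>A\<close> strictly behind the window.\<close>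

lemma child_crossing:
  assumes c: "chord v u" and ch: "child v u v' u'" and A: "A \<in> body v u" and B: "B \<in> body v' u'"
    and AB: "sees A B"
  obtains t where "0 < t" "t < 1" "A + t *\<^sub>R (B - A) \<in> open_segment v' u'" "ht v' u' A < 0"
proof -
  obtain X Y where s: "sides v u X Y" using sides_exist[OF c] by blast
  obtain X' Y' where s': "sides v' u' X' Y'" using sides_exist[OF child_chord[OF ch]] by blast
  have "A \<in> Y'" "B \<in> X'" "X' \<inter> Y' = {}"
    using child_sides(1)[OF c ch s s'] A body_subset_side[OF s'] B s' by (auto simp: sides_def)
  then have "closed_segment A B \<inter> open_segment v' u' \<noteq> {}"
    using connected_in_side[OF s' _ AB] by (metis connected_segment disjoint_iff ends_in_segment subsetD)
  then obtain t where t: "0 \<le> t" "t \<le> 1" and z: "A + t *\<^sub>R (B - A) \<in> open_segment v' u'"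
    by (auto simp: in_closed_segment_iff)
  have hB: "ht v' u' B > 0" using B by (simp add: body_def)
  have h: "(1 - t) * ht v' u' A + t * ht v' u' B = 0" using ht_open_segment[OF z] by (simp add: ht_affine')
  have "A \<notin> open_segment v' u'" using ch A unfolding child_def by blast
  then have "t \<noteq> 0" using z by auto
  then have "t * ht v' u' B > 0" using t hB by simp
  then have "(1 - t) * ht v' u' A < 0" using h by linarith
  then have "t < 1" "ht v' u' A < 0" using t by (auto simp: mult_less_0_iff)
  then show ?thesis using t z \<open>t \<noteq> 0\<close> by (intro that[of t]) auto
qed

section \<open>The generations of windows\<close>

primrec windows :: "real^2 \<Rightarrow> real^2 \<Rightarrow> nat \<Rightarrow> ((real^2) \<times> (real^2)) set" where
  "windows a b 0 = {(a, b), (b, a)}"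
| "windows a b (Suc n) = {(v', u'). \<exists>v u. (v, u) \<in> windows a b n \<and> child v u v' u'}"

context
  fixes a b
  assumes root: "chord a b"
begin

abbreviation "W \<equiv> windows a b"

lemma window_chord: "(v, u) \<in> W n \<Longrightarrow> chord v u"
  using root chord_swap by (cases n) (auto intro: child_chord)

lemma child_pocket:
  assumes c: "chord v u" and ch: "child v u v' u'"
  shows "pocket v' u' \<subseteq> pocket v u" "pocket v' u' \<inter> body v u = {}"
proof -
  obtain Y where s: "sides v u (pocket v u) Y" using pocket_sides[OF c] .
  obtain Y' where s': "sides v' u' (pocket v' u') Y'" using pocket_sides[OF child_chord[OF ch]] .
  show "pocket v' u' \<subseteq> pocket v u" "pocket v' u' \<inter> body v u = {}"
    using child_sides[OF c ch s s'] s' unfolding sides_def by blast+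
qed

text \<open>Pockets behave like the subtrees of a tree. For two windows of one generation,
  overlapping pockets have overlapping parent pockets, hence by induction the same parent, and
  siblings have disjoint pockets. For different generations the claim passes from the parent of the
  later window to its child.\<close>

lemma pockets_nested:
  assumes "(v, u) \<in> W n" "(v', u') \<in> W m" "n \<le> m" "pocket v u \<inter> pocket v' u' \<noteq> {}"
  shows "pocket v' u' \<subseteq> pocket v u \<and> (n = m \<longrightarrow> (v', u') = (v, u)) \<and>
    (n < m \<longrightarrow> pocket v' u' \<inter> body v u = {})"
  using assms
proof (induction m arbitrary: n v u v' u')
  case 0
  then show ?case using pocket_swap_disjoint[OF root] by (auto simp: Int_commute)
next
  case (Suc m)
  obtain v1 u1 where w1: "(v1, u1) \<in> W m" "child v1 u1 v' u'" using Suc.prems(2) by auto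
  have c1: "chord v1 u1" using w1(1) by (rule window_chord)
  note p1 = child_pocket[OF c1 w1(2)]
  show ?case
  proof (cases "n \<le> m")
    case True
    then have "pocket v1 u1 \<subseteq> pocket v u \<and> (n = m \<longrightarrow> (v1, u1) = (v, u)) \<and>
      (n < m \<longrightarrow> pocket v1 u1 \<inter> body v u = {})"
      using Suc.IH[OF Suc.prems(1) w1(1)] Suc.prems(4) p1 by blast
    then show ?thesis using p1 True by (cases "n = m") auto
  next
    case False
    then have n: "n = Suc m" using Suc.prems by simp
    obtain v2 u2 where w2: "(v2, u2) \<in> W m" "child v2 u2 v u" using Suc.prems(1) n by auto
    have c2: "chord v2 u2" using w2(1) by (rule window_chord)
    note p2 = child_pocket[OF c2 w2(2)]
    have "(v1, u1) = (v2, u2)" using Suc.IH[OF w2(1) w1(1)] Suc.prems(4) p1 p2 by blast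
    then have ch2: "child v1 u1 v u" using w2 by simp
    obtain Y where s: "sides v u (pocket v u) Y" using pocket_sides[OF child_chord[OF ch2]] .
    obtain Y' where s': "sides v' u' (pocket v' u') Y'" using pocket_sides[OF child_chord[OF w1(2)]] .
    have "(v, u) = (v', u')"
      using siblings_disjoint(1)[OF c1 ch2 w1(2) s s'] Suc.prems(4) by blast
    then show ?thesis using n by simp
  qed
qed

lemma body_unique:
  assumes w: "(v, u) \<in> W n" "(v', u') \<in> W m" and x: "x \<in> body v u" "x \<in> body v' u'"
  shows "(v', u') = (v, u)" "n = m"
proof -
  have *: "(v', u') = (v, u) \<and> n = m"
    if "n \<le> m" "(v, u) \<in> W n" "(v', u') \<in> W m" "x \<in> body v u" "x \<in> body v' u'" for v u v' u' n m
  proof -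
    have p: "x \<in> pocket v u" "x \<in> pocket v' u'"
      using body_subset_pocket window_chord that by blast+
    then have n: "(n = m \<longrightarrow> (v', u') = (v, u)) \<and> (n < m \<longrightarrow> pocket v' u' \<inter> body v u = {})"
      using pockets_nested[OF that(2,3,1)] by blast
    then have "\<not> n < m" using p(2) that(4) by blast
    then show ?thesis using n that(1) by simp
  qed
  have "(v', u') = (v, u) \<and> n = m"
  proof (cases "n \<le> m")
    case True
    then show ?thesis using *[OF _ w x] by blast
  next
    case False
    then show ?thesis using *[OF _ w(2,1) x(2,1)] by simp
  qed
  then show "(v', u') = (v, u)" "n = m" by blast+
qed

text \<open>Near each point of a window there are points of its own body. If the window met another,
  open body, the two bodies would share a point and coincide; but a window has height 0 over
  itself.\<close>

lemma chord_body_disjoint: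
  assumes w: "(v, u) \<in> W n" "(v', u') \<in> W m"
  shows "open_segment v u \<inter> body v' u' = {}"
proof (rule ccontr)
  assume "open_segment v u \<inter> body v' u' \<noteq> {}"
  then obtain x where x: "x \<in> open_segment v u" "x \<in> body v' u'" by blast
  then obtain y where "y \<in> body v' u'" "y \<in> body v u"
    using near_chord_in_body[OF window_chord[OF w(1)] x(1) body_open x(2)] by blast
  then have "(v', u') = (v, u)" using body_unique[OF w] by blast
  then show False using x ht_open_segment[OF x(1)] by (simp add: body_def)
qed

definition covered :: "(real^2) set" where
  "covered = (\<Union>n. \<Union>(v, u)\<in>W n. body v u \<union> open_segment v u)"

lemma coveredI: "(v, u) \<in> W n \<Longrightarrow> x \<in> body v u \<union> open_segment v u \<Longrightarrow> x \<in> covered"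
  unfolding covered_def by blast

text \<open>Seen from a window point, a point at positive height is in the body. At negative height
  the segment passes through the parent's body, one generation earlier, which is why the induction
  runs on the generation; at generation 0 the reversed initial chord takes the place of the parent.
  A segment from the body that misses the window is handled by \<open>step\<close>.\<close>

lemma covered_segment:
  assumes "(v, u) \<in> W n" "x \<in> body v u \<union> open_segment v u" "sees x x'"
  shows "x' \<in> covered"
  using assms
proof (induction n arbitrary: v u x rule: less_induct)
  case (less n v u x)
  have c: "chord v u" using less.prems(1) by (rule window_chord)
  have on_chord: "x' \<in> covered" if y: "y \<in> open_segment v u" "sees y x'" for y
  proof -
    consider "ht v u x' > 0" | "ht v u x' = 0" | "ht v u x' < 0" by linarith
    then show ?thesis
    proof cases
      case 1
      then show ?thesis using y bodyI by (intro coveredI[OF less.prems(1)]) blast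
    next
      case 2
      then show ?thesis using chord_maximal[OF c y] by (intro coveredI[OF less.prems(1)]) auto
    next
      case 3
      show ?thesis
      proof (cases n)
        case 0
        then have "(u, v) \<in> W 0" using less.prems(1) by auto
        moreover have "x' \<in> body u v"
          using bodyI[of u v x' y] y 3 ht_swap[of u v x'] by (simp add: open_segment_commute)
        ultimately show ?thesis using coveredI by blast
      next
        case (Suc m)
        then obtain v0 u0 where w0: "(v0, u0) \<in> W m" "child v0 u0 v u" using less.prems(1) by auto
        then obtain q where q: "q \<in> open_segment y x'" "q \<in> body v0 u0"
          using child_meets[OF w0(2) y(1) 3 y(2)] by blast
        then have "sees q x'"
          using y(2) by (meson ends_in_segment(2) order_trans segment_open_subset_closed subsetD subset_closed_segment)
        then show ?thesis using less.IH[of m, OF _ w0(1), of q] q(2) Suc by blast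
      qed
    qed
  qed
  show ?case
  proof (cases "closed_segment x x' \<inter> open_segment v u = {}")
    case False
    then obtain y where y: "y \<in> closed_segment x x'" "y \<in> open_segment v u" by blast
    then have "sees y x'" using less.prems(3) by (meson ends_in_segment(2) order_trans subset_closed_segment)
    then show ?thesis using on_chord y by blast
  next
    case True
    then have xb: "x \<in> body v u" using less.prems(2) by auto
    show ?thesis
    proof (cases "x' \<in> body v u")
      case True
      then show ?thesis using coveredI[OF less.prems(1)] by blast
    next
      case False
      obtain v' u' where "child v u v' u'" "x' \<in> body v' u' \<union> open_segment v' u'"
        using step[OF c xb less.prems(3) True False] .
      moreover have "(v', u') \<in> W (Suc n)" using less.prems(1) calculation(1) by auto
      ultimately show ?thesis using coveredI by blast
    qed
  qed
qed

text \<open>Nearby points of \<open>G\<close> see each other, so by \<open>covered_segment\<close>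
  both the covered set and its complement in \<open>G\<close> are open. Connectedness of
  \<open>G\<close> finishes the proof without any bound on the number of generations.\<close>

lemma covered_eq: "covered = G"
proof -
  have sub: "covered \<subseteq> G"
    unfolding covered_def using body_subset_G window_chord by (force simp: chord_def)
  have vis: "x' \<in> covered" if x: "x \<in> covered" and xx: "sees x x'" for x x'
  proof -
    obtain n v u where w: "(v, u) \<in> W n" "x \<in> body v u \<union> open_segment v u"
      using x unfolding covered_def by blast
    show ?thesis by (rule covered_segment[OF w xx])
  qed
  have ball: "\<exists>e>0. ball x e \<subseteq> G \<and> (\<forall>x'\<in>ball x e. sees x x' \<and> sees x' x)"
    if x: "x \<in> G" for x
  proof -
    obtain e where e: "e > 0" "ball x e \<subseteq> G" using x G_open open_contains_ball by blast
    have "closed_segment x x' \<subseteq> ball x e \<and> closed_segment x' x \<subseteq> ball x e" if "x' \<in> ball x e" for x'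
      using that e(1) by (intro conjI closed_segment_subset) auto
    then show ?thesis using e by (meson order_trans)
  qed
  have "open covered" unfolding open_contains_ball
  proof
    fix x assume x: "x \<in> covered"
    then obtain e where e: "e > 0" "\<forall>x'\<in>ball x e. sees x x'"
      using ball[OF subsetD[OF sub x]] by blast
    have "ball x e \<subseteq> covered"
    proof
      fix x' assume "x' \<in> ball x e"
      then show "x' \<in> covered" using e(2) vis[OF x] by blast
    qed
    then show "\<exists>e>0. ball x e \<subseteq> covered" using e(1) by blast
  qed
  moreover have "open (G - covered)" unfolding open_contains_ball
  proof
    fix x assume x: "x \<in> G - covered"
    then obtain e where e: "e > 0" "ball x e \<subseteq> G" "\<forall>x'\<in>ball x e. sees x' x"
      using ball[of x] by blast
    have "x' \<notin> covered" if "x' \<in> ball x e" for x'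
      using vis[of x' x] e(3) that x by blast
    then show "\<exists>e>0. ball x e \<subseteq> G - covered" using e by blast
  qed
  moreover have "covered \<noteq> {}"
  proof -
    obtain z where "z \<in> open_segment a b" using chord_nonempty[OF root] by blast
    then show ?thesis using coveredI[of a b 0 z] by auto
  qed
  ultimately show ?thesis
    using connectedD[OF G_connected, of covered "G - covered"] sub by blast
qed

text \<open>Consider the earliest generation that the segment meets. If the segment crosses the
  window met there, its ends lie on different sides, and the part behind the window would meet the
  parent, an earlier generation, unless the window is the initial chord. If it meets only the body,
  each end is in that body or, by \<open>step\<close>, in a child.\<close>

lemma visible_bodies:
  assumes wA: "(vA, uA) \<in> W n" "A \<in> body vA uA" and wB: "(vB, uB) \<in> W m" "B \<in> body vB uB"
    and AB: "sees A B"
  shows "(vA, uA) = (vB, uB) \<or> child vA uA vB uB \<or> child vB uB vA uA \<or>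
    (\<exists>k v u. (v, u) \<in> W k \<and> child v u vA uA \<and> child v u vB uB) \<or> (vB, uB) = (uA, vA)"
proof -
  define meets where "meets k \<longleftrightarrow> (\<exists>v u. (v, u) \<in> W k \<and> closed_segment A B \<inter> (body v u \<union> open_segment v u) \<noteq> {})" for k
  define k where "k = (LEAST k. meets k)"
  have "meets n" unfolding meets_def using wA by (metis IntI UnI1 empty_iff ends_in_segment(1))
  then have "meets k" unfolding k_def by (rule LeastI)
  then obtain v u where w: "(v, u) \<in> W k" "closed_segment A B \<inter> (body v u \<union> open_segment v u) \<noteq> {}"
    unfolding meets_def by blast
  have least: "\<not> meets j" if "j < k" for j using that not_less_Least unfolding k_def by blast
  have c: "chord v u" using w(1) by (rule window_chord)
  have idA: "(vA, uA) = (v', u')" if "(v', u') \<in> W j" "A \<in> body v' u' \<union> open_segment v' u'" for v' u' j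
    using body_unique[OF that(1) wA(1) _ wA(2)] chord_body_disjoint[OF that(1) wA(1)] that(2) wA(2) by blast
  have idB: "(vB, uB) = (v', u')" if "(v', u') \<in> W j" "B \<in> body v' u' \<union> open_segment v' u'" for v' u' j
    using body_unique[OF that(1) wB(1) _ wB(2)] chord_body_disjoint[OF that(1) wB(1)] that(2) wB(2) by blast
  show ?thesis
  proof (cases "closed_segment A B \<inter> open_segment v u = {}")
    case False
    then obtain x where x: "x \<in> closed_segment A B" "x \<in> open_segment v u" by blast
    have xAB: "sees x A" "sees x B"
      using x AB by (meson ends_in_segment order_trans subset_closed_segment)+
    have off: "ht v u y \<noteq> 0" if "sees x y" "y \<in> body v' u'" "(v', u') \<in> W j" for y v' u' j
      using chord_maximal[OF c x(2) that(1)] chord_body_disjoint[OF w(1) that(3)] that(2) by blast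
    have hA: "ht v u A \<noteq> 0" and hB: "ht v u B \<noteq> 0" using off xAB wA wB by blast+
    obtain t where t: "0 \<le> t" "t \<le> 1" "x = A + t *\<^sub>R (B - A)" using x(1) by (auto simp: in_closed_segment_iff)
    have h0: "(1 - t) * ht v u A + t * ht v u B = 0" using ht_open_segment[OF x(2)] unfolding t(3) ht_affine' .
    have pos: "y \<in> body v u" if "ht v u y > 0" "sees x y" for y
      using that x(2) unfolding body_def by (auto simp: closed_segment_commute)
    have neg: "k = 0 \<and> y \<in> body u v" if "ht v u y < 0" "sees x y" "open_segment x y \<subseteq> closed_segment A B" for y
    proof (cases k)
      case 0
      then show ?thesis using that x(2) ht_swap[of u v y]
        unfolding body_def by (auto simp: closed_segment_commute open_segment_commute)
    next
      case (Suc j)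
      then obtain v0 u0 where w0: "(v0, u0) \<in> W j" "child v0 u0 v u" using w(1) by auto
      then have "open_segment x y \<inter> body v0 u0 \<noteq> {}" using child_meets[OF w0(2) x(2)] that by blast
      then have "meets j" unfolding meets_def using w0(1) that(3) by blast
      then show ?thesis using least[of j] Suc by simp
    qed
    have xsub: "open_segment x A \<subseteq> closed_segment A B" "open_segment x B \<subseteq> closed_segment A B"
      using x(1) by (meson ends_in_segment order_trans segment_open_subset_closed subset_closed_segment)+
    have swap: "(u, v) \<in> W k" if "k = 0" using w(1) that by auto
    have "\<not> (ht v u A > 0 \<and> ht v u B > 0)" "\<not> (ht v u A < 0 \<and> ht v u B < 0)"
    proof -
      show "\<not> (ht v u A > 0 \<and> ht v u B > 0)"
        using h0 t convex_ht_gt[of v u] ht_affine'[of v u A t B] ht_open_segment[OF x(2)]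
        by (smt (verit, best) mult_nonneg_nonneg mult_pos_pos)
      show "\<not> (ht v u A < 0 \<and> ht v u B < 0)"
        using h0 t by (smt (verit, best) mult_nonneg_nonpos mult_pos_neg)
    qed
    then consider "ht v u A > 0" "ht v u B < 0" | "ht v u A < 0" "ht v u B > 0"
      using hA hB by linarith
    then show ?thesis
    proof cases
      case 1
      then show ?thesis using idA[OF w(1)] idB[OF swap] pos xAB neg[OF 1(2) xAB(2) xsub(2)] by blast
    next
      case 2
      then show ?thesis using idB[OF w(1)] idA[OF swap] pos xAB neg[OF 2(1) xAB(1) xsub(1)] by blast
    qed
  next
    case True
    then obtain x where x: "x \<in> closed_segment A B" "x \<in> body v u" using w(2) by blast
    have sub: "closed_segment x A \<subseteq> closed_segment A B" "closed_segment x B \<subseteq> closed_segment A B"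
      using x by (simp_all add: subset_closed_segment)
    have main: "y \<in> body v u \<or> (\<exists>v' u'. child v u v' u' \<and> (v', u') \<in> W (Suc k) \<and> y \<in> body v' u' \<union> open_segment v' u')"
      if y: "closed_segment x y \<subseteq> closed_segment A B" for y
    proof (cases "y \<in> body v u")
      case False
      have "sees x y" "closed_segment x y \<inter> open_segment v u = {}" using y AB True by blast+
      then obtain v' u' where "child v u v' u'" "y \<in> body v' u' \<union> open_segment v' u'"
        using step[OF c x(2) _ _ False] by blast
      then show ?thesis using w(1) by auto
    qed blast
    have "(vA, uA) = (v, u) \<or> child v u vA uA" using main[OF sub(1)] idA w(1) by blast
    moreover have "(vB, uB) = (v, u) \<or> child v u vB uB" using main[OF sub(2)] idB w(1) by blast
    ultimately show ?thesis using w(1) by blast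
  qed
qed

text \<open>Each window separates \<open>A\<close> from \<open>B\<close>. The point at
  \<open>s\<close> comes from the last clause of \<open>child\<close>, applied on the way from the
  first window to \<open>B\<close>. The order of the parameters holds because the ends of the
  segment, up to the crossings, stay in the children's bodies.\<close>

lemma sibling_crossing:
  assumes w: "(v, u) \<in> W k" and ch1: "child v u v1 u1" and ch2: "child v u v2 u2"
    and ne: "(v1, u1) \<noteq> (v2, u2)" and A: "A \<in> body v1 u1" and B: "B \<in> body v2 u2"
    and AB: "sees A B"
  obtains t1 s t2 where "0 < t1" "t1 < s" "s < t2" "t2 < 1"
    "A + t1 *\<^sub>R (B - A) \<in> open_segment v1 u1" "A + s *\<^sub>R (B - A) \<in> body v u"
    "A + t2 *\<^sub>R (B - A) \<in> open_segment v2 u2" "ht v1 u1 B < 0" "ht v2 u2 A < 0"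
proof -
  have c: "chord v u" using w by (rule window_chord)
  have w1: "(v1, u1) \<in> W (Suc k)" and w2: "(v2, u2) \<in> W (Suc k)" using w ch1 ch2 by auto
  have c1: "chord v1 u1" and c2: "chord v2 u2" using ch1 ch2 child_chord by auto
  have cross: "\<exists>t. 0 < t \<and> t < 1 \<and> A + t *\<^sub>R (B - A) \<in> open_segment v1 u1 \<and> ht v1 u1 B < 0"
    if ch1: "child v u v1 u1" and ch2: "child v u v2 u2" and ne: "(v1, u1) \<noteq> (v2, u2)"
      and A: "A \<in> body v1 u1" and B: "B \<in> body v2 u2" and AB: "sees A B"
    for v1 u1 v2 u2 A B
  proof -
    obtain X1 Y1 where s1: "sides v1 u1 X1 Y1" using sides_exist[OF child_chord[OF ch1]] by blast
    obtain X2 Y2 where s2: "sides v2 u2 X2 Y2" using sides_exist[OF child_chord[OF ch2]] by blast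
    have "A \<in> X1" "B \<in> Y1" "X1 \<inter> Y1 = {}"
      using siblings_disjoint(2)[OF c ch1 ch2 s1 s2 ne] body_subset_side[OF s1] body_subset_side[OF s2] A B s1
      by (auto simp: sides_def)
    then have "closed_segment A B \<inter> open_segment v1 u1 \<noteq> {}"
      using connected_in_side[OF s1 _ AB] by (metis connected_segment disjoint_iff ends_in_segment subsetD)
    then obtain t where t: "0 \<le> t" "t \<le> 1" and z: "A + t *\<^sub>R (B - A) \<in> open_segment v1 u1"
      by (auto simp: in_closed_segment_iff)
    have hA: "ht v1 u1 A > 0" using A by (simp add: body_def)
    have h: "(1 - t) * ht v1 u1 A + t * ht v1 u1 B = 0" using ht_open_segment[OF z] by (simp add: ht_affine')
    have "B \<notin> open_segment v1 u1" using \<open>B \<in> Y1\<close> s1 by (auto simp: sides_def)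
    then have "t < 1" using z t by (cases "t = 1") auto
    then have "(1 - t) * ht v1 u1 A > 0" using hA by simp
    then have "t * ht v1 u1 B < 0" using h by linarith
    then have "0 < t" "ht v1 u1 B < 0" using t by (auto simp: mult_less_0_iff)
    then show ?thesis using \<open>t < 1\<close> z by blast
  qed
  obtain t1 where t1: "0 < t1" "t1 < 1" "A + t1 *\<^sub>R (B - A) \<in> open_segment v1 u1" "ht v1 u1 B < 0"
    using cross[OF ch1 ch2 ne A B AB] by blast
  obtain r where r: "0 < r" "r < 1" "B + r *\<^sub>R (A - B) \<in> open_segment v2 u2" "ht v2 u2 A < 0"
    using cross[OF ch2 ch1 ne[symmetric] B A] AB by (metis closed_segment_commute)
  define t2 where "t2 = 1 - r"
  have t2: "0 < t2" "t2 < 1" "A + t2 *\<^sub>R (B - A) \<in> open_segment v2 u2"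
    using r by (auto simp: t2_def algebra_simps)
  have subG: "sees (A + p *\<^sub>R (B - A)) (A + q *\<^sub>R (B - A))"
    if "0 \<le> p" "p \<le> 1" "0 \<le> q" "q \<le> 1" for p q
  proof -
    have "A + p *\<^sub>R (B - A) \<in> closed_segment A B" "A + q *\<^sub>R (B - A) \<in> closed_segment A B"
      using that unfolding in_closed_segment_iff by blast+
    then show ?thesis using AB by (meson order_trans subset_closed_segment)
  qed
  have hA: "ht v1 u1 A > 0" "ht v2 u2 B > 0" using A B by (simp_all add: body_def)
  define q where "q = (\<lambda>s. A + s *\<^sub>R (B - A))"
  \<comment> \<open>An affine function that decreases from a positive value at 0 to a zero at
    \<open>y\<close> is positive before \<open>y\<close>.\<close>
  have lin: "(1 - x) * \<alpha> + x * \<beta> > 0" if "x < y" "(1 - y) * \<alpha> + y * \<beta> = 0" "\<alpha> > 0" "\<beta> < 0" for x y \<alpha> \<beta> :: real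
  proof -
    have "x * (\<beta> - \<alpha>) > y * (\<beta> - \<alpha>)" using that by (intro mult_strict_right_mono_neg) auto
    then show ?thesis using that(2) by (simp add: algebra_simps)
  qed
  have z1: "(1 - t1) * ht v1 u1 A + t1 * ht v1 u1 B = 0" using ht_open_segment[OF t1(3)] by (simp add: ht_affine')
  have z2: "(1 - t2) * ht v2 u2 A + t2 * ht v2 u2 B = 0" using ht_open_segment[OF t2(3)] by (simp add: ht_affine')
  have "t1 \<noteq> t2"
  proof
    assume "t1 = t2"
    obtain X1 Y1 where s1: "sides v1 u1 X1 Y1" using sides_exist[OF c1] by blast
    obtain X2 Y2 where s2: "sides v2 u2 X2 Y2" using sides_exist[OF c2] by blast
    show False
      using siblings_disjoint(3)[OF c ch1 ch2 s1 s2 ne] t1(3) t2(3) \<open>t1 = t2\<close> s1 unfolding sides_def by blast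
  qed
  moreover have "\<not> t2 < t1"
  proof
    assume "t2 < t1"
    then have "ht v1 u1 (q t2) > 0" using lin[OF _ z1 hA(1) t1(4)] by (simp add: q_def ht_affine')
    then have "q t2 \<in> body v1 u1"
      using subG[of t2 t1] t1 t2 unfolding body_def q_def by auto
    then show False using chord_body_disjoint[OF w2 w1] t2(3) unfolding q_def by blast
  qed
  ultimately have t12: "t1 < t2" by simp
  have "sees (q t1) B" using subG[of t1 1] t1(1,2) by (simp add: q_def)
  moreover have "q t1 \<in> open_segment v1 u1" using t1(3) by (simp add: q_def)
  ultimately have "open_segment (q t1) B \<inter> body v u \<noteq> {}" using child_meets[OF ch1 _ t1(4)] by blast
  then obtain y where y: "y \<in> open_segment (q t1) B" "y \<in> body v u" by blast
  then obtain s0 where s0: "0 < s0" "s0 < 1" "y = q t1 + s0 *\<^sub>R (B - q t1)" by (auto simp: in_open_segment_iff)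
  define s where "s = t1 + s0 * (1 - t1)"
  have ys: "y = q s" by (simp add: s0 s_def q_def algebra_simps)
  have "s > t1" using s0 t1 by (simp add: s_def)
  have "s < 1"
  proof -
    have "s0 * (1 - t1) < 1 * (1 - t1)" using s0 t1 by (intro mult_strict_right_mono) auto
    then show ?thesis by (simp add: s_def)
  qed
  have "s \<noteq> t2" using t2(3) y(2) ch2 unfolding ys child_def q_def by blast
  moreover have "\<not> s > t2"
  proof
    assume "s > t2"
    then have "(1 - (1 - s)) * ht v2 u2 B + (1 - s) * ht v2 u2 A > 0"
      using lin[of "1 - s" "1 - t2" "ht v2 u2 B" "ht v2 u2 A"] z2 hA(2) r(4) by (simp add: algebra_simps)
    then have "ht v2 u2 (q s) > 0" by (simp add: q_def ht_affine' add.commute)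
    then have "q s \<in> body v2 u2"
      using subG[of s t2] t2 \<open>s > t2\<close> \<open>s < 1\<close> unfolding body_def q_def by auto
    then show False using body_unique(2)[OF w w2, of "q s"] y(2) ys by simp
  qed
  ultimately have "s < t2" by simp
  then show ?thesis
    using that[of t1 s t2] t1 t2 \<open>s > t1\<close> y(2) ys r(4) unfolding q_def by blast
qed

end

section \<open>Areas of visible regions\<close>

lemma P_lebesgue: "P \<in> sets lebesgue"
  using P_closed by (simp add: borel_closed)

lemma smc_upper:
  assumes "convex K" "K \<subseteq> P"
  shows "measure lebesgue K \<le> smc P"
  unfolding smc_def
  by (rule cSup_upper) (use assms bdd_above_convex_measures[OF P_bounded P_lebesgue] in auto)

lemma smc_nonneg: "0 \<le> smc P"
  using smc_upper[of "{}"] by simp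

lemma wedge_le_smc:
  assumes "closed_segment x y \<subseteq> P" "closed_segment y z \<subseteq> P" "closed_segment z x \<subseteq> P"
  shows "\<bar>wedge (y - x) (z - x)\<bar> \<le> 2 * smc P"
  using smc_upper[OF convex_convex_hull triangle_in_P[OF assms]] measure_triangle[of x y z] by simp

text \<open>\<open>A\<close> and \<open>q\<close> are on opposite sides of the diagonal
  \<open>Bp\<close>, the only side not known to lie in \<open>P\<close>. So the open diagonal is
  interior to the union of the two triangles, and the frontier of the union is in
  \<open>P\<close>.\<close>

lemma quadrilateral_triangle_in_P:
  assumes AB: "closed_segment A B \<subseteq> P" and Ap: "closed_segment A p \<subseteq> P"
    and Bq: "closed_segment B q \<subseteq> P" and pq: "closed_segment p q \<subseteq> P"
    and opp: "wedge (B - p) (A - p) * wedge (B - p) (q - p) < 0"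
  shows "convex hull {A, B, p} \<subseteq> P"
proof -
  let ?T = "convex hull {A, B, p}" and ?T' = "convex hull {B, q, p}"
  have "x \<in> P" if x: "x \<in> frontier (?T \<union> ?T')" for x
  proof -
    have "x \<in> frontier ?T \<union> frontier ?T'" using x frontier_Un_subset by blast
    then have edges: "x \<in> closed_segment A B \<union> closed_segment B p \<union> closed_segment p A \<union>
        closed_segment B q \<union> closed_segment q p"
      by (simp add: frontier_of_triangle closed_segment_commute) blast
    have "x \<notin> interior (?T \<union> ?T')" using x by (simp add: frontier_def)
    then have "x \<notin> open_segment B p" using open_segment_in_interior_Un[OF opp] by blast
    then have "x \<in> closed_segment B p \<Longrightarrow> x = B \<or> x = p" by (auto simp: open_segment_def)
    then show ?thesis
      using edges AB Ap Bq pq closed_segment_commute[of p A] closed_segment_commute[of q p]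
        ends_in_segment[of A B] ends_in_segment[of A p] by blast
  qed
  then have "frontier (?T \<union> ?T') \<subseteq> P" by blast
  moreover have "bounded (?T \<union> ?T')" by (simp add: bounded_convex_hull)
  ultimately have "?T \<union> ?T' \<subseteq> P"
    using subset_if_frontier_subset[OF connected_Compl_P P_bounded] by blast
  then show ?thesis by blast
qed

text \<open>If the segment from \<open>B\<close> to \<open>q\<close> does not cross the one from \<open>A\<close> to \<open>p\<close>, then \<open>P\<close> contains
  the triangle \<open>ABp\<close>. Otherwise \<open>P\<close> contains the two triangles that these segments form with \<open>AB\<close>
  and \<open>pq\<close>, and the factor \<open>1 + ht v u B / ht v u A\<close> is the worst case for the larger of the two.\<close>

theorem mutual_visibility_bound:
  assumes AB: "closed_segment A B \<subseteq> P" and Ap: "closed_segment A p \<subseteq> P"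
    and Bq: "closed_segment B q \<subseteq> P" and pq: "closed_segment p q \<subseteq> P"
    and vu: "v \<noteq> u" and h0: "ht v u p = 0" "ht v u q = 0"
    and hA: "ht v u A > 0" and hB: "0 \<le> ht v u B" "ht v u B \<le> ht v u A"
  shows "\<bar>wedge (A - p) (B - p)\<bar> \<le> 2 * smc P * (1 + ht v u B / ht v u A)"
proof -
  define s where "s = smc P"
  define a where "a = A - p"
  define e where "e = u - v"
  define H where "H = ht v u A"
  have hp: "ht v u x = wedge e (x - p)" for x
    using h0(1) by (simp add: ht_def e_def wedge_linear)
  have ea: "wedge e a = H" "wedge a e = - H" by (simp_all add: hp H_def a_def wedge_commute[of _ e])
  have Hpos: "H > 0" using hA by (simp add: H_def)
  have s0: "s \<ge> 0" using smc_nonneg by (simp add: s_def)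
  \<comment> \<open>\<eta> and \<xi> are the coordinates of \<open>B - p\<close> along
    \<open>a\<close> and along the window direction \<open>e\<close>. The quantity to be bounded is
    \<open>\<bar>\<xi>\<bar> * H\<close>, twice the area of the triangle \<open>ABp\<close>.\<close>
  define \<eta> where "\<eta> = ht v u B / H"
  define \<xi> where "\<xi> = wedge (B - p) a / H"
  have \<eta>: "0 \<le> \<eta>" "\<eta> \<le> 1" using hB Hpos by (simp_all add: \<eta>_def H_def)
  have B: "B - p = \<xi> *\<^sub>R e + \<eta> *\<^sub>R a"
    using wedge_basis[of e a "B - p"] ea Hpos by (simp add: \<xi>_def \<eta>_def hp)
  define r where "r = (SOME r. q - p = r *\<^sub>R e)"
  have "\<exists>r. q - p = r *\<^sub>R e"
    using h0(2) vu wedge_eq_0_iff[of e "q - p"] unfolding hp by (simp add: e_def)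
  then have q: "q - p = r *\<^sub>R e" unfolding r_def by (rule someI_ex)
  have D: "\<bar>wedge (A - p) (B - p)\<bar> = \<bar>\<xi>\<bar> * H"
    using Hpos unfolding a_def[symmetric] B by (simp add: wedge_add_right ea abs_mult)
  have goal: "\<bar>\<xi>\<bar> * H \<le> 2 * s * (1 + \<eta>)"
  \<comment> \<open>A negative product means that \<open>B\<close> and \<open>q\<close> lie on
    opposite sides of the line \<open>pA\<close>.\<close>
  proof (cases "r * \<xi> < 0")
    case False
    have "convex hull {A, B, p} \<subseteq> P" if "\<xi> \<noteq> 0"
    proof -
      have "r = 0 \<or> (r \<noteq> 0 \<and> \<eta> = 0) \<or> (r * \<xi> > 0 \<and> \<eta> > 0)"
        using False that \<eta> by (cases "r = 0"; cases "\<eta> = 0") (auto simp: not_less le_less)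
      then consider "r = 0" | "r \<noteq> 0" "\<eta> = 0" | "r * \<xi> > 0" "\<eta> > 0" by blast
      then show ?thesis
      proof cases
        case 1
        then have "q = p" using q by simp
        then show ?thesis using AB Ap Bq by (intro triangle_in_P) (auto simp: closed_segment_commute)
      next
        \<comment> \<open>Here \<open>B\<close> is on the line of \<open>p\<close> and
          \<open>q\<close>, so the segment \<open>Bp\<close> is covered by \<open>Bq\<close> and
          \<open>pq\<close>.\<close>
        case 2
        have "collinear {B, p, q}"
          unfolding collinear_def
        proof (rule exI[of _ e], intro ballI)
          fix x y assume "x \<in> {B, p, q}" "y \<in> {B, p, q}"
          then obtain k l where "x = p + k *\<^sub>R e" "y = p + l *\<^sub>R e"
            using B q 2 by (metis add.commute add.right_neutral diff_add_cancel empty_iff insert_iff scaleR_zero_left)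
          then have "x - y = (k - l) *\<^sub>R e" by (simp add: algebra_simps)
          then show "\<exists>c. x - y = c *\<^sub>R e" by blast
        qed
        then have "closed_segment B p \<subseteq> closed_segment B q \<union> closed_segment p q"
          using subset_closed_segment[of B p B q] subset_closed_segment[of B p p q]
            Un_closed_segment[of q B p] closed_segment_commute[of q p]
          unfolding collinear_between_cases between_mem_segment by (auto simp: closed_segment_commute)
        then show ?thesis using AB Ap Bq pq by (intro triangle_in_P) (auto simp: closed_segment_commute)
      next
        case 3
        have "wedge (B - p) (A - p) = \<xi> * H" "wedge (B - p) (q - p) = - \<eta> * r * H"
          unfolding a_def[symmetric] B q by (simp_all add: wedge_add_left ea)
        then have "wedge (B - p) (A - p) * wedge (B - p) (q - p) = - (r * \<xi> * \<eta> * H * H)" by simp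
        moreover have "r * \<xi> * \<eta> * H * H > 0" using 3 Hpos by simp
        ultimately show ?thesis using quadrilateral_triangle_in_P[OF AB Ap Bq pq] by simp
      qed
    qed
    then have "\<xi> \<noteq> 0 \<Longrightarrow> measure lebesgue (convex hull {p, A, B}) \<le> s"
      unfolding s_def by (intro smc_upper) (auto simp: insert_commute)
    then have "\<bar>\<xi>\<bar> * H \<le> 2 * s"
      using D s0 by (cases "\<xi> = 0") (simp_all add: measure_triangle)
    also have "\<dots> \<le> 2 * s * (1 + \<eta>)" using s0 \<eta> by (simp add: mult_left_mono algebra_simps)
    finally show ?thesis .
  next
    case True
    \<comment> \<open>The crossing point of \<open>Bq\<close> and \<open>pA\<close> divides
      \<open>Bq\<close> in the ratio \<rho>, measured from \<open>q\<close>. It has height \<kappa>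
      = \<eta> \<rho> relative to \<open>A\<close>.\<close>
    define \<rho> where "\<rho> = r / (r - \<xi>)"
    have sg: "(\<xi> > 0 \<and> r < 0) \<or> (\<xi> < 0 \<and> r > 0)" using True by (auto simp: mult_less_0_iff)
    have \<rho>: "0 < \<rho>" "\<rho> < 1" using sg unfolding \<rho>_def by (auto simp: divide_simps)
    have r: "r * (1 - \<rho>) = - \<rho> * \<xi>" using sg unfolding \<rho>_def by (auto simp: field_simps)
    define \<kappa> where "\<kappa> = \<eta> * \<rho>"
    have \<kappa>: "0 \<le> \<kappa>" "\<kappa> \<le> 1" using \<eta> \<rho> by (auto simp: \<kappa>_def mult_le_one)
    define z where "z = p + \<kappa> *\<^sub>R a"
    have z: "z = B + (1 - \<rho>) *\<^sub>R (q - B)"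
    proof -
      have "q - B = (r - \<xi>) *\<^sub>R e - \<eta> *\<^sub>R a" using B q by (simp add: algebra_simps)
      then have E: "B + (1 - \<rho>) *\<^sub>R (q - B) = p + (\<xi> + (1 - \<rho>) * (r - \<xi>)) *\<^sub>R e + (\<eta> - (1 - \<rho>) * \<eta>) *\<^sub>R a"
        using B by (simp add: algebra_simps)
      have E0: "\<xi> + (1 - \<rho>) * (r - \<xi>) = 0" using r by (simp add: algebra_simps)
      show ?thesis unfolding E E0 z_def \<kappa>_def by (simp add: algebra_simps)
    qed
    have zBq: "z \<in> closed_segment B q" unfolding in_closed_segment_iff z using \<rho> by (intro exI[of _ "1 - \<rho>"]) auto
    have zAp: "z \<in> closed_segment p A"
      unfolding in_closed_segment_iff z_def a_def using \<kappa> by blast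
    have subz: "closed_segment B z \<subseteq> P" "closed_segment z q \<subseteq> P" "closed_segment p z \<subseteq> P" "closed_segment z A \<subseteq> P"
      using closed_segment_parts[OF zBq] closed_segment_parts[OF zAp] Bq Ap closed_segment_commute[of A p] by blast+
    have "\<bar>wedge (B - A) (z - A)\<bar> \<le> 2 * s" unfolding s_def
      by (rule wedge_le_smc) (use AB subz in \<open>auto simp: closed_segment_commute\<close>)
    moreover have "wedge (B - A) (z - A) = \<xi> * (\<kappa> - 1) * H"
    proof -
      have "B - A = \<xi> *\<^sub>R e + (\<eta> - 1) *\<^sub>R a" using B by (simp add: a_def algebra_simps)
      moreover have "z - A = (\<kappa> - 1) *\<^sub>R a" by (simp add: z_def a_def algebra_simps)
      ultimately show ?thesis by (simp add: wedge_add_left ea)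
    qed
    ultimately have 1: "\<bar>\<xi>\<bar> * H * (1 - \<kappa>) \<le> 2 * s" using Hpos \<kappa> by (simp add: abs_mult algebra_simps)
    have "\<bar>wedge (q - p) (z - p)\<bar> \<le> 2 * s" unfolding s_def
      by (rule wedge_le_smc) (use pq subz in \<open>auto simp: closed_segment_commute\<close>)
    moreover have "wedge (q - p) (z - p) = r * \<kappa> * H" unfolding q by (simp add: z_def ea)
    ultimately have "\<bar>r\<bar> * \<kappa> * H \<le> 2 * s" using Hpos \<kappa> by (simp add: abs_mult)
    moreover have "\<bar>r\<bar> * (1 - \<rho>) = \<rho> * \<bar>\<xi>\<bar>" using r \<rho> by (metis abs_minus_cancel abs_mult abs_of_pos diff_gt_0_iff_gt mult_minus_left)
    ultimately have 2: "\<bar>\<xi>\<bar> * H * (\<kappa> * \<rho>) \<le> 2 * s * (1 - \<rho>)"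
    proof -
      assume le: "\<bar>r\<bar> * \<kappa> * H \<le> 2 * s" and eq: "\<bar>r\<bar> * (1 - \<rho>) = \<rho> * \<bar>\<xi>\<bar>"
      have "(\<bar>r\<bar> * \<kappa> * H) * (1 - \<rho>) \<le> 2 * s * (1 - \<rho>)" using le \<rho> by (intro mult_right_mono) auto
      moreover have "(\<bar>r\<bar> * \<kappa> * H) * (1 - \<rho>) = (\<bar>r\<bar> * (1 - \<rho>)) * \<kappa> * H" by simp
      ultimately show ?thesis unfolding eq by (simp add: algebra_simps)
    qed
    define X where "X = \<bar>\<xi>\<bar> * H"
    have X: "X \<ge> 0" using Hpos by (simp add: X_def)
    show ?thesis
    \<comment> \<open>The triangle \<open>ABz\<close> gives
      \<open>X * (1 - \<kappa>) \<le> 2 * s\<close>, the triangle \<open>pqz\<close> gives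
      \<open>X * (\<kappa> * \<rho>) \<le> 2 * s * (1 - \<rho>)\<close>. The first suffices for
      small \<rho>, the second for large \<rho>. When \<eta> > 0 and \<rho> = 1 / (1 + \<eta>), both
      amount exactly to the claim.\<close>
    proof (cases "\<rho> * (1 + \<eta>) \<le> 1")
      case True
      have "1 \<le> (1 - \<kappa>) * (1 + \<eta>)"
      proof -
        have "\<kappa> * (1 + \<eta>) \<le> \<eta>" using True \<eta> mult_left_mono[OF True \<eta>(1)] by (simp add: \<kappa>_def algebra_simps)
        then show ?thesis by (simp add: algebra_simps)
      qed
      then have "X * 1 \<le> X * ((1 - \<kappa>) * (1 + \<eta>))" using X by (intro mult_left_mono)
      also have "\<dots> \<le> (2 * s) * (1 + \<eta>)"
        using mult_right_mono[OF 1, of "1 + \<eta>"] \<eta> by (simp add: X_def algebra_simps)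
      finally show ?thesis by (simp add: X_def)
    next
      case False
      have "1 - \<rho> \<le> (1 + \<eta>) * (\<kappa> * \<rho>)"
      proof -
        have "\<rho> * (1 + \<eta>) - 1 \<ge> 0" using False by simp
        have "(1 + \<eta>) * (\<kappa> * \<rho>) = (\<rho> * (1 + \<eta>)) * (\<eta> * \<rho>)" by (simp add: \<kappa>_def)
        also have "\<dots> \<ge> 1 * (\<eta> * \<rho>)" using False \<eta> \<rho> by (intro mult_right_mono) auto
        finally have "(1 + \<eta>) * (\<kappa> * \<rho>) \<ge> \<eta> * \<rho>" by simp
        moreover have "\<eta> * \<rho> \<ge> 1 - \<rho>" using False by (simp add: algebra_simps)
        ultimately show ?thesis by linarith
      qed
      then have "X * (1 - \<rho>) \<le> X * ((1 + \<eta>) * (\<kappa> * \<rho>))" using X by (intro mult_left_mono)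
      also have "\<dots> = (X * (\<kappa> * \<rho>)) * (1 + \<eta>)" by simp
      also have "\<dots> \<le> (2 * s * (1 - \<rho>)) * (1 + \<eta>)"
        using 2 \<eta> unfolding X_def by (intro mult_right_mono) auto
      finally have "X * (1 - \<rho>) \<le> (2 * s * (1 + \<eta>)) * (1 - \<rho>)" by (simp add: algebra_simps)
      then show ?thesis using \<rho> by (simp add: X_def)
    qed
  qed
  then show ?thesis using D by (simp add: s_def \<eta>_def H_def)
qed

section \<open>Regions that contain the charged partners\<close>

lemma chord_segment_in_P:
  assumes "chord v u" "p \<in> closed_segment v u" "q \<in> closed_segment v u"
  shows "closed_segment p q \<subseteq> P"
proof -
  have "closed_segment v u \<subseteq> P"
    using assms(1) closure_mono[of "open_segment v u" G] by (simp add: P_eq chord_def closure_open_segment)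
  moreover have "closed_segment p q \<subseteq> closed_segment v u"
    using assms by (simp add: subset_closed_segment)
  ultimately show ?thesis by blast
qed

lemma ht_closed_segment: "x \<in> closed_segment v u \<Longrightarrow> ht v u x = 0"
  by (auto simp: in_closed_segment_iff ht_affine')

text \<open>A point \<open>B\<close> of a child is at most twice as far from \<open>A\<close> as the point where \<open>AB\<close> crosses the
  child's window, so that the bound for that point gives one for \<open>B\<close>.\<close>

lemma lower_neighbours_bound:
  assumes c: "chord v u" and A: "A \<in> body v u" and p: "p \<in> open_segment v u" "sees A p"
    and AB: "sees A B" and le: "ht v u B \<le> ht v u A"
    and B: "B \<in> body v u \<or> (\<exists>v' u'. child v u v' u' \<and> B \<in> body v' u' \<and> ht v' u' B \<le> - ht v' u' A)"
  shows "\<bar>wedge (A - p) (B - p)\<bar> \<le> 2 * smc P * (3 + ht v u B / ht v u A)"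
    "- 1 \<le> ht v u B / ht v u A" "ht v u B / ht v u A \<le> 1"
proof -
  define s where "s = smc P"
  define \<eta> where "\<eta> = ht v u B / ht v u A"
  have s0: "s \<ge> 0" using smc_nonneg by (simp add: s_def)
  have hA: "ht v u A > 0" using A by (simp add: body_def)
  have pc: "p \<in> closed_segment v u" using p segment_open_subset_closed by blast
  have vu: "v \<noteq> u" using c by (simp add: chord_def)
  have inP: "closed_segment x y \<subseteq> P" if "sees x y" for x y using that G_subset_P by blast
  have "\<bar>wedge (A - p) (B - p)\<bar> \<le> 2 * s * (3 + \<eta>) \<and> - 1 \<le> \<eta>"
  proof (cases "B \<in> body v u")
    case True
    then obtain q where q: "q \<in> open_segment v u" "sees B q" and hB: "ht v u B > 0"
      by (auto simp: body_def)
    have qc: "q \<in> closed_segment v u" using q segment_open_subset_closed by blast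
    have "\<bar>wedge (A - p) (B - p)\<bar> \<le> 2 * s * (1 + \<eta>)"
      unfolding s_def \<eta>_def
      by (rule mutual_visibility_bound[OF inP[OF AB] inP[OF p(2)] inP[OF q(2)] chord_segment_in_P[OF c pc qc] vu])
        (use ht_closed_segment pc qc hA hB le in auto)
    also have "\<dots> \<le> 2 * s * (3 + \<eta>)" using s0 by (intro mult_left_mono) auto
    finally show ?thesis using hA hB by (simp add: \<eta>_def add_nonneg_nonneg order_trans[of "-1" 0])
  next
    case False
    then obtain v' u' where ch: "child v u v' u'" and B': "B \<in> body v' u'" "ht v' u' B \<le> - ht v' u' A"
      using B by blast
    obtain t where t: "0 < t" "t < 1" and z: "A + t *\<^sub>R (B - A) \<in> open_segment v' u'" and neg: "ht v' u' A < 0"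
      using child_crossing[OF c ch A B'(1) AB] .
    define z where "z = A + t *\<^sub>R (B - A)"
    have "(1 - t) * ht v' u' A + t * ht v' u' B = 0" using ht_open_segment[OF z] by (simp add: ht_affine')
    then have "(1 - t) * (- ht v' u' A) = t * ht v' u' B" by (simp add: algebra_simps)
    also have "\<dots> \<le> t * (- ht v' u' A)" using B'(2) t by (intro mult_left_mono) auto
    finally have "(1 - t) * (- ht v' u' A) \<le> t * (- ht v' u' A)" .
    then have t2: "1 - t \<le> t" using neg by (simp add: mult_le_cancel_right)
    have hz: "ht v u z = (1 - t) * ht v u A + t * ht v u B" unfolding z_def by (rule ht_affine')
    have hz0: "ht v u z \<ge> 0" using child_ht_nonneg[OF ch z] by (simp add: z_def)
    have hz1: "ht v u z \<le> ht v u A" unfolding hz using le t by (simp add: algebra_simps mult_left_mono)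
    obtain q where q: "q \<in> closed_segment v u" "closed_segment q z \<subseteq> P"
      using ch z unfolding child_def z_def by blast
    have zseg: "z \<in> closed_segment A B" unfolding in_closed_segment_iff z_def using t by (intro exI[of _ t]) auto
    have Az: "closed_segment A z \<subseteq> P" using closed_segment_parts(1)[OF zseg] AB G_subset_P by blast
    have zq: "closed_segment z q \<subseteq> P" using q(2) by (simp add: closed_segment_commute)
    have "\<bar>wedge (A - p) (z - p)\<bar> \<le> 2 * s * (1 + ht v u z / ht v u A)"
      unfolding s_def
      by (rule mutual_visibility_bound[OF Az inP[OF p(2)] zq chord_segment_in_P[OF c pc q(1)] vu])
        (use ht_closed_segment pc q(1) hA hz0 hz1 in auto)
    moreover have "wedge (A - p) (z - p) = t * wedge (A - p) (B - p)"
    proof -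
      have "z - p = (1 - t) *\<^sub>R (A - p) + t *\<^sub>R (B - p)" by (simp add: z_def algebra_simps)
      then show ?thesis by (simp add: wedge_add_right)
    qed
    moreover have hzA: "ht v u z / ht v u A = (1 - t) + t * \<eta>"
      using hA by (simp add: hz \<eta>_def add_divide_distrib)
    ultimately have "t * \<bar>wedge (A - p) (B - p)\<bar> \<le> 2 * s * (1 + ((1 - t) + t * \<eta>))"
      using t by (simp add: abs_mult)
    \<comment> \<open>Since \<open>t\<close> is at least 1/2, 2 - \<open>t\<close> is at most 3
      \<open>t\<close>; this is the origin of the constant 3.\<close>
    also have "\<dots> \<le> 2 * s * (t * (3 + \<eta>))" using t2 s0 by (intro mult_left_mono) (auto simp: algebra_simps)
    finally have "t * \<bar>wedge (A - p) (B - p)\<bar> \<le> t * (2 * s * (3 + \<eta>))" by (simp only: mult.left_commute)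
    then have "\<bar>wedge (A - p) (B - p)\<bar> \<le> 2 * s * (3 + \<eta>)" by (simp only: mult_le_cancel_left_pos[OF t(1)])
    moreover have "- 1 \<le> \<eta>"
    proof -
      have "0 \<le> (1 - t) + t * \<eta>" using hz0 hA unfolding hzA[symmetric] by simp
      then have "0 \<le> t + t * \<eta>" using t2 by linarith
      then have "0 \<le> t * (1 + \<eta>)" by (simp add: algebra_simps)
      then show ?thesis using t by (simp add: zero_le_mult_iff)
    qed
    ultimately show ?thesis by blast
  qed
  then show "\<bar>wedge (A - p) (B - p)\<bar> \<le> 2 * smc P * (3 + ht v u B / ht v u A)" "- 1 \<le> ht v u B / ht v u A"
    by (simp_all add: s_def \<eta>_def)
  show "ht v u B / ht v u A \<le> 1" using le hA by simp
qed

text \<open>In the coordinates of \<open>measure_parallelogram\<close> the half width is 2 s (3 +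
  \<eta>) with \<eta> between -1 and 1. Two strips of height 1, with half width 6 s below the window
  and 8 s above it, have total area (12 + 16) s.\<close>

lemma lower_neighbours_region:
  assumes c: "chord v u" and A: "A \<in> body v u"
  obtains S where "S \<in> lmeasurable" "measure lebesgue S \<le> 28 * smc P"
    "\<And>B. sees A B \<Longrightarrow> ht v u B \<le> ht v u A \<Longrightarrow>
      B \<in> body v u \<or> (\<exists>v' u'. child v u v' u' \<and> B \<in> body v' u' \<and> ht v' u' B \<le> - ht v' u' A) \<Longrightarrow> B \<in> S"
proof -
  define s where "s = smc P"
  have s0: "s \<ge> 0" using smc_nonneg by (simp add: s_def)
  obtain p where p: "p \<in> open_segment v u" "sees A p" using A by (auto simp: body_def)
  have hA: "ht v u A > 0" using A by (simp add: body_def)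
  have hp: "ht v u x = wedge (u - v) (x - p)" for x
    using ht_open_segment[OF p(1)] by (simp add: ht_def wedge_linear)
  define a where "a = A - p"
  define R where "R \<alpha> \<beta>1 \<beta>2 = {x. - \<alpha> \<le> wedge a (x - p) \<and> wedge a (x - p) \<le> \<alpha> \<and>
    \<beta>1 \<le> wedge (u - v) (x - p) / ht v u A \<and> wedge (u - v) (x - p) / ht v u A \<le> \<beta>2}" for \<alpha> \<beta>1 \<beta>2
  have R: "R \<alpha> \<beta>1 \<beta>2 \<in> lmeasurable" "measure lebesgue (R \<alpha> \<beta>1 \<beta>2) = (2 * \<alpha>) * (\<beta>2 - \<beta>1)"
    if "0 \<le> \<alpha>" "\<beta>1 \<le> \<beta>2" for \<alpha> \<beta>1 \<beta>2
    using measure_parallelogram[of "u - v" a "ht v u A" "- \<alpha>" \<alpha> \<beta>1 \<beta>2 p] that hA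
    unfolding R_def by (simp_all add: hp[of A] a_def)
  define S where "S = R (6 * s) (- 1) 0 \<union> R (8 * s) 0 1"
  have "S \<in> lmeasurable" unfolding S_def using s0 by (intro fmeasurable.Un R) auto
  moreover have "measure lebesgue S \<le> 28 * smc P"
  proof -
    have "measure lebesgue S \<le> measure lebesgue (R (6 * s) (- 1) 0) + measure lebesgue (R (8 * s) 0 1)"
      unfolding S_def by (rule measure_Un_le) (use s0 R fmeasurableD in auto)
    then show ?thesis using s0 by (simp add: R s_def)
  qed
  moreover have "B \<in> S"
    if "sees A B" "ht v u B \<le> ht v u A"
      "B \<in> body v u \<or> (\<exists>v' u'. child v u v' u' \<and> B \<in> body v' u' \<and> ht v' u' B \<le> - ht v' u' A)" for B
  proof -
    define \<eta> where "\<eta> = ht v u B / ht v u A"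
    define \<xi> where "\<xi> = wedge a (B - p)"
    have bnd: "\<bar>\<xi>\<bar> \<le> 2 * s * (3 + \<eta>)" "- 1 \<le> \<eta>" "\<eta> \<le> 1"
      using lower_neighbours_bound[OF c A p that] by (simp_all add: \<xi>_def \<eta>_def a_def s_def)
    have m: "B \<in> R \<alpha> \<beta>1 \<beta>2 \<longleftrightarrow> \<bar>\<xi>\<bar> \<le> \<alpha> \<and> \<beta>1 \<le> \<eta> \<and> \<eta> \<le> \<beta>2" for \<alpha> \<beta>1 \<beta>2
      unfolding R_def \<xi>_def \<eta>_def hp[of B] by auto
    show ?thesis
    proof (cases "\<eta> \<le> 0")
      case True
      have "2 * s * (3 + \<eta>) \<le> 2 * s * 3" using True s0 by (intro mult_left_mono) auto
      then show ?thesis unfolding S_def using m True bnd by auto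
    next
      case False
      have "2 * s * (3 + \<eta>) \<le> 2 * s * 4" using bnd(3) s0 by (intro mult_left_mono) auto
      then show ?thesis unfolding S_def using m False bnd by auto
    qed
  qed
  ultimately show ?thesis using that by blast
qed

text \<open>The intersection of the lines \<open>AB\<close> and \<open>vu\<close>, given by a
  formula so that its dependence on \<open>(A, B)\<close> is visibly Borel.\<close>

definition crossing :: "real^2 \<Rightarrow> real^2 \<Rightarrow> real^2 \<Rightarrow> real^2 \<Rightarrow> real^2" where
  "crossing v u A B = A + (ht v u A / (ht v u A - ht v u B)) *\<^sub>R (B - A)"

lemma crossing_eq:
  assumes "ht v u A > 0" "ht v u B < 0" "ht v u (A + t *\<^sub>R (B - A)) = 0"
  shows "t = ht v u A / (ht v u A - ht v u B)" "crossing v u A B = A + t *\<^sub>R (B - A)"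
proof -
  have "(1 - t) * ht v u A + t * ht v u B = 0" using assms(3) by (simp add: ht_affine')
  then show "t = ht v u A / (ht v u A - ht v u B)" using assms by (simp add: field_simps)
  then show "crossing v u A B = A + t *\<^sub>R (B - A)" by (simp add: crossing_def)
qed

text \<open>The points \<open>B\<close> lie in the image, under the homothety with centre \<open>A\<close> and ratio 5, of the
  triangle spanned by \<open>A\<close> and the part of the window that \<open>A\<close> sees.\<close>

lemma across_region:
  assumes c: "chord v u" and A: "A \<in> body v u"
  obtains S where "S \<in> lmeasurable" "measure lebesgue S \<le> 25 * smc P"
    "\<And>B. sees A B \<Longrightarrow> ht v u B < 0 \<Longrightarrow> - ht v u B \<le> 4 * ht v u A \<Longrightarrow>
      crossing v u A B \<in> closed_segment v u \<Longrightarrow> B \<in> S"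
proof -
  define J where "J = {z \<in> closed_segment v u. closed_segment A z \<subseteq> P}"
  define K where "K = convex hull (insert A J)"
  have hA: "ht v u A > 0" using A by (simp add: body_def)
  \<comment> \<open>For two visible window points \<open>x\<close> and \<open>y\<close> the triangle
    \<open>A\<close>, \<open>x\<close>, \<open>y\<close> is filled. So the visible part of the
    window is convex, and \<open>K\<close> is just the union of the segments from \<open>A\<close>
    to it.\<close>
  have "convex J"
  proof (rule convexI)
    fix x y and r t :: real assume *: "x \<in> J" "y \<in> J" "0 \<le> r" "0 \<le> t" "r + t = 1"
    have "convex hull {A, x, y} \<subseteq> P"
      using * chord_segment_in_P[OF c] by (intro triangle_in_P) (auto simp: J_def closed_segment_commute)
    moreover have "r *\<^sub>R x + t *\<^sub>R y \<in> convex hull {A, x, y}"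
      unfolding convex_hull_3 using * by force
    moreover have "A \<in> convex hull {A, x, y}" by (simp add: hull_inc)
    ultimately have "closed_segment A (r *\<^sub>R x + t *\<^sub>R y) \<subseteq> P"
      using closed_segment_subset[OF _ _ convex_convex_hull, of A "{A, x, y}"] by blast
    moreover have "r *\<^sub>R x + t *\<^sub>R y \<in> closed_segment v u"
      using * convexD[OF convex_closed_segment[of v u]] by (simp add: J_def)
    ultimately show "r *\<^sub>R x + t *\<^sub>R y \<in> J" by (simp add: J_def)
  qed
  then have hJ: "convex hull J = J" by (simp add: hull_same)
  have "A \<in> P" using A body_subset_G G_subset_P by blast
  then have KP: "K \<subseteq> P" unfolding K_def convex_hull_insert_segments hJ by (auto simp: J_def)
  have "K \<in> lmeasurable"
    using KP P_bounded by (intro measurable_convex) (auto simp: K_def intro: bounded_subset)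
  note h = measure_homothety[OF this, of A 5]
  have "measure lebesgue ((\<lambda>x. A + 5 *\<^sub>R (x - A)) ` K) \<le> 25 * smc P"
    using h(2) smc_upper[OF _ KP] by (simp add: K_def)
  moreover have "B \<in> (\<lambda>x. A + 5 *\<^sub>R (x - A)) ` K"
    if B: "sees A B" "ht v u B < 0" "- ht v u B \<le> 4 * ht v u A"
      "crossing v u A B \<in> closed_segment v u" for B
  proof -
    define t where "t = ht v u A / (ht v u A - ht v u B)"
    have t: "t \<ge> 1 / 5" "t \<le> 1" using hA B unfolding t_def by (simp_all add: divide_simps)
    define z where "z = A + t *\<^sub>R (B - A)"
    have "crossing v u A B = z" by (simp add: crossing_def t_def z_def)
    moreover have zseg: "z \<in> closed_segment A B" unfolding in_closed_segment_iff z_def using t by (intro exI[of _ t]) auto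
    then have "closed_segment A z \<subseteq> P" using closed_segment_parts(1)[OF zseg] B(1) G_subset_P by blast
    ultimately have zJ: "z \<in> J" using B(4) by (simp add: J_def)
    \<comment> \<open>The preimage of \<open>B\<close> under the homothety. It does not lie beyond
      \<open>z\<close>, because \<open>t\<close> is at least 1/5.\<close>
    define w where "w = A + (1 / (5 * t)) *\<^sub>R (z - A)"
    have "w \<in> closed_segment A z"
      unfolding in_closed_segment_iff w_def using t by (intro exI[of _ "1 / (5 * t)"]) (auto simp: divide_simps)
    then have "w \<in> K" unfolding K_def convex_hull_insert_segments hJ using zJ by auto
    moreover have "B = A + 5 *\<^sub>R (w - A)" using t by (simp add: w_def z_def)
    ultimately show ?thesis by blast
  qed
  ultimately show ?thesis using that h(1) by blast
qed

text \<open>Here \<open>A\<close> sees \<open>B\<close> through its own window at \<open>Z1\<close>, and \<open>Z2\<close> is either \<open>B\<close> or the point where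
  \<open>AB\<close> enters the sibling that contains \<open>B\<close>. As \<open>B\<close> is more than four times farther from the window
  than \<open>A\<close>, the point \<open>Z1\<close> has height at least \<open>3/5\<close> of that of \<open>A\<close> above the parent's window, so
  the bound for \<open>Z1\<close> and \<open>Z2\<close> does not degenerate.\<close>

lemma far_neighbours_region:
  assumes c: "chord v u" and ch: "child v u v1 u1" and A: "A \<in> body v1 u1"
  obtains S where "S \<in> lmeasurable" "measure lebesgue S \<le> 36 * smc P"
    "\<And>B t1 t2 q. sees A B \<Longrightarrow> ht v u B \<le> ht v u A \<Longrightarrow>
      - ht v1 u1 B > 4 * ht v1 u1 A \<Longrightarrow> 0 < t1 \<Longrightarrow> t1 < t2 \<Longrightarrow> t2 \<le> 1 \<Longrightarrow> 1 - t2 \<le> t2 \<Longrightarrow>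
      A + t1 *\<^sub>R (B - A) \<in> open_segment v1 u1 \<Longrightarrow> ht v u (A + t1 *\<^sub>R (B - A)) > 0 \<Longrightarrow>
      ht v u (A + t2 *\<^sub>R (B - A)) \<ge> 0 \<Longrightarrow> q \<in> closed_segment v u \<Longrightarrow>
      closed_segment (A + t2 *\<^sub>R (B - A)) q \<subseteq> P \<Longrightarrow> B \<in> S"
proof -
  define s where "s = smc P"
  have s0: "s \<ge> 0" using smc_nonneg by (simp add: s_def)
  have vu: "v \<noteq> u" using c by (simp add: chord_def)
  have vu1: "v1 \<noteq> u1" using child_chord[OF ch] by (simp add: chord_def)
  have h1A: "ht v1 u1 A > 0" using A by (simp add: body_def)
  \<comment> \<open>The point where the line of the child's window meets the parent's window. It
    serves as the base point seen from \<open>Z1\<close>.\<close>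
  obtain p where p: "p \<in> closed_segment v u" "ht v1 u1 p = 0" "\<And>z. z \<in> open_segment v1 u1 \<Longrightarrow> closed_segment p z \<subseteq> P"
    using ch unfolding child_def by blast
  have hp: "ht v u x = wedge (u - v) (x - p)" for x
    using ht_closed_segment[OF p(1)] by (simp add: ht_def wedge_linear)
  have h1p: "ht v1 u1 x = wedge (u1 - v1) (x - p)" for x
    using p(2) by (simp add: ht_def wedge_linear)
  define m where "m = wedge (u - v) (u1 - v1)"
  define H where "H = ht v u A"
  define e where "e = (H / m) *\<^sub>R (u1 - v1)"
  define \<xi> where "\<xi> x = wedge e (x - p)" for x
  have \<xi>h1: "\<xi> x = H / m * ht v1 u1 x" for x by (simp add: \<xi>_def e_def h1p)
  \<comment> \<open>160/9 is 20/3 times 8/3. The first factor bounds \<xi> at \<open>Z2\<close>; the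
    second is the largest value of (1 - t1) / (t2 - t1) for t1 \<le> 1/5 and t2 \<ge> 1/2.\<close>
  define b where "b = 160 / 9 * s"
  \<comment> \<open>\<open>B\<close> lies behind the window of \<open>A\<close>, so the sign of
    \<xi> at \<open>B\<close> is opposite to that of \<open>H / m\<close>, and a strip of width
    \<open>b\<close> on one side suffices. With a height range of length 2 the area is 320/9 times
    \<open>s\<close>, at most 36 times.\<close>
  define \<alpha>1 \<alpha>2 where "\<alpha>1 = (if H / m > 0 then - b else 0)" and "\<alpha>2 = (if H / m > 0 then 0 else b)"
  have b0: "b \<ge> 0" using s0 by (simp add: b_def)
  \<comment> \<open>In the excluded cases no \<open>B\<close> qualifies: the crossing point on the
    window of \<open>A\<close> could not have positive height over the parent's window.\<close>
  define S where "S = (if m = 0 \<or> H \<le> 0 then {} else {x. \<alpha>1 \<le> wedge e (x - p) \<and> wedge e (x - p) \<le> \<alpha>2 \<and>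
    - 1 \<le> wedge (u - v) (x - p) / H \<and> wedge (u - v) (x - p) / H \<le> 1})"
  have ae: "\<alpha>1 \<le> \<alpha>2" "\<alpha>2 - \<alpha>1 = b" using b0 by (auto simp: \<alpha>1_def \<alpha>2_def)
  have S: "S \<in> lmeasurable \<and> measure lebesgue S \<le> 36 * smc P"
  proof (cases "m = 0 \<or> H \<le> 0")
    case True
    then show ?thesis using smc_nonneg by (simp add: S_def)
  next
    case False
    have we: "wedge (u - v) e = H" using False by (simp add: e_def m_def)
    have "H \<noteq> 0" using False by simp
    note M = measure_parallelogram[OF we this ae(1), of "-1" 1 p]
    show ?thesis using M False s0 by (simp add: S_def ae b_def s_def)
  qed
  moreover have "B \<in> S"
    if AB: "sees A B" and le: "ht v u B \<le> ht v u A" and far: "- ht v1 u1 B > 4 * ht v1 u1 A"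
      and t: "0 < t1" "t1 < t2" "t2 \<le> 1" "1 - t2 \<le> t2" and z1: "A + t1 *\<^sub>R (B - A) \<in> open_segment v1 u1"
      and hz1: "ht v u (A + t1 *\<^sub>R (B - A)) > 0" and hz2: "ht v u (A + t2 *\<^sub>R (B - A)) \<ge> 0"
      and q: "q \<in> closed_segment v u" "closed_segment (A + t2 *\<^sub>R (B - A)) q \<subseteq> P" for B t1 t2 q
  proof -
    define Z1 Z2 where "Z1 = A + t1 *\<^sub>R (B - A)" and "Z2 = A + t2 *\<^sub>R (B - A)"
    define \<Delta> where "\<Delta> = H - ht v u B"
    have lin: "ht v u (A + x *\<^sub>R (B - A)) = H - x * \<Delta>" for x
      unfolding ht_affine' H_def \<Delta>_def by (simp add: algebra_simps)
    have \<Delta>: "\<Delta> \<ge> 0" using le by (simp add: \<Delta>_def H_def)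
    have "t1 * \<Delta> \<ge> 0" using t \<Delta> by simp
    then have H: "H > 0" using hz1 lin[of t1] by linarith
    have "\<exists>k. Z1 - p = k *\<^sub>R (u1 - v1)"
      using wedge_eq_0_iff[of "u1 - v1" "Z1 - p"] ht_open_segment[OF z1] vu1 unfolding h1p Z1_def by simp
    then obtain k where k: "Z1 - p = k *\<^sub>R (u1 - v1)" by blast
    define \<zeta> where "\<zeta> = ht v u Z1 / H"
    have hZ1: "ht v u Z1 = k * m" unfolding hp k m_def by simp
    have m: "m \<noteq> 0" using hz1 hZ1 by (auto simp: Z1_def)
    have Z1e: "Z1 - p = \<zeta> *\<^sub>R e" using m H by (simp add: k \<zeta>_def hZ1 e_def)
    have h1z: "(1 - t1) * ht v1 u1 A + t1 * ht v1 u1 B = 0" using ht_open_segment[OF z1] by (simp add: ht_affine')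
    \<comment> \<open>The factor 4 puts the crossing into the first fifth of
      \<open>AB\<close>.\<close>
    have t15: "t1 < 1 / 5"
    proof -
      have "t1 * (- ht v1 u1 B) > t1 * (4 * ht v1 u1 A)" using far t(1) by (intro mult_strict_left_mono)
      then have "(1 - t1) * ht v1 u1 A > 4 * t1 * ht v1 u1 A" using h1z by (simp add: algebra_simps)
      then have "1 - t1 > 4 * t1" using h1A by (simp add: mult_less_cancel_right)
      then show ?thesis by simp
    qed
    have "t2 * \<Delta> \<le> H" using hz2 lin[of t2] by simp
    moreover have "(1 / 2) * \<Delta> \<le> t2 * \<Delta>" using t(4) \<Delta> by (intro mult_right_mono) auto
    ultimately have \<Delta>2: "\<Delta> \<le> 2 * H" by linarith
    \<comment> \<open>The height is still nonnegative at \<open>Z2\<close>, in the second half of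
      \<open>AB\<close>. So it drops by at most \<open>2 * H\<close> along \<open>AB\<close>, and by
      less than 2/5 of \<open>H\<close> up to \<open>Z1\<close>.\<close>
    have \<zeta>: "\<zeta> > 3 / 5"
    proof -
      have "t1 * \<Delta> \<le> t1 * (2 * H)" using \<Delta>2 t by (intro mult_left_mono) auto
      also have "\<dots> < (1/5) * (2 * H)" using t15 H by (intro mult_strict_right_mono) auto
      finally have "ht v u Z1 > 3 / 5 * H" using lin[of t1] by (simp add: Z1_def)
      then show ?thesis using H by (simp add: \<zeta>_def pos_less_divide_eq)
    qed
    have "(t2 - t1) * \<Delta> \<ge> 0" using t \<Delta> by simp
    then have z21: "ht v u Z2 \<le> ht v u Z1" using lin[of t1] lin[of t2] by (simp add: Z1_def Z2_def algebra_simps)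
    have Zs: "closed_segment Z1 Z2 \<subseteq> P"
    proof -
      have "Z1 \<in> closed_segment A B" "Z2 \<in> closed_segment A B"
        unfolding in_closed_segment_iff Z1_def Z2_def using t by (auto intro: exI[of _ t1] exI[of _ t2])
      then show ?thesis using AB G_subset_P by (meson order_trans subset_closed_segment)
    qed
    have Z1p: "closed_segment Z1 p \<subseteq> P" using p(3)[OF z1] by (simp add: Z1_def closed_segment_commute)
    have "\<bar>wedge (Z1 - p) (Z2 - p)\<bar> \<le> 2 * s * (1 + ht v u Z2 / ht v u Z1)"
      unfolding s_def
      by (rule mutual_visibility_bound[OF Zs Z1p _ chord_segment_in_P[OF c p(1) q(1)] vu])
        (use q ht_closed_segment[OF p(1)] ht_closed_segment[OF q(1)] hz1 hz2 z21 in \<open>auto simp: Z1_def Z2_def\<close>)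
    also have "\<dots> \<le> 2 * s * 2" using z21 hz1 s0 by (intro mult_left_mono) (auto simp: Z1_def)
    finally have "\<zeta> * \<bar>\<xi> Z2\<bar> \<le> 4 * s" using \<zeta> by (simp add: Z1e \<xi>_def abs_mult)
    moreover have "(3/5) * \<bar>\<xi> Z2\<bar> \<le> \<zeta> * \<bar>\<xi> Z2\<bar>" using \<zeta> by (intro mult_right_mono) auto
    ultimately have x2: "\<bar>\<xi> Z2\<bar> \<le> 20 / 3 * s" by linarith
    \<comment> \<open>The height over the window of \<open>A\<close> is affine along
      \<open>AB\<close> and vanishes at \<open>t1\<close>. As \<xi> is a multiple of it, this gives
      the ratio of \<xi> at \<open>B\<close> to \<xi> at \<open>Z2\<close>.\<close>
    have lin1: "t1 * ht v1 u1 (A + x *\<^sub>R (B - A)) = (t1 - x) * ht v1 u1 A" for x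
    proof -
      have "t1 * ht v1 u1 (A + x *\<^sub>R (B - A)) = (1 - x) * t1 * ht v1 u1 A + x * (t1 * ht v1 u1 B)"
        unfolding ht_affine' by (simp add: algebra_simps)
      also have "t1 * ht v1 u1 B = - (1 - t1) * ht v1 u1 A" using h1z by (simp add: algebra_simps)
      finally show ?thesis by (simp add: algebra_simps)
    qed
    have e1: "t1 * ht v1 u1 B = (t1 - 1) * ht v1 u1 A" using lin1[of 1] by simp
    have e2: "t1 * ht v1 u1 Z2 = (t1 - t2) * ht v1 u1 A" using lin1[of t2] by (simp only: Z2_def)
    have "t1 * ((t2 - t1) * ht v1 u1 B) = (t2 - t1) * (t1 * ht v1 u1 B)" by simp
    also have "\<dots> = (1 - t1) * (t1 * ht v1 u1 Z2)" unfolding e1 e2 by (simp add: algebra_simps)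
    finally have "t1 * ((t2 - t1) * ht v1 u1 B) = t1 * ((1 - t1) * ht v1 u1 Z2)" by simp
    then have "(t2 - t1) * ht v1 u1 B = (1 - t1) * ht v1 u1 Z2" using t(1) by simp
    then have "H / m * ((t2 - t1) * ht v1 u1 B) = H / m * ((1 - t1) * ht v1 u1 Z2)" by (rule arg_cong)
    then have ratio: "(t2 - t1) * \<xi> B = (1 - t1) * \<xi> Z2" unfolding \<xi>h1 by (simp only: mult.left_commute)
    have "(t2 - t1) * \<bar>\<xi> B\<bar> = (1 - t1) * \<bar>\<xi> Z2\<bar>"
      using arg_cong[OF ratio, of abs] t by (simp add: abs_mult)
    also have "\<dots> \<le> (8/3 * (t2 - t1)) * \<bar>\<xi> Z2\<bar>" using t t15 by (intro mult_right_mono) auto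
    finally have "(t2 - t1) * \<bar>\<xi> B\<bar> \<le> (t2 - t1) * (8/3 * \<bar>\<xi> Z2\<bar>)" by (simp add: algebra_simps)
    then have "\<bar>\<xi> B\<bar> \<le> 8/3 * \<bar>\<xi> Z2\<bar>" using t by (simp add: mult_le_cancel_left)
    then have xB: "\<bar>\<xi> B\<bar> \<le> b" using x2 by (simp add: b_def)
    have h1B: "ht v1 u1 B < 0" using far h1A by linarith
    have "\<alpha>1 \<le> \<xi> B \<and> \<xi> B \<le> \<alpha>2"
    proof (cases "H / m > 0")
      case True
      then have "\<xi> B < 0" unfolding \<xi>h1 using h1B by (rule mult_pos_neg)
      then show ?thesis using True xB by (simp add: \<alpha>1_def \<alpha>2_def)
    next
      case False
      then have "H / m < 0" using H m by (simp add: divide_less_0_iff zero_less_divide_iff)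
      then have "\<xi> B > 0" unfolding \<xi>h1 using h1B by (rule mult_neg_neg)
      then show ?thesis using False xB by (simp add: \<alpha>1_def \<alpha>2_def)
    qed
    moreover have "- 1 \<le> ht v u B / H" "ht v u B / H \<le> 1"
      using \<Delta>2 \<Delta> H by (simp_all add: \<Delta>_def pos_le_divide_eq pos_divide_le_eq)
    ultimately show ?thesis using m H unfolding S_def \<xi>_def hp by simp
  qed
  ultimately show ?thesis using that[of S] by blast
qed

section \<open>Charging visible pairs\<close>

text \<open>In each of the following relations the first point is the one that is charged.\<close>

definition same_body :: "real^2 \<Rightarrow> real^2 \<Rightarrow> ((real^2) \<times> (real^2)) set" where
  "same_body v u = {(A, B). A \<in> body v u \<and> B \<in> body v u \<and> ht v u B \<le> ht v u A}"

definition into_child :: "real^2 \<Rightarrow> real^2 \<Rightarrow> real^2 \<Rightarrow> real^2 \<Rightarrow> ((real^2) \<times> (real^2)) set" where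
  "into_child v u v' u' = {(A, B). A \<in> body v u \<and> B \<in> body v' u' \<and> ht v u B \<le> ht v u A \<and>
    ht v' u' B \<le> - ht v' u' A}"

definition across :: "real^2 \<Rightarrow> real^2 \<Rightarrow> ((real^2) \<times> (real^2)) set" where
  "across v u = {(A, B). A \<in> body v u \<and> ht v u B < 0 \<and> - ht v u B \<le> 4 * ht v u A \<and>
    crossing v u A B \<in> closed_segment v u}"

definition into_parent :: "real^2 \<Rightarrow> real^2 \<Rightarrow> real^2 \<Rightarrow> real^2 \<Rightarrow> ((real^2) \<times> (real^2)) set" where
  "into_parent v u v1 u1 = {(A, B). A \<in> body v1 u1 \<and> B \<in> body v u \<and> ht v u B \<le> ht v u A \<and>
    - ht v1 u1 B > 4 * ht v1 u1 A}"

definition into_sibling ::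
    "real^2 \<Rightarrow> real^2 \<Rightarrow> real^2 \<Rightarrow> real^2 \<Rightarrow> real^2 \<Rightarrow> real^2 \<Rightarrow> ((real^2) \<times> (real^2)) set" where
  "into_sibling v u v1 u1 v2 u2 = {(A, B). A \<in> body v1 u1 \<and> B \<in> body v2 u2 \<and> ht v u B \<le> ht v u A \<and>
    - ht v1 u1 B > 4 * ht v1 u1 A \<and> ht v2 u2 B \<le> - ht v2 u2 A}"

lemma borel_ht_fst_snd [measurable]:
  "(\<lambda>p. ht v u (fst p)) \<in> borel_measurable borel" "(\<lambda>p. ht v u (snd p)) \<in> borel_measurable borel"
  by (intro borel_measurable_continuous_onI continuous_intros)+

lemma borel_body_prod: "body v u \<times> body v' u' \<in> sets borel" "body v u \<times> UNIV \<in> sets borel"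
  by (intro borel_open open_Times body_open open_UNIV)+

lemma charges_borel:
  "same_body v u \<in> sets borel" "into_child v u v' u' \<in> sets borel" "across v u \<in> sets borel"
  "into_parent v u v' u' \<in> sets borel" "into_sibling v u v' u' v2 u2 \<in> sets borel"
proof -
  have "same_body v u = (body v u \<times> body v u) \<inter> {p \<in> space borel. ht v u (snd p) \<le> ht v u (fst p)}"
    by (auto simp: same_body_def)
  also have "\<dots> \<in> sets borel" by (intro sets.Int borel_body_prod) measurable
  finally show "same_body v u \<in> sets borel" .
  have "into_child v u v' u' = (body v u \<times> body v' u') \<inter> {p \<in> space borel. ht v u (snd p) \<le> ht v u (fst p) \<and>
      ht v' u' (snd p) \<le> - ht v' u' (fst p)}"
    by (auto simp: into_child_def)
  also have "\<dots> \<in> sets borel" by (intro sets.Int borel_body_prod) measurable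
  finally show "into_child v u v' u' \<in> sets borel" .
  have "into_parent v u v' u' = (body v' u' \<times> body v u) \<inter> {p \<in> space borel. ht v u (snd p) \<le> ht v u (fst p) \<and>
      - ht v' u' (snd p) > 4 * ht v' u' (fst p)}"
    by (auto simp: into_parent_def)
  also have "\<dots> \<in> sets borel" by (intro sets.Int borel_body_prod) measurable
  finally show "into_parent v u v' u' \<in> sets borel" .
  have "into_sibling v u v' u' v2 u2 = (body v' u' \<times> body v2 u2) \<inter> {p \<in> space borel. ht v u (snd p) \<le> ht v u (fst p) \<and>
      - ht v' u' (snd p) > 4 * ht v' u' (fst p) \<and> ht v2 u2 (snd p) \<le> - ht v2 u2 (fst p)}"
    by (auto simp: into_sibling_def)
  also have "\<dots> \<in> sets borel" by (intro sets.Int borel_body_prod) measurable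
  finally show "into_sibling v u v' u' v2 u2 \<in> sets borel" .
  define f where "f p = crossing v u (fst p) (snd p)" for p
  have cont: "(fst :: (real^2) \<times> (real^2) \<Rightarrow> real^2) \<in> borel_measurable borel"
    "(snd :: (real^2) \<times> (real^2) \<Rightarrow> real^2) \<in> borel_measurable borel"
    by (intro borel_measurable_continuous_onI continuous_intros)+
  have [measurable]: "f \<in> borel_measurable borel"
    unfolding f_def crossing_def
    by (intro borel_measurable_add borel_measurable_scaleR borel_measurable_divide borel_measurable_diff
        borel_ht_fst_snd cont)
  have [measurable]: "closed_segment v u \<in> sets borel" by (simp add: borel_closed)
  have "across v u = (body v u \<times> UNIV) \<inter> {p \<in> space borel. ht v u (snd p) < 0 \<and>
      - ht v u (snd p) \<le> 4 * ht v u (fst p) \<and> f p \<in> closed_segment v u}"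
    by (auto simp: across_def f_def)
  also have "\<dots> \<in> sets borel" by (intro sets.Int borel_body_prod) measurable
  finally show "across v u \<in> sets borel" .
qed

section \<open>The charge relation and its slices\<close>

context
  fixes a b
  assumes root: "chord a b"
begin

definition all_windows :: "((real^2) \<times> (real^2)) set" where
  "all_windows = (\<Union>n. windows a b n)"

lemma all_windows_chord: "(v, u) \<in> all_windows \<Longrightarrow> chord v u"
  using window_chord[OF root] by (auto simp: all_windows_def)

lemma all_windows_child: "(v, u) \<in> all_windows \<Longrightarrow> child v u v' u' \<Longrightarrow> (v', u') \<in> all_windows"
proof -
  assume "(v, u) \<in> all_windows" and ch: "child v u v' u'"
  then obtain n where "(v, u) \<in> windows a b n" by (auto simp: all_windows_def)
  then have "(v', u') \<in> windows a b (Suc n)" using ch by auto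
  then show ?thesis unfolding all_windows_def by blast
qed

lemma body_nonempty: "(v, u) \<in> all_windows \<Longrightarrow> body v u \<noteq> {}"
  using near_chord_in_body[of v u _ UNIV] all_windows_chord chord_nonempty by fastforce

lemma all_windows_body_unique:
  assumes "(v, u) \<in> all_windows" "(v', u') \<in> all_windows" "x \<in> body v u" "x \<in> body v' u'"
  shows "(v', u') = (v, u)"
  using body_unique(1)[OF root] assms by (auto simp: all_windows_def)

text \<open>The child's body determines its generation, so both parents are of one generation. Both
  of their pockets contain that body, hence they overlap and the parents agree.\<close>

lemma parent_unique:
  assumes w: "(v, u) \<in> all_windows" "(v', u') \<in> all_windows" and ch: "child v u x y" "child v' u' x y"
  shows "(v', u') = (v, u)"
proof -
  obtain n m where nm: "(v, u) \<in> windows a b n" "(v', u') \<in> windows a b m" using w by (auto simp: all_windows_def)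
  then have xy: "(x, y) \<in> windows a b (Suc n)" "(x, y) \<in> windows a b (Suc m)" using ch by auto
  obtain z where z: "z \<in> body x y" using body_nonempty[of x y] all_windows_child[OF w(1) ch(1)] by blast
  have "n = m" using body_unique(2)[OF root xy z z] by simp
  moreover have "z \<in> pocket v u" "z \<in> pocket v' u'"
    using z body_subset_pocket[OF child_chord[OF ch(1)]] child_pocket(1)[OF root all_windows_chord[OF w(1)] ch(1)]
      child_pocket(1)[OF root all_windows_chord[OF w(2)] ch(2)] by blast+
  ultimately show ?thesis using pockets_nested[OF root nm] by blast
qed

text \<open>The bodies are nonempty, open and pairwise disjoint, and they determine their windows.
  Countability makes \<open>charge\<close> Borel and the union of all windows a null set.\<close>

lemma countable_all_windows: "countable all_windows"
proof -
  let ?f = "\<lambda>(v, u). body v u"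
  have inj: "inj_on ?f all_windows"
  proof (rule inj_onI, clarify)
    fix v u v' u' assume w: "(v, u) \<in> all_windows" "(v', u') \<in> all_windows" "body v u = body v' u'"
    then obtain x where "x \<in> body v u" using body_nonempty by blast
    then show "v = v' \<and> u = u'" using all_windows_body_unique[OF w(1,2)] w(3) by auto
  qed
  have "countable (?f ` all_windows)"
  proof (rule countable_disjoint_open_subsets)
    show "open S" if "S \<in> ?f ` all_windows" for S using that body_open by auto
    show "pairwise disjnt (?f ` all_windows)"
      unfolding pairwise_def disjnt_iff using all_windows_body_unique by fastforce
  qed
  then show ?thesis using countable_image_inj_on[OF _ inj] by blast
qed

definition charge :: "((real^2) \<times> (real^2)) set" where
  "charge = {(A, B). sees A B} \<inter>
    ((\<Union>(v, u)\<in>all_windows. same_body v u \<union> across v u) \<union>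
     (\<Union>(v, u)\<in>all_windows. \<Union>(v', u')\<in>{(v', u') \<in> all_windows. child v u v' u'}.
        into_child v u v' u' \<union> into_parent v u v' u' \<union>
        (\<Union>(v2, u2)\<in>{(v2, u2) \<in> all_windows. child v u v2 u2 \<and> (v', u') \<noteq> (v2, u2)}. into_sibling v u v' u' v2 u2)))"

lemma charge_borel: "charge \<in> sets borel"
proof -
  have c: "countable {(v', u') \<in> all_windows. R v' u'}" for R
    by (rule countable_subset[OF _ countable_all_windows]) auto
  have "{(A, B). sees A B} \<in> sets borel"
    by (intro borel_open open_segments_visible G_open)
  then show ?thesis unfolding charge_def
    by (intro sets.Int sets.Un sets.countable_UN'' countable_all_windows c)
      (auto intro!: sets.Un sets.countable_UN'' c charges_borel countable_all_windows)
qed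

text \<open>\<open>A\<close> determines its window and the parent of that window, so three regions
  suffice: for partners in the body of \<open>A\<close> and its children, for partners moderately
  far across its window, and for those farther across. The areas add up to 28 + 25 + 36.\<close>

lemma charge_slice:
  assumes w: "(v, u) \<in> all_windows" and A: "A \<in> body v u"
  obtains S where "S \<in> lmeasurable" "measure lebesgue S \<le> 89 * smc P" "\<And>B. (A, B) \<in> charge \<Longrightarrow> B \<in> S"
proof -
  have c: "chord v u" using w by (rule all_windows_chord)
  obtain S1 where S1: "S1 \<in> lmeasurable" "measure lebesgue S1 \<le> 28 * smc P"
    "\<And>B. sees A B \<Longrightarrow> ht v u B \<le> ht v u A \<Longrightarrow>
      B \<in> body v u \<or> (\<exists>v' u'. child v u v' u' \<and> B \<in> body v' u' \<and> ht v' u' B \<le> - ht v' u' A) \<Longrightarrow> B \<in> S1"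
    using lower_neighbours_region[OF c A] by metis
  obtain S2 where S2: "S2 \<in> lmeasurable" "measure lebesgue S2 \<le> 25 * smc P"
    "\<And>B. sees A B \<Longrightarrow> ht v u B < 0 \<Longrightarrow> - ht v u B \<le> 4 * ht v u A \<Longrightarrow>
      crossing v u A B \<in> closed_segment v u \<Longrightarrow> B \<in> S2"
    using across_region[OF c A] by metis
  have "\<exists>S3. S3 \<in> lmeasurable \<and> measure lebesgue S3 \<le> 36 * smc P \<and>
    (\<forall>v0 u0 B. (v0, u0) \<in> all_windows \<longrightarrow> child v0 u0 v u \<longrightarrow> sees A B \<longrightarrow>
      (A, B) \<in> into_parent v0 u0 v u \<or>
      (\<exists>v2 u2. (v2, u2) \<in> all_windows \<and> child v0 u0 v2 u2 \<and> (v, u) \<noteq> (v2, u2) \<and> (A, B) \<in> into_sibling v0 u0 v u v2 u2) \<longrightarrow> B \<in> S3)"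
  proof (cases "\<exists>v0 u0. (v0, u0) \<in> all_windows \<and> child v0 u0 v u")
    case False
    then show ?thesis using smc_nonneg by (intro exI[of _ "{}"]) auto
  next
    case True
    then obtain v0 u0 where w0: "(v0, u0) \<in> all_windows" and ch: "child v0 u0 v u" by blast
    have c0: "chord v0 u0" using w0 by (rule all_windows_chord)
    obtain S3 where S3: "S3 \<in> lmeasurable" "measure lebesgue S3 \<le> 36 * smc P"
      "\<And>B t1 t2 q. sees A B \<Longrightarrow> ht v0 u0 B \<le> ht v0 u0 A \<Longrightarrow>
        - ht v u B > 4 * ht v u A \<Longrightarrow> 0 < t1 \<Longrightarrow> t1 < t2 \<Longrightarrow> t2 \<le> 1 \<Longrightarrow> 1 - t2 \<le> t2 \<Longrightarrow>
        A + t1 *\<^sub>R (B - A) \<in> open_segment v u \<Longrightarrow> ht v0 u0 (A + t1 *\<^sub>R (B - A)) > 0 \<Longrightarrow>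
        ht v0 u0 (A + t2 *\<^sub>R (B - A)) \<ge> 0 \<Longrightarrow> q \<in> closed_segment v0 u0 \<Longrightarrow>
        closed_segment (A + t2 *\<^sub>R (B - A)) q \<subseteq> P \<Longrightarrow> B \<in> S3"
      using far_neighbours_region[OF c0 ch A] by metis
    \<comment> \<open>For a partner in the parent's body the second point on the segment is
      \<open>B\<close> itself, that is, \<open>t2 = 1\<close>.\<close>
    have par: "B \<in> S3" if AB: "sees A B" and B: "(A, B) \<in> into_parent v0 u0 v u" for B
    proof -
      have B': "B \<in> body v0 u0" "ht v0 u0 B \<le> ht v0 u0 A" "- ht v u B > 4 * ht v u A"
        using B by (auto simp: into_parent_def)
      obtain r where r: "0 < r" "r < 1" "B + r *\<^sub>R (A - B) \<in> open_segment v u"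
        using child_crossing[OF c0 ch B'(1) A] AB by (metis closed_segment_commute)
      have z: "A + (1 - r) *\<^sub>R (B - A) \<in> open_segment v u" using r(3) by (simp add: algebra_simps)
      obtain q where q: "q \<in> open_segment v0 u0" "sees B q" and hB: "ht v0 u0 B > 0"
        using B'(1) by (auto simp: body_def)
      have "ht v0 u0 (A + (1 - r) *\<^sub>R (B - A)) = r * ht v0 u0 A + (1 - r) * ht v0 u0 B"
        by (simp only: ht_affine') simp
      also have "\<dots> > 0" using r hB B'(2) by (intro add_pos_pos mult_pos_pos) auto
      finally have hz: "ht v0 u0 (A + (1 - r) *\<^sub>R (B - A)) > 0" .
      have "closed_segment B q \<subseteq> P" using q(2) G_subset_P by blast
      then show ?thesis
        using r hB q(1) segment_open_subset_closed
        by (intro S3(3)[OF AB B'(2,3), of "1 - r" 1 q] z hz) auto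
    qed
    have sib: "B \<in> S3"
      if AB: "sees A B" and ch2: "child v0 u0 v2 u2" and ne: "(v, u) \<noteq> (v2, u2)"
        and B: "(A, B) \<in> into_sibling v0 u0 v u v2 u2" for B v2 u2
    proof -
      have B': "B \<in> body v2 u2" "ht v0 u0 B \<le> ht v0 u0 A" "- ht v u B > 4 * ht v u A" "ht v2 u2 B \<le> - ht v2 u2 A"
        using B by (auto simp: into_sibling_def)
      obtain n where n: "(v0, u0) \<in> windows a b n" using w0 by (auto simp: all_windows_def)
      obtain t1 s t2 where t: "0 < t1" "t1 < s" "s < t2" "t2 < 1"
        "A + t1 *\<^sub>R (B - A) \<in> open_segment v u" "A + s *\<^sub>R (B - A) \<in> body v0 u0"
        "A + t2 *\<^sub>R (B - A) \<in> open_segment v2 u2" "ht v u B < 0" "ht v2 u2 A < 0"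
        using sibling_crossing[OF root n ch ch2 ne A B'(1) AB] .
      \<comment> \<open>\<open>B\<close> is at most as far from its window as \<open>A\<close>, so
        the crossing is in the second half of \<open>AB\<close>.\<close>
      have "(1 - t2) * ht v2 u2 A + t2 * ht v2 u2 B = 0" using ht_open_segment[OF t(7)] unfolding ht_affine' .
      then have "(1 - t2) * (- ht v2 u2 A) = t2 * ht v2 u2 B" by (simp add: algebra_simps)
      also have "\<dots> \<le> t2 * (- ht v2 u2 A)" using B'(4) t by (intro mult_left_mono) auto
      finally have t2: "1 - t2 \<le> t2" using t(9) by (simp add: mult_le_cancel_right)
      have lin: "ht v0 u0 (A + x *\<^sub>R (B - A)) = ht v0 u0 A - x * (ht v0 u0 A - ht v0 u0 B)" for x
        unfolding ht_affine' by (simp add: algebra_simps)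
      \<comment> \<open>The height over the parent's window does not increase along
        \<open>AB\<close>, so its positivity at the later parameter \<open>s\<close>, inside the
        parent's body, carries back to \<open>t1\<close>.\<close>
      have "ht v0 u0 (A + s *\<^sub>R (B - A)) > 0" using t(6) by (simp add: body_def)
      moreover have "t1 * (ht v0 u0 A - ht v0 u0 B) \<le> s * (ht v0 u0 A - ht v0 u0 B)"
        using t B'(2) by (intro mult_right_mono) auto
      ultimately have hz: "ht v0 u0 (A + t1 *\<^sub>R (B - A)) > 0" unfolding lin by linarith
      obtain q where q: "q \<in> closed_segment v0 u0" "closed_segment q (A + t2 *\<^sub>R (B - A)) \<subseteq> P"
        using ch2 t(7) unfolding child_def by blast
      then have q2: "closed_segment (A + t2 *\<^sub>R (B - A)) q \<subseteq> P" by (simp add: closed_segment_commute)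
      show ?thesis
        by (rule S3(3)[OF AB B'(2,3) t(1) _ _ t2 t(5) hz child_ht_nonneg[OF ch2 t(7)] q(1) q2])
          (use t in auto)
    qed
    show ?thesis
    proof (intro exI[of _ S3] conjI S3(1,2) allI impI)
      fix v' u' B assume *: "(v', u') \<in> all_windows" "child v' u' v u" "sees A B"
        "(A, B) \<in> into_parent v' u' v u \<or>
        (\<exists>v2 u2. (v2, u2) \<in> all_windows \<and> child v' u' v2 u2 \<and> (v, u) \<noteq> (v2, u2) \<and> (A, B) \<in> into_sibling v' u' v u v2 u2)"
      have "(v', u') = (v0, u0)" using parent_unique[OF w0 *(1) ch *(2)] .
      then show "B \<in> S3" using * par sib by blast
    qed
  qed
  then obtain S3 where S3: "S3 \<in> lmeasurable" "measure lebesgue S3 \<le> 36 * smc P"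
    "\<And>v0 u0 B. (v0, u0) \<in> all_windows \<Longrightarrow> child v0 u0 v u \<Longrightarrow> sees A B \<Longrightarrow>
      (A, B) \<in> into_parent v0 u0 v u \<or>
      (\<exists>v2 u2. (v2, u2) \<in> all_windows \<and> child v0 u0 v2 u2 \<and> (v, u) \<noteq> (v2, u2) \<and> (A, B) \<in> into_sibling v0 u0 v u v2 u2) \<Longrightarrow> B \<in> S3"
    by blast
  have "B \<in> S1 \<union> S2 \<union> S3" if AB: "(A, B) \<in> charge" for B
  proof -
    have vis: "sees A B" using AB by (simp add: charge_def)
    have id: "(v', u') = (v, u)" if "(v', u') \<in> all_windows" "A \<in> body v' u'" for v' u'
      using all_windows_body_unique[OF w that(1) A that(2)] .
    consider (1) v' u' where "(v', u') \<in> all_windows" "(A, B) \<in> same_body v' u'"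
      | (2) v' u' where "(v', u') \<in> all_windows" "(A, B) \<in> across v' u'"
      | (3) v' u' v1 u1 where "(v', u') \<in> all_windows" "child v' u' v1 u1" "(A, B) \<in> into_child v' u' v1 u1"
      | (4) v' u' v1 u1 where "(v', u') \<in> all_windows" "(v1, u1) \<in> all_windows" "child v' u' v1 u1" "(A, B) \<in> into_parent v' u' v1 u1"
      | (5) v' u' v1 u1 v2 u2 where "(v', u') \<in> all_windows" "(v1, u1) \<in> all_windows" "child v' u' v1 u1"
          "(v2, u2) \<in> all_windows" "child v' u' v2 u2" "(v1, u1) \<noteq> (v2, u2)" "(A, B) \<in> into_sibling v' u' v1 u1 v2 u2"
      using AB unfolding charge_def by blast
    then show ?thesis
    proof cases
      case 1
      then have "(v', u') = (v, u)" using id by (auto simp: same_body_def)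
      then show ?thesis using 1 S1(3)[OF vis] by (auto simp: same_body_def)
    next
      case 2
      then have "(v', u') = (v, u)" using id by (auto simp: across_def)
      then show ?thesis using 2 S2(3)[OF vis] by (auto simp: across_def)
    next
      case 3
      then have "(v', u') = (v, u)" using id by (auto simp: into_child_def)
      then show ?thesis using 3 S1(3)[OF vis] by (auto simp: into_child_def)
    next
      case 4
      then have "(v1, u1) = (v, u)" using id by (auto simp: into_parent_def)
      then show ?thesis using 4 S3(3)[OF 4(1) _ vis] by auto
    next
      case 5
      then have "(v1, u1) = (v, u)" using id by (auto simp: into_sibling_def)
      then show ?thesis using 5 S3(3)[OF 5(1) _ vis] by auto
    qed
  qed
  moreover have "S1 \<union> S2 \<union> S3 \<in> lmeasurable" using S1 S2 S3 by auto
  moreover have "measure lebesgue (S1 \<union> S2 \<union> S3) \<le> 89 * smc P"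
  proof -
    have "measure lebesgue (S1 \<union> S2 \<union> S3) \<le> measure lebesgue (S1 \<union> S2) + measure lebesgue S3"
      by (rule measure_Un_le) (use S1 S2 S3 fmeasurableD in auto)
    moreover have "measure lebesgue (S1 \<union> S2) \<le> measure lebesgue S1 + measure lebesgue S2"
      by (rule measure_Un_le) (use S1 S2 fmeasurableD in auto)
    ultimately show ?thesis using S1(2) S2(2) S3(2) by linarith
  qed
  ultimately show ?thesis using that by blast
qed

text \<open>Within one body the point that is not lower is charged. For parent and child and for
  siblings, a point that sees its partner through its own window, at most four times as far beyond
  it, is charged by \<open>across\<close>. Otherwise the point that is not lower over the parent's
  window is charged, and the large ratio supplies the inequality about distances from the partner's
  window that \<open>into_child\<close> and \<open>into_sibling\<close> demand.\<close>

lemma charge_complete: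
  assumes A: "(vA, uA) \<in> all_windows" "A \<in> body vA uA" and B: "(vB, uB) \<in> all_windows" "B \<in> body vB uB"
    and AB: "sees A B"
  shows "(A, B) \<in> charge \<or> (B, A) \<in> charge"
proof -
  have BA: "sees B A" using AB by (simp add: closed_segment_commute)
  have sameI: "(A, B) \<in> charge" if "(v, u) \<in> all_windows" "(A, B) \<in> same_body v u" "sees A B" for A B v u
    unfolding charge_def using that by blast
  have acrossI: "(A, B) \<in> charge" if "(v, u) \<in> all_windows" "(A, B) \<in> across v u" "sees A B" for A B v u
    unfolding charge_def using that by blast
  have childI: "(A, B) \<in> charge" if "(v, u) \<in> all_windows" "child v u v' u'"
    "(A, B) \<in> into_child v u v' u' \<union> into_parent v u v' u'" "sees A B" for A B v u v' u'
  proof -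
    have "(v', u') \<in> {(v', u') \<in> all_windows. child v u v' u'}" using all_windows_child that by blast
    then show ?thesis unfolding charge_def using that by blast
  qed
  have sibI: "(A, B) \<in> charge" if "(v, u) \<in> all_windows" "child v u v1 u1" "child v u v2 u2" "(v1, u1) \<noteq> (v2, u2)"
    "(A, B) \<in> into_sibling v u v1 u1 v2 u2" "sees A B" for A B v u v1 u1 v2 u2
  proof -
    have "(v1, u1) \<in> {(v', u') \<in> all_windows. child v u v' u'}"
      "(v2, u2) \<in> {(v2, u2) \<in> all_windows. child v u v2 u2 \<and> (v1, u1) \<noteq> (v2, u2)}"
      using all_windows_child that by blast+
    then show ?thesis unfolding charge_def using that by blast
  qed
  have same: "(A, B) \<in> charge \<or> (B, A) \<in> charge" if "(v, u) \<in> all_windows" "A \<in> body v u" "B \<in> body v u" for v u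
  proof -
    have "(A, B) \<in> same_body v u \<or> (B, A) \<in> same_body v u"
      using that(2,3) by (auto simp: same_body_def)
    then show ?thesis using sameI[OF that(1) _ AB] sameI[OF that(1) _ BA] by blast
  qed
  have through: "(A, B) \<in> charge"
    if "(v, u) \<in> all_windows" "A \<in> body v u" "ht v u B < 0" "- ht v u B \<le> 4 * ht v u A"
      "A + t *\<^sub>R (B - A) \<in> open_segment v u" "sees A B" for A B v u t
  proof -
    have "ht v u (A + t *\<^sub>R (B - A)) = 0" using ht_open_segment[OF that(5)] .
    then have "crossing v u A B = A + t *\<^sub>R (B - A)"
      using crossing_eq(2)[OF _ that(3)] that(2) by (simp add: body_def)
    then have "crossing v u A B \<in> closed_segment v u" using that(5) segment_open_subset_closed by force
    then show ?thesis using that by (intro acrossI[OF that(1)]) (auto simp: across_def)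
  qed
  have parent_child: "(A, B) \<in> charge \<or> (B, A) \<in> charge"
    if w: "(v, u) \<in> all_windows" and ch: "child v u v' u'" and A: "A \<in> body v u" and B: "B \<in> body v' u'"
      and AB: "sees A B" for A B v u v' u'
  proof -
    have BA: "sees B A" using AB by (simp add: closed_segment_commute)
    obtain t where t: "0 < t" "t < 1" "A + t *\<^sub>R (B - A) \<in> open_segment v' u'" "ht v' u' A < 0"
      using child_crossing[OF all_windows_chord[OF w] ch A B AB] .
    have z: "B + (1 - t) *\<^sub>R (A - B) \<in> open_segment v' u'" using t(3) by (simp add: algebra_simps)
    have hB: "ht v' u' B > 0" using B by (simp add: body_def)
    consider "- ht v' u' A \<le> 4 * ht v' u' B" | "- ht v' u' A > 4 * ht v' u' B" "ht v u A \<le> ht v u B"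
      | "- ht v' u' A > 4 * ht v' u' B" "ht v u B \<le> ht v u A" by linarith
    then show ?thesis
    proof cases
      case 1
      then show ?thesis using through[OF all_windows_child[OF w ch] B t(4) 1 z BA] by blast
    next
      case 2
      then have "(B, A) \<in> into_parent v u v' u'" using A B by (simp add: into_parent_def)
      then show ?thesis using childI[OF w ch _ BA] by blast
    next
      case 3
      then have "(A, B) \<in> into_child v u v' u'" using A B hB by (simp add: into_child_def)
      then show ?thesis using childI[OF w ch _ AB] by blast
    qed
  qed
  have siblings: "(A, B) \<in> charge \<or> (B, A) \<in> charge"
    if w: "(v, u) \<in> all_windows" and ch1: "child v u v1 u1" and ch2: "child v u v2 u2" and ne: "(v1, u1) \<noteq> (v2, u2)"
      and A: "A \<in> body v1 u1" and B: "B \<in> body v2 u2" and AB: "sees A B"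
      and le: "ht v u B \<le> ht v u A" for A B v u v1 u1 v2 u2
  proof -
    have BA: "sees B A" using AB by (simp add: closed_segment_commute)
    obtain n where n: "(v, u) \<in> windows a b n" using w by (auto simp: all_windows_def)
    obtain t1 s t2 where t: "0 < t1" "t1 < s" "s < t2" "t2 < 1"
      "A + t1 *\<^sub>R (B - A) \<in> open_segment v1 u1" "A + s *\<^sub>R (B - A) \<in> body v u"
      "A + t2 *\<^sub>R (B - A) \<in> open_segment v2 u2" "ht v1 u1 B < 0" "ht v2 u2 A < 0"
      using sibling_crossing[OF root n ch1 ch2 ne A B AB] .
    have z: "B + (1 - t2) *\<^sub>R (A - B) \<in> open_segment v2 u2" using t(7) by (simp add: algebra_simps)
    have hB: "ht v2 u2 B > 0" using B by (simp add: body_def)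
    consider "- ht v1 u1 B \<le> 4 * ht v1 u1 A" | "- ht v2 u2 A \<le> 4 * ht v2 u2 B"
      | "- ht v1 u1 B > 4 * ht v1 u1 A" "ht v2 u2 B \<le> - ht v2 u2 A" using hB by linarith
    then show ?thesis
    proof cases
      case 1
      then show ?thesis using through[OF all_windows_child[OF w ch1] A t(8) 1 t(5) AB] by blast
    next
      case 2
      then show ?thesis using through[OF all_windows_child[OF w ch2] B t(9) 2 z BA] by blast
    next
      case 3
      then have "(A, B) \<in> into_sibling v u v1 u1 v2 u2" using A B le by (simp add: into_sibling_def)
      then show ?thesis using sibI[OF w ch1 ch2 ne _ AB] by blast
    qed
  qed
  have swapped: "(A, B) \<in> charge \<or> (B, A) \<in> charge" if eq: "vB = uA" "uB = vA"
  proof -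
    have hA: "ht vA uA A > 0" and hB: "ht vA uA B < 0"
      using A(2) B(2) ht_swap[of vB uB B] by (auto simp: body_def eq)
    have c: "chord vA uA" using A(1) by (rule all_windows_chord)
    have cross: "\<exists>t. A + t *\<^sub>R (B - A) \<in> open_segment vA uA"
    proof -
      obtain Y where s: "sides vA uA (pocket vA uA) Y" using pocket_sides[OF c] .
      have "A \<in> pocket vA uA" "B \<in> Y" "pocket vA uA \<inter> Y = {}"
        using A(2) B(2) body_subset_side[OF s] body_subset_side[OF sides_swap[OF s]] s
        by (auto simp: eq sides_def)
      then have "closed_segment A B \<inter> open_segment vA uA \<noteq> {}"
        using connected_in_side[OF s _ AB] by (metis connected_segment disjoint_iff ends_in_segment subsetD)
      then show ?thesis by (auto simp: in_closed_segment_iff)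
    qed
    then obtain t where t: "A + t *\<^sub>R (B - A) \<in> open_segment vA uA" by blast
    have z: "B + (1 - t) *\<^sub>R (A - B) \<in> open_segment vB uB"
      using t by (simp add: eq open_segment_commute algebra_simps)
    \<comment> \<open>Both heights refer to the same line, so the point farther from the chord
      satisfies its inequality even with factor 1.\<close>
    consider "- ht vA uA B \<le> 4 * ht vA uA A" | "- ht vB uB A \<le> 4 * ht vB uB B"
      using hA hB ht_swap[of uA vA] unfolding eq by fastforce
    then show ?thesis
    proof cases
      case 1
      then show ?thesis using through[OF A hB 1 t AB] by blast
    next
      case 2
      have "ht vB uB A < 0" using hA ht_swap[of uA vA A] by (simp add: eq)
      then show ?thesis using through[OF B _ 2 z BA] by blast
    qed
  qed
  obtain n m where nm: "(vA, uA) \<in> windows a b n" "(vB, uB) \<in> windows a b m"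
    using A(1) B(1) by (auto simp: all_windows_def)
  consider "(vA, uA) = (vB, uB)" | "child vA uA vB uB" | "child vB uB vA uA"
    | v u where "(v, u) \<in> all_windows" "child v u vA uA" "child v u vB uB" | "(vB, uB) = (uA, vA)"
    using visible_bodies[OF root nm(1) A(2) nm(2) B(2) AB] unfolding all_windows_def by blast
  then show ?thesis
  proof cases
    case 1
    then show ?thesis using same A B by auto
  next
    case 2
    then show ?thesis using parent_child[OF A(1) 2 A(2) B(2) AB] by blast
  next
    case 3
    then show ?thesis using parent_child[OF B(1) 3 B(2) A(2) BA] by blast
  next
    case 4
    show ?thesis
    proof (cases "(vA, uA) = (vB, uB)")
      case True
      then show ?thesis using same A B by auto
    next
      case False
      have "ht v u B \<le> ht v u A \<or> ht v u A \<le> ht v u B" by linarith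
      then show ?thesis
        using siblings[OF 4 False A(2) B(2) AB] siblings[OF 4(1,3,2) _ B(2) A(2) BA] False by auto
    qed
  next
    case 5
    then show ?thesis using swapped by simp
  qed
qed

end

end

section \<open>The measure of the set of visible pairs\<close>

lemma negligible_ht_line:
  assumes "v \<noteq> u"
  shows "negligible {x. ht v u x = 0}"
proof -
  define n :: "real^2" where "n = vector [- (u - v)$2, (u - v)$1]"
  have "n \<noteq> 0" using assms by (auto simp: n_def vec_eq_iff forall_2)
  moreover have "{x. ht v u x = 0} = {x. n \<bullet> x = n \<bullet> v}"
    by (auto simp: ht_def wedge_def n_def inner_vec_def sum_2 algebra_simps)
  ultimately show ?thesis by (simp add: negligible_hyperplane)
qed

lemma negligible_segment: "negligible (closed_segment v (u :: real^2))"
proof (cases "v = u")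
  case False
  have "closed_segment v u \<subseteq> {x. ht v u x = 0}"
    by (auto simp: in_closed_segment_iff ht_affine')
  then show ?thesis using negligible_ht_line[OF False] negligible_subset by blast
qed simp

lemma emeasure_lborel_eq_0:
  assumes "negligible S" "S \<in> sets borel"
  shows "emeasure lborel S = 0"
  using assms by (simp add: negligible_iff_null_sets null_sets_def)

lemma null_product:
  fixes S :: "(real^2) set"
  assumes "negligible S" "S \<in> sets borel"
  shows "S \<times> (UNIV :: (real^2) set) \<in> null_sets lborel" "(UNIV :: (real^2) set) \<times> S \<in> null_sets lborel"
proof -
  have S: "S \<in> null_sets lborel" using emeasure_lborel_eq_0[OF assms] assms(2) by (simp add: null_sets_def)
  show "S \<times> (UNIV :: (real^2) set) \<in> null_sets lborel"
    using lborel.times_in_null_sets1[OF S, of UNIV] unfolding lborel_prod by simp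
  show "(UNIV :: (real^2) set) \<times> S \<in> null_sets lborel"
    using lborel.times_in_null_sets2[OF _ S, of UNIV lborel] unfolding lborel_prod by simp
qed

context jordan_domain
begin

text \<open>Tonelli: the slice over \<open>A\<close> has area at most 90 times \<open>smc P\<close>,
  and it is empty unless \<open>A\<close> is in a body and hence in \<open>G\<close>. For the
  reversed relation the other coordinate is sliced, which gives the same integral.\<close>

lemma emeasure_charges:
  assumes root: "chord a b"
  shows "emeasure lborel (charge a b) \<le> ennreal (90 * smc P * measure lebesgue P)"
    "emeasure lborel {(A, B). (B, A) \<in> charge a b} \<le> ennreal (90 * smc P * measure lebesgue P)"
    "{(A, B). (B, A) \<in> charge a b} \<in> sets borel"
proof -
  let ?C = "charge a b" and ?s = "smc P"
  have C: "?C \<in> sets (lborel \<Otimes>\<^sub>M lborel)" 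
    using charge_borel[OF root] by (simp only: lborel_prod sets_lborel)
  have slice: "emeasure lborel {B. (A, B) \<in> ?C} \<le> ennreal (90 * ?s) * indicator G A" for A
  proof (cases "\<exists>v u. (v, u) \<in> all_windows a b \<and> A \<in> body v u")
    case True
    then obtain v u where w: "(v, u) \<in> all_windows a b" "A \<in> body v u" by blast
    obtain S where S: "S \<in> lmeasurable" "measure lebesgue S \<le> 89 * ?s" "\<And>B. (A, B) \<in> ?C \<Longrightarrow> B \<in> S"
      using charge_slice[OF root w] by metis
    have "Pair A -` ?C \<in> sets lborel" by (rule sets_Pair1[OF C])
    moreover have "Pair A -` ?C = {B. (A, B) \<in> ?C}" by auto
    ultimately have bor: "{B. (A, B) \<in> ?C} \<in> sets lborel" by simp
    have "emeasure lborel {B. (A, B) \<in> ?C} = emeasure lebesgue {B. (A, B) \<in> ?C}" using bor by simp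
    also have "\<dots> \<le> emeasure lebesgue S" using S by (intro emeasure_mono) (auto dest: fmeasurableD)
    also have "\<dots> = ennreal (measure lebesgue S)" using S(1) by (simp add: emeasure_eq_measure2)
    also have "\<dots> \<le> ennreal (90 * ?s)" using S(2) smc_nonneg by (intro ennreal_leI) linarith
    finally show ?thesis using w(2) body_subset_G by (auto simp: indicator_def)
  next
    case False
    have "(A, B) \<notin> ?C" for B
      using False unfolding charge_def[OF root]
      by (fastforce simp: same_body_def across_def into_child_def into_parent_def into_sibling_def)
    then show ?thesis by simp
  qed
  have G: "G \<in> sets lborel" using G_open by (simp add: borel_open)
  have int: "(\<integral>\<^sup>+A. emeasure lborel {B. (A, B) \<in> ?C} \<partial>lborel) \<le> ennreal (90 * ?s * measure lebesgue P)"
  proof -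
    have "(\<integral>\<^sup>+A. emeasure lborel {B. (A, B) \<in> ?C} \<partial>lborel) \<le> (\<integral>\<^sup>+A. ennreal (90 * ?s) * indicator G A \<partial>lborel)"
      by (intro nn_integral_mono slice)
    also have "\<dots> = ennreal (90 * ?s) * emeasure lborel G" using G by (rule nn_integral_cmult_indicator)
    also have "emeasure lborel G = emeasure lebesgue G" using G by simp
    also have "\<dots> \<le> emeasure lebesgue P" using P_lebesgue G_subset_P by (intro emeasure_mono)
    also have "\<dots> = ennreal (measure lebesgue P)"
      by (intro emeasure_eq_measure2) (simp add: P_compact lmeasurable_compact)
    also have "ennreal (90 * ?s) * ennreal (measure lebesgue P) = ennreal (90 * ?s * measure lebesgue P)"
      using smc_nonneg by (simp add: ennreal_mult)
    finally show ?thesis by (simp add: mult_left_mono)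
  qed
  have eq1: "Pair A -` ?C = {B. (A, B) \<in> ?C}" for A by auto
  have "emeasure lborel ?C = (\<integral>\<^sup>+A. emeasure lborel {B. (A, B) \<in> ?C} \<partial>lborel)"
    using lborel.emeasure_pair_measure_alt[OF C] unfolding eq1 lborel_prod .
  then show "emeasure lborel ?C \<le> ennreal (90 * ?s * measure lebesgue P)" using int by simp
  let ?C' = "{(A, B). (B, A) \<in> ?C}"
  have "?C' = prod.swap -` ?C \<inter> space borel" by auto
  also have "\<dots> \<in> sets borel"
    by (rule measurable_sets[OF _ charge_borel[OF root]])
      (intro borel_measurable_continuous_onI continuous_on_swap)
  finally show bor': "?C' \<in> sets borel" .
  then have C': "?C' \<in> sets (lborel \<Otimes>\<^sub>M lborel)" by (simp only: lborel_prod sets_lborel)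
  have eq2: "(\<lambda>x. (x, y)) -` ?C' = {B. (y, B) \<in> ?C}" for y by auto
  have "emeasure lborel ?C' = (\<integral>\<^sup>+y. emeasure lborel {B. (y, B) \<in> ?C} \<partial>lborel)"
    using lborel_pair.emeasure_pair_measure_alt2[OF C'] unfolding eq2 lborel_prod .
  then show "emeasure lborel ?C' \<le> ennreal (90 * ?s * measure lebesgue P)" using int by simp
qed

text \<open>Points of \<open>G\<close> outside all bodies lie on countably many segments, so the
  pairs containing such a point form a null set. Every other visible pair is charged in one of the
  two orders.\<close>

theorem visible_pairs_measure:
  "emeasure lborel {(A, B). sees A B} \<le> ennreal (180 * smc P * measure lebesgue P)"
proof -
  let ?M = "90 * smc P * measure lebesgue P"
  obtain a b where root: "chord a b" by (rule chord_exists)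
  let ?C = "charge a b" and ?C' = "{(A, B). (B, A) \<in> charge a b}"
  define U where "U = (\<Union>(v, u)\<in>all_windows a b. body v u)"
  define E where "E = G - U"
  have "open U" unfolding U_def using body_open by auto
  then have E: "E \<in> sets borel" unfolding E_def using G_open by auto
  have "E \<subseteq> (\<Union>(v, u)\<in>all_windows a b. closed_segment v u)"
  proof
    fix x assume "x \<in> E"
    then have x: "x \<in> covered a b" "x \<notin> U" using covered_eq[OF root] by (auto simp: E_def)
    then show "x \<in> (\<Union>(v, u)\<in>all_windows a b. closed_segment v u)"
      unfolding covered_def[OF root] U_def all_windows_def[OF root]
      using segment_open_subset_closed by fastforce
  qed
  moreover have "negligible (\<Union>(v, u)\<in>all_windows a b. closed_segment v u)"
    by (rule negligible_countable_Union) (use countable_all_windows[OF root] in \<open>auto simp: negligible_segment\<close>)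
  ultimately have nE: "negligible E" by (rule negligible_subset[rotated])
  note N = null_product[OF nE E]
  have "{(A, B). sees A B} \<subseteq> (?C \<union> ?C') \<union> (E \<times> UNIV \<union> UNIV \<times> E)"
  proof
    fix p assume "p \<in> {(A, B). sees A B}"
    then obtain A B where p: "p = (A, B)" and AB: "sees A B" by blast
    have "(A, B) \<in> ?C \<or> (B, A) \<in> ?C" if "A \<in> U" "B \<in> U"
      using charge_complete[OF root _ _ _ _ AB] that unfolding U_def by blast
    moreover have "A \<in> G" "B \<in> G" using AB by auto
    ultimately show "p \<in> (?C \<union> ?C') \<union> (E \<times> UNIV \<union> UNIV \<times> E)" unfolding E_def p by blast
  qed
  then have "emeasure lborel {(A, B). sees A B} \<le>
      emeasure lborel ((?C \<union> ?C') \<union> (E \<times> UNIV \<union> UNIV \<times> E))"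
    by (intro emeasure_mono) (use N charge_borel[OF root] emeasure_charges(3)[OF root] in \<open>auto simp: null_sets_def\<close>)
  also have "\<dots> = emeasure lborel (?C \<union> ?C')"
    by (rule emeasure_Un_null_set) (use N charge_borel[OF root] emeasure_charges(3)[OF root] in auto)
  also have "\<dots> \<le> emeasure lborel ?C + emeasure lborel ?C'"
    by (rule emeasure_subadditive) (use charge_borel[OF root] emeasure_charges(3)[OF root] in auto)
  also have "\<dots> \<le> ennreal ?M + ennreal ?M" by (intro add_mono emeasure_charges root)
  also have "\<dots> = ennreal (180 * smc P * measure lebesgue P)"
    using smc_nonneg by (simp flip: ennreal_plus)
  finally show ?thesis .
qed

end

section \<open>Segments in the polygon that touch its boundary\<close>

lemma path_image_polygonal_path:
  "\<exists>E. finite E \<and> path_image (polygonal_path vs) = (\<Union>(a, b)\<in>E. closed_segment a b)"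
proof (induction vs rule: polygonal_path.induct)
  case 1
  show ?case by (intro exI[of _ "{(0, 0)}"]) simp
next
  case (2 a)
  show ?case by (intro exI[of _ "{(a, a)}"]) simp
next
  case (3 a b)
  show ?case by (intro exI[of _ "{(a, b)}"]) simp
next
  case (4 a b c vs)
  then obtain E where E: "finite E" "path_image (polygonal_path (b # c # vs)) = (\<Union>(a, b)\<in>E. closed_segment a b)"
    by blast
  have "pathstart (polygonal_path (b # c # vs)) = b" by (cases vs) auto
  then have "path_image (polygonal_path (a # b # c # vs)) = closed_segment a b \<union> (\<Union>(a, b)\<in>E. closed_segment a b)"
    using E(2) by (simp add: path_image_join)
  then show ?case using E(1) by (intro exI[of _ "insert (a, b) E"]) simp
qed

text \<open>For each fixed \<open>A\<close> other than \<open>x\<close> the points \<open>B\<close>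
  fill a line, so almost every slice is null.\<close>

lemma null_collinear:
  "{(A, B). wedge (A - x) (B - x) = 0} \<in> null_sets (lborel :: ((real^2) \<times> (real^2)) measure)"
proof -
  let ?S = "{(A, B). wedge (A - x) (B - x) = 0}"
  have "?S = {p. wedge (fst p - x) (snd p - x) = 0}" by auto
  moreover have "closed {p. wedge (fst p - x) (snd p - x) = 0}"
    by (intro closed_Collect_eq continuous_intros)
  ultimately have S: "?S \<in> sets borel" by (simp add: borel_closed)
  then have S': "?S \<in> sets (lborel \<Otimes>\<^sub>M lborel)" by (simp only: lborel_prod sets_lborel)
  have "emeasure lborel (Pair A -` ?S) = 0" if "A \<noteq> x" for A
  proof (rule emeasure_lborel_eq_0)
    have "Pair A -` ?S = {B. ht x A B = 0}" by (auto simp: ht_def)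
    then show "negligible (Pair A -` ?S)" using negligible_ht_line[of x A] that by simp
    show "Pair A -` ?S \<in> sets borel" using sets_Pair1[OF S'] by simp
  qed
  moreover have "AE A in lborel. A \<noteq> x" by (rule AE_lborel_singleton)
  ultimately have "AE A in lborel. emeasure lborel (Pair A -` ?S) = 0" by auto
  then have "(\<integral>\<^sup>+A. emeasure lborel (Pair A -` ?S) \<partial>lborel) = (\<integral>\<^sup>+A. 0 \<partial>(lborel :: (real^2) measure))"
    by (rule nn_integral_cong_AE)
  then have "emeasure lborel ?S = 0"
    using lborel.emeasure_pair_measure_alt[OF S'] by (simp add: lborel_prod)
  then show ?thesis using S by (simp add: null_sets_def)
qed

context jordan_domain
begin

text \<open>Suppose the segment touches the curve at \<open>x\<close>. By genericity all edges
  through \<open>x\<close> are parallel, so near \<open>x\<close> the curve lies on one line, with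
  \<open>A\<close> and \<open>B\<close> strictly on opposite sides. Each half disc at
  \<open>x\<close> misses the curve and contains a point of the segment, hence lies in
  \<open>G\<close>. Near \<open>x\<close> only points of that line can then be missing from
  \<open>P\<close>, which is impossible as \<open>x\<close> is a limit of the open complement of
  \<open>P\<close>.\<close>

lemma segment_in_G_if_generic:
  assumes E: "finite E" "path_image c = (\<Union>(a, b)\<in>E. closed_segment a b)"
    and AB: "closed_segment A B \<subseteq> P" and ends: "A \<notin> path_image c" "B \<notin> path_image c"
    and vertex: "\<And>a b. (a, b) \<in> E \<Longrightarrow> wedge (A - a) (B - a) \<noteq> 0 \<and> wedge (A - b) (B - b) \<noteq> 0"
    and cross: "\<And>a b a' b' x. (a, b) \<in> E \<Longrightarrow> (a', b') \<in> E \<Longrightarrow> wedge (b - a) (b' - a') \<noteq> 0 \<Longrightarrow>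
      x \<in> closed_segment a b \<Longrightarrow> x \<in> closed_segment a' b' \<Longrightarrow> wedge (A - x) (B - x) \<noteq> 0"
  shows "sees A B"
proof (rule ccontr)
  assume "\<not> sees A B"
  then obtain x where x: "x \<in> closed_segment A B" "x \<notin> G" by blast
  then have xc: "x \<in> path_image c" using AB by (auto simp: P_def G_def)
  then obtain a b where e: "(a, b) \<in> E" "x \<in> closed_segment a b" using E(2) by auto
  obtain t where t: "0 \<le> t" "t \<le> 1" "x = A + t *\<^sub>R (B - A)" using x(1) by (auto simp: in_closed_segment_iff)
  have "t \<noteq> 0" "t \<noteq> 1" using t(3) xc ends by auto
  then have t01: "0 < t" "t < 1" using t by auto
  have col: "wedge (A - x) (B - x) = 0"
  proof -
    have "A - x = (- t) *\<^sub>R (B - A)" "B - x = (1 - t) *\<^sub>R (B - A)" by (simp_all add: t(3) algebra_simps)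
    then show ?thesis by (simp only: wedge_simps)
  qed
  \<comment> \<open>A degenerate edge would be the single point \<open>x = a\<close>, which
    \<open>vertex\<close> excludes.\<close>
  have ab: "a \<noteq> b" using e vertex[OF e(1)] col by auto
  have hx: "ht a b x = 0" using e(2) by (auto simp: in_closed_segment_iff ht_affine')
  define F where "F = {(c, d) \<in> E. x \<notin> closed_segment c d}"
  have "closed (\<Union>(c, d)\<in>F. closed_segment c d)"
  proof (rule closed_UN)
    show "finite F" unfolding F_def by (rule finite_subset[OF _ E(1)]) auto
  qed auto
  then have "open (- (\<Union>(c, d)\<in>F. closed_segment c d))" by blast
  moreover have "x \<in> - (\<Union>(c, d)\<in>F. closed_segment c d)" by (auto simp: F_def)
  ultimately obtain \<epsilon> where eps: "\<epsilon> > 0" "ball x \<epsilon> \<subseteq> - (\<Union>(c, d)\<in>F. closed_segment c d)"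
    by (rule openE)
  have line: "ht a b y = 0" if y: "y \<in> ball x \<epsilon>" "y \<in> path_image c" for y
  proof -
    obtain p q where pq: "(p, q) \<in> E" "y \<in> closed_segment p q" using y(2) E(2) by auto
    have "(p, q) \<notin> F" using eps(2) y(1) pq(2) by blast
    then have xpq: "x \<in> closed_segment p q" using pq(1) by (simp add: F_def)
    then have w: "wedge (b - a) (q - p) = 0" using cross[OF e(1) pq(1) _ e(2) xpq] col by blast
    obtain r r' where rr: "y = p + r *\<^sub>R (q - p)" "x = p + r' *\<^sub>R (q - p)"
      using pq(2) xpq unfolding in_closed_segment_iff by blast
    have "y = x + (r - r') *\<^sub>R (q - p)" unfolding rr by (simp add: algebra_simps)
    then have "ht a b y = ht a b x + (r - r') * wedge (b - a) (q - p)"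
      by (simp add: ht_def wedge_add_right wedge_diff_right)
    then show ?thesis using w hx by simp
  qed
  have hAB: "(1 - t) * ht a b A + t * ht a b B = 0" using hx unfolding t(3) ht_affine' .
  have hA: "ht a b A \<noteq> 0"
  proof
    assume hA: "ht a b A = 0"
    then have hB: "ht a b B = 0" using hAB t01 by simp
    obtain r r' where "A = a + r *\<^sub>R (b - a)" "B = a + r' *\<^sub>R (b - a)"
      using hA hB ht_eq_0_iff[OF ab] by blast
    then have "wedge (A - a) (B - a) = 0" by simp
    then show False using vertex[OF e(1)] by blast
  qed
  have sub: "D \<subseteq> G" if D: "connected D" "D \<inter> path_image c = {}" "D \<inter> G \<noteq> {}" for D
  proof -
    have "D \<inter> frontier G = {}" using D(2) frontier_G by simp
    then show ?thesis using connected_Int_frontier[OF D(1,3)] by blast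
  qed
  have half: "ball x \<epsilon> \<inter> {y. ht p q y > 0} \<subseteq> G"
    if pq: "(p = a \<and> q = b) \<or> (p = b \<and> q = a)" and w: "ht p q w > 0" "w = A \<or> w = B" for p q w
  proof (rule sub)
    have hpx: "ht p q x = 0" using hx pq ht_swap[of a b x] by auto
    show "connected (ball x \<epsilon> \<inter> {y. ht p q y > 0})"
      by (intro convex_connected convex_Int convex_ht_gt) simp
    have off: "y \<notin> path_image c" if "y \<in> ball x \<epsilon>" "ht p q y > 0" for y
      using line[OF that(1)] that(2) pq ht_swap[of a b y] by auto
    then show "ball x \<epsilon> \<inter> {y. ht p q y > 0} \<inter> path_image c = {}" by blast
    obtain s where s: "0 < s" "s < 1" "x + s *\<^sub>R (w - x) \<in> ball x \<epsilon>"
      using segment_point_near[OF eps(1)] by blast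
    have pos: "ht p q (x + s *\<^sub>R (w - x)) > 0" using s w hpx by (simp add: ht_affine')
    have "closed_segment x w \<subseteq> closed_segment A B" using x(1) w(2) by (auto simp: subset_closed_segment)
    moreover have "x + s *\<^sub>R (w - x) \<in> closed_segment x w" unfolding in_closed_segment_iff using s by (intro exI[of _ s]) auto
    ultimately have "x + s *\<^sub>R (w - x) \<in> P" using AB by blast
    then have "x + s *\<^sub>R (w - x) \<in> G" using off[OF s(3) pos] by (auto simp: P_def G_def)
    then show "ball x \<epsilon> \<inter> {y. ht p q y > 0} \<inter> G \<noteq> {}" using s(3) pos by blast
  qed
  have both: "ball x \<epsilon> \<inter> {y. ht a b y > 0} \<subseteq> G" "ball x \<epsilon> \<inter> {y. ht b a y > 0} \<subseteq> G"
  proof -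
    have "ht a b A > 0 \<and> ht a b B < 0 \<or> ht a b A < 0 \<and> ht a b B > 0"
    proof (cases "ht a b A > 0")
      case True
      then have "(1 - t) * ht a b A > 0" using t01 by simp
      then have "t * ht a b B < 0" using hAB by linarith
      then show ?thesis using True t01 by (simp add: mult_less_0_iff)
    next
      case False
      then have "ht a b A < 0" using hA by simp
      then have "(1 - t) * ht a b A < 0" using t01 by (simp add: mult_pos_neg)
      then have "t * ht a b B > 0" using hAB by linarith
      then show ?thesis using \<open>ht a b A < 0\<close> t01 by (simp add: zero_less_mult_iff)
    qed
    then show "ball x \<epsilon> \<inter> {y. ht a b y > 0} \<subseteq> G" "ball x \<epsilon> \<inter> {y. ht b a y > 0} \<subseteq> G"
      using half[of a b A] half[of a b B] half[of b a A] half[of b a B] ht_swap[of b a] by auto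
  qed
  have "x \<in> frontier P"
  proof -
    have "x \<in> P" using xc by (simp add: P_def)
    then show ?thesis using x(2) by (simp add: frontier_def interior_P closure_closed[OF P_closed])
  qed
  then have "x \<in> closure (- P)" by (simp add: frontier_closures)
  then obtain y where y: "y \<in> - P" "y \<in> ball x \<epsilon>"
    using eps(1) unfolding closure_approachable by (auto simp: dist_commute)
  have "open (- P \<inter> ball x \<epsilon>)" using P_closed by (auto intro!: open_Int)
  then obtain \<delta> where d: "\<delta> > 0" "ball y \<delta> \<subseteq> - P \<inter> ball x \<epsilon>"
    by (rule openE) (use y in blast)
  have "ht a b z = 0" if "z \<in> ball y \<delta>" for z
  proof (rule ccontr)
    assume "ht a b z \<noteq> 0"
    then have "ht a b z > 0 \<or> ht b a z > 0" using ht_swap[of b a z] by linarith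
    moreover have "z \<in> ball x \<epsilon>" using d(2) that by blast
    ultimately have "z \<in> G" using both by blast
    then show False using d(2) that G_subset_P by blast
  qed
  moreover have "ball y \<delta> \<inter> {z. ht a b z > 0} \<noteq> {}"
    using ball_meets_halfplane[OF ab _ d(1)] calculation[of y] d(1) by simp
  ultimately show False by fastforce
qed

end

theorem corollary1p4:
  fixes P :: "(real^2) set"
  assumes "simple_polygon P"
  shows "beer_index P \<le> 180 * convexity_ratio P"
proof -
  obtain vs where vs: "simple_path (polygonal_path vs)"
    "pathfinish (polygonal_path vs) = pathstart (polygonal_path vs)"
    "P = path_image (polygonal_path vs) \<union> inside (path_image (polygonal_path vs))"
    using assms unfolding simple_polygon_def by blast
  interpret J: jordan_domain "polygonal_path vs" using vs by unfold_locales
  have P: "J.P = P" by (simp add: J.P_def vs(3))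
  obtain E where E: "finite E" "path_image (polygonal_path vs) = (\<Union>(a, b)\<in>E. closed_segment a b)"
    using path_image_polygonal_path by metis
  let ?c = "path_image (polygonal_path vs)"
  \<comment> \<open>Two edges that are not parallel share at most one point, so \<open>X\<close> is
    finite. The same condition excludes an edge paired with itself.\<close>
  define X where "X = {x. \<exists>(a, b)\<in>E. \<exists>(a', b')\<in>E. wedge (b - a) (b' - a') \<noteq> 0 \<and>
    x \<in> closed_segment a b \<and> x \<in> closed_segment a' b'}"
  define F where "F = fst ` E \<union> snd ` E \<union> X"
  have "finite X"
  proof -
    have one: "finite {x. wedge (b - a) (b' - a') \<noteq> 0 \<and> x \<in> closed_segment a b \<and> x \<in> closed_segment a' b'}"
      (is "finite ?Y") for a b a' b'
    proof -
      have "x = y" if xy: "x \<in> ?Y" "y \<in> ?Y" for x y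
      proof -
        have diff: "\<exists>r. x - y = r *\<^sub>R (q - p)" if pq: "x \<in> closed_segment p q" "y \<in> closed_segment p q" for p q
        proof -
          obtain r r' where rr: "x = p + r *\<^sub>R (q - p)" "y = p + r' *\<^sub>R (q - p)"
            using pq unfolding in_closed_segment_iff by blast
          have "x - y = (r - r') *\<^sub>R (q - p)" unfolding rr by (simp add: algebra_simps)
          then show ?thesis by blast
        qed
        obtain r where r: "x - y = r *\<^sub>R (b - a)" using diff[of a b] xy by blast
        obtain s where s: "x - y = s *\<^sub>R (b' - a')" using diff[of a' b'] xy by blast
        have "wedge (b - a) (x - y) = 0" unfolding r by simp
        then have "s * wedge (b - a) (b' - a') = 0" unfolding s by simp
        then show ?thesis using xy s by simp
      qed
      then have "?Y \<subseteq> {SOME x. x \<in> ?Y}" by (metis (mono_tags, lifting) insertI1 someI subsetI)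
      then show ?thesis using finite_subset by blast
    qed
    have "X = (\<Union>(a, b)\<in>E. \<Union>(a', b')\<in>E. {x. wedge (b - a) (b' - a') \<noteq> 0 \<and> x \<in> closed_segment a b \<and> x \<in> closed_segment a' b'})"
      unfolding X_def by auto
    then show ?thesis using E(1) one by auto
  qed
  then have F: "finite F" using E(1) by (simp add: F_def)
  \<comment> \<open>Off this null set the hypotheses of \<open>segment_in_G_if_generic\<close>
    hold.\<close>
  define N where "N = ?c \<times> UNIV \<union> UNIV \<times> ?c \<union> (\<Union>x\<in>F. {(A, B). wedge (A - x) (B - x) = 0})"
  have "negligible ?c" unfolding E(2) using E(1) by (intro negligible_Union) (auto simp: negligible_segment)
  moreover have "?c \<in> sets borel" using vs(1) by (simp add: borel_closed closed_simple_path_image)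
  ultimately have N: "N \<in> null_sets lborel" unfolding N_def
    using null_product[of ?c] null_collinear F by (intro null_sets.Un null_sets.finite_UN) auto
  let ?V = "{(A, B). closed_segment A B \<subseteq> J.G}"
  have sub: "Seg P \<subseteq> ?V \<union> N"
  proof
    fix p assume "p \<in> Seg P"
    then obtain A B where p: "p = (A, B)" and AB: "closed_segment A B \<subseteq> P" by (auto simp: Seg_def)
    show "p \<in> ?V \<union> N"
    proof (cases "p \<in> N")
      case False
      then have n: "A \<notin> ?c" "B \<notin> ?c" "\<And>x. x \<in> F \<Longrightarrow> wedge (A - x) (B - x) \<noteq> 0"
        by (auto simp: N_def p)
      have "closed_segment A B \<subseteq> J.G"
      proof (rule J.segment_in_G_if_generic[OF E _ n(1,2)])
        show "closed_segment A B \<subseteq> J.P" using AB P by simp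
        show "wedge (A - a) (B - a) \<noteq> 0 \<and> wedge (A - b) (B - b) \<noteq> 0" if "(a, b) \<in> E" for a b
          using n(3) that by (force simp: F_def)
        show "wedge (A - x) (B - x) \<noteq> 0"
          if "(a, b) \<in> E" "(a', b') \<in> E" "wedge (b - a) (b' - a') \<noteq> 0" "x \<in> closed_segment a b" "x \<in> closed_segment a' b'"
          for a b a' b' x
          using that unfolding F_def X_def by (intro n(3)) (unfold F_def X_def, blast)
      qed
      then show ?thesis by (simp add: p)
    qed blast
  qed
  have V: "?V \<in> sets lborel" using open_segments_visible[OF J.G_open] by (simp add: borel_open)
  have "closed (Seg P)" by (intro closed_Seg compact_imp_closed compact_simple_polygon assms)
  then have S: "Seg P \<in> sets lborel" by (simp add: borel_closed)
  have "emeasure lebesgue (Seg P) = emeasure lborel (Seg P)" using S by simp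
  also have "\<dots> \<le> emeasure lborel (?V \<union> N)" using sub V N by (intro emeasure_mono) auto
  also have "\<dots> = emeasure lborel ?V" using V N by (rule emeasure_Un_null_set)
  also have "\<dots> \<le> ennreal (180 * smc P * measure lebesgue P)" using J.visible_pairs_measure unfolding P .
  finally have "measure lebesgue (Seg P) \<le> 180 * smc P * measure lebesgue P"
    unfolding measure_def using J.smc_nonneg unfolding P
    by (metis enn2real_leI measure_def measure_nonneg mult_nonneg_nonneg zero_le_numeral)
  then have "measure lebesgue (Seg P) / (measure lebesgue P)\<^sup>2 \<le> 180 * smc P * measure lebesgue P / (measure lebesgue P)\<^sup>2"
    by (intro divide_right_mono) auto
  \<comment> \<open>The cancellation covers \<open>measure lebesgue P = 0\<close> as well: division
    by 0 gives 0, so both sides would be 0.\<close>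
  also have "\<dots> = 180 * (smc P / measure lebesgue P)" by (simp add: power2_eq_square)
  finally show ?thesis by (simp add: beer_index_def convexity_ratio_def)
qed

end
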